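(* Let $\mathcal C$ be a ribbon $\Bbbk$-category with finite-dimensional Hom spaces such that the functor $(X,Y)\mapsto X^*\otimes Y$ of $\mathcal C$ admits a coend $(A,i)$. Let $\pi:\mathcal C\to\mathcal C^{s}$ be its semisimplification, and let $\mathcal B$ be a full ribbon and abelian subcategory of $\mathcal C^s$ which is semisimple, has finitely many isomorphism classes of simple objects, and whose simple objects are scalar. Let $(B,j)$ be the coend of $\mathcal B$ and $\varphi:B\to\pi(A)$ the morphism described in the context. Let $\beta\in\mathrm{Hom}_{\mathcal B}(\mathbf 1,B)$ and $\alpha\in\mathrm{Hom}_{\mathcal C}(\mathbf 1,A)$ be such that $\pi(\alpha)=\varphi\beta$. (a) If $\beta\in\mathcal I(\mathcal B)$, then $\alpha\in\mathcal I(\mathcal C)$ and $\tau_{\mathcal C}(L;\alpha)=\tau_{\mathcal B}(L;\beta)$ for any framed link $L$. (b) If $\beta\in\mathcal I(\mathcal B)^{\mathrm{norm}}$, then $\alpha\in\mathcal I(\mathcal C)^{\mathrm{norm}}$ and $\tau_{\mathcal C}(M;\alpha)=\tau_{\mathcal B}(M;\beta)$ for any 3-manifold $M$.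
   Context: **Ribbon $\Bbbk$-categories.** $\Bbbk$ is a field. Monoidal categories are taken strict. A ribbon category is a monoidal category with unit $\mathbf 1$, a left duality ($X^*$, $\mathrm{ev}_X:X^*\otimes X\to\mathbf 1$, $\mathrm{coev}_X:\mathbf 1\to X\otimes X^*$; $\mathbf 1^*=\mathbf 1$), a braiding $c_{X,Y}$, and a twist $\theta_X$ (natural isomorphisms with $\theta_{X\otimes Y}=c_{Y,X}c_{X,Y}(\theta_X\otimes\theta_Y)$ and $\theta_{X^*}=(\theta_X)^*$). A ribbon $\Bbbk$-category is a ribbon category whose Hom-sets are $\Bbbk$-vector spaces, with bilinear composition and tensor product, and with $\mathrm{End}(\mathbf 1)=\Bbbk$. Put $\widetilde{\mathrm{ev}}_X=\mathrm{ev}_X c_{X,X^*}(\theta_X\otimes\mathrm{id}_{X^*})$, $\widetilde{\mathrm{coev}}_X=(\mathrm{id}_{X^*}\otimes\theta_X^{-1})(c_{X^*,X})^{-1}\mathrm{coev}_X$, $\mathrm{tr}_q(f)=\widetilde{\mathrm{ev}}_X(f\otimes\mathrm{id}_{X^*})\mathrm{coev}_X\in\Bbbk$ for $f\in\mathrm{End}(X)$. A morphism $f:X\to Y$ is negligible if $\mathrm{tr}_q(gf)=0$ for all $g:Y\to X$; $\mathrm{Negl}_{\mathcal C}(X,Y)$ is the space of negligible morphisms. A full ribbon and abelian subcategory is a full subcategory containing $\mathbf 1$, closed under tensor product and duality, and which is abelian. An object $X$ is scalar if $\mathrm{End}(X)=\Bbbk$. **Coend and $\mathcal I$.** For a ribbon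 $\Bbbk$-category $\mathcal C$ with a coend $(A,i)$ of $(X,Y)\mapsto X^*\otimes Y$ (universal dinatural family $i_X:X^*\otimes X\to A$), $A$ is a Hopf algebra with: $\Delta_A i_X=(i_X\otimes i_X)(\mathrm{id}\otimes\mathrm{coev}_X\otimes\mathrm{id})$; $\varepsilon_A i_X=\mathrm{ev}_X$; $\eta_A=i_{\mathbf 1}$; $m_A(i_X\otimes i_Y)=i_{Y\otimes X}(\gamma_{X,Y}\otimes\mathrm{id}_{Y\otimes X})(\mathrm{id}_{X^*}\otimes c_{X,Y^*\otimes Y})$ with $\gamma_{X,Y}:X^*\otimes Y^*\to(Y\otimes X)^*$ canonical; $S_A i_X=i_{X^*}(\beta_X\otimes\theta_{X^*})c_{X^*,X}$ with $\beta_X=(\widetilde{\mathrm{ev}}_X\otimes\mathrm{id}_{X^{**}})(\mathrm{id}_X\otimes\mathrm{coev}_{X^*})$. Put $\Gamma_l=(\mathrm{id}_A\otimes m_A)(\Delta_A\otimes\mathrm{id}_A)$ and let $\Theta_\pm:A\to\mathbf 1$ be given by $\Theta_\pm i_X=\mathrm{ev}_X(\mathrm{id}_{X^*}\otimes\theta_X^{\pm1})$. $\mathcal I(\mathcal C)$ is the set of $\alpha\in\mathrm{Hom}(\mathbf 1,A)$ such that $S_A\alpha-\alpha$ and $\Gamma_l(\alpha\otimes\alpha)-\alpha\otimes\alpha$ are negligible; $\mathcal I(\mathcal C)^{\mathrm{norm}}$ is the set of $\alpha\in\mathcal I(\mathcal C)$ with $\Theta_+\alpha\neq0$ and $\Theta_-\alpha\neq0$.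 **Invariants.** An $n$-special tangle is an oriented framed tangle $T\subset\mathbb R^2\times[0,1]$ with $2n$ bottom endpoints, no top endpoints, consisting of $n$ arcs, the $k$-th joining the $(2k-1)$-th and $2k$-th bottom endpoints and oriented out of $\mathbb R^2\times[0,1]$ near the $2k$-th one. $T_{(X_1,\dots,X_n)}:X_1^*\otimes X_1\otimes\cdots\otimes X_n^*\otimes X_n\to\mathbf 1$ is the morphism represented by $T$ with $k$-th component coloured by $X_k$ (diagrams read bottom to top, downward arrows coloured $X$ standing for $\mathrm{id}_X$, upward ones for $\mathrm{id}_{X^*}$), and $\phi_T:A^{\otimes n}\to\mathbf 1$ is the unique morphism with $T_{(X_1,\dots,X_n)}=\phi_T(i_{X_1}\otimes\cdots\otimes i_{X_n})$. For a framed link $L\subset S^3$ with $n$ components (oriented arbitrarily) choose an $n$-special tangle $T_L$ with $L$ isotopic to $T_L\circ(\cup_-\otimes\cdots\otimes\cup_-)$, $\cup_-$ the clockwise oriented cup; $\tau_{\mathcal C}(L;\alpha)=\phi_{T_L}\alpha^{\otimes n}$ (independent of choices for $\alpha\in\mathcal I(\mathcal C)$). All 3-manifolds are closed, connected, oriented; $M_L$ is obtained from $S^3$ by surgery along $L$, $n_L$ is the number of components of $L$, $b_-(L)$ the number of negative eigenvalues of its linking matrix. For $\alpha\in\mathcal I(\mathcal C)^{\mathrm{norm}}$, $\tau_{\mathcal C}(M_L;\alpha)=(\Theta_+\alpha)^{b_-(L)-n_L}(\Theta_-\alpha)^{-b_-(L)}\tau_{\mathcal C}(L;\alpha)$ is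 an invariant of 3-manifolds. **Semisimplification and $\varphi$.** $\mathcal C^s$ has the same objects as $\mathcal C$ and $\mathrm{Hom}_{\mathcal C^s}(X,Y)=\mathrm{Hom}_{\mathcal C}(X,Y)/\mathrm{Negl}_{\mathcal C}(X,Y)$, with composition, monoidal structure, braiding, twist and duality induced from $\mathcal C$; $\pi:\mathcal C\to\mathcal C^s$ is the identity on objects and the quotient map on morphisms. Let $\Lambda$ be a finite set of representatives of isomorphism classes of simple objects of $\mathcal B$ containing $\mathbf 1$; for $\lambda\in\Lambda$ let $\pi^{-1}(\lambda)$ be the unique object of $\mathcal C$ with $\pi(\pi^{-1}(\lambda))=\lambda$. $B=\bigoplus_{\lambda\in\Lambda}\lambda^*\otimes\lambda$ with projections $p_\lambda:B\to\lambda^*\otimes\lambda$ and injections $q_\lambda$. For $X\simeq\bigoplus_k\lambda_k$ in $\mathcal B$ with projections $p_k:X\to\lambda_k$ and injections $q_k:\lambda_k\to X$, $j_X=\sum_kq_{\lambda_k}(q_k^*\otimes p_k):X^*\otimes X\to B$; $(B,j)$ is a coend of $(X,Y)\mapsto X^*\otimes Y$ on $\mathcal B$. Finally $\varphi=\sum_{\lambda\in\Lambda}\pi(i_{\pi^{-1}(\lambda)})\,p_\lambda\in\mathrm{Hom}_{\mathcal C^s}(B,\pi(A))$. *)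

theory Defs
  imports
    "Jordan_Normal_Form.Char_Poly"
    "HOL-Algebra.FiniteProduct"
    "HOL-Combinatorics.Permutations"
    "HOL-Analysis.Analysis"
begin

section \<open>Ribbon categories over a field\<close>

record ('o, 'm, 'k) rcat =
  Obj :: "'o set"
  Mor :: "'m set"
  Dom :: "'m \<Rightarrow> 'o"
  Cod :: "'m \<Rightarrow> 'o"
  Idm :: "'o \<Rightarrow> 'm"
  Cmp :: "'m \<Rightarrow> 'm \<Rightarrow> 'm" (infixr \<open>\<cdot>\<index>\<close> 70)
  TUnit :: 'o (\<open>\<I>\<index>\<close>)
  TOb :: "'o \<Rightarrow> 'o \<Rightarrow> 'o" (infixr \<open>\<diamondop>\<index>\<close> 75)
  TMo :: "'m \<Rightarrow> 'm \<Rightarrow> 'm" (infixr \<open>\<star>\<index>\<close> 75)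
  Dual :: "'o \<Rightarrow> 'o"
  Ev :: "'o \<Rightarrow> 'm"
  Coev :: "'o \<Rightarrow> 'm"
  Braid :: "'o \<Rightarrow> 'o \<Rightarrow> 'm"
  Twist :: "'o \<Rightarrow> 'm"
  Zer :: "'o \<Rightarrow> 'o \<Rightarrow> 'm"
  Add :: "'m \<Rightarrow> 'm \<Rightarrow> 'm"
  Scl :: "'k \<Rightarrow> 'm \<Rightarrow> 'm"

definition Hom :: "('o, 'm, 'k) rcat \<Rightarrow> 'o \<Rightarrow> 'o \<Rightarrow> 'm set" where
  "Hom C X Y = {f \<in> Mor C. Dom C f = X \<and> Cod C f = Y}"

definition hom_group :: "('o, 'm, 'k) rcat \<Rightarrow> 'o \<Rightarrow> 'o \<Rightarrow> 'm monoid" where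
  "hom_group C X Y = \<lparr>carrier = Hom C X Y, mult = Add C, one = Zer C X Y\<rparr>"

definition msum :: "('o, 'm, 'k) rcat \<Rightarrow> 'o \<Rightarrow> 'o \<Rightarrow> ('i \<Rightarrow> 'm) \<Rightarrow> 'i set \<Rightarrow> 'm" where
  "msum C X Y f I = finprod (hom_group C X Y) f I"

definition msub :: "('o, 'm, 'k::field) rcat \<Rightarrow> 'm \<Rightarrow> 'm \<Rightarrow> 'm" where
  "msub C f g = Add C f (Scl C (- 1) g)"

definition inverse_mor :: "('o, 'm, 'k) rcat \<Rightarrow> 'm \<Rightarrow> 'm \<Rightarrow> bool" where
  "inverse_mor C f g \<longleftrightarrow> g \<in> Hom C (Cod C f) (Dom C f) \<and>
     g \<cdot>\<^bsub>C\<^esub> f = Idm C (Dom C f) \<and> f \<cdot>\<^bsub>C\<^esub> g = Idm C (Cod C f)"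

definition iso_mor :: "('o, 'm, 'k) rcat \<Rightarrow> 'm \<Rightarrow> bool" where
  "iso_mor C f \<longleftrightarrow> f \<in> Mor C \<and> (\<exists>g. inverse_mor C f g)"

definition minv :: "('o, 'm, 'k) rcat \<Rightarrow> 'm \<Rightarrow> 'm" where
  "minv C f = (THE g. inverse_mor C f g)"

definition dual_mor :: "('o, 'm, 'k) rcat \<Rightarrow> 'm \<Rightarrow> 'm" where
  "dual_mor C f = (let X = Dom C f; Y = Cod C f in
     (Ev C Y \<star>\<^bsub>C\<^esub> Idm C (Dual C X))
     \<cdot>\<^bsub>C\<^esub> (Idm C (Dual C Y) \<star>\<^bsub>C\<^esub> f \<star>\<^bsub>C\<^esub> Idm C (Dual C X))
     \<cdot>\<^bsub>C\<^esub> (Idm C (Dual C Y) \<star>\<^bsub>C\<^esub> Coev C X))"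

text \<open>An object is scalar if its only endomorphisms are the multiples of the identity,
  without identification of distinct multiples.\<close>

definition scalar_object :: "('o, 'm, 'k) rcat \<Rightarrow> 'o \<Rightarrow> bool" where
  "scalar_object C X \<longleftrightarrow> bij_betw (\<lambda>a. Scl C a (Idm C X)) UNIV (Hom C X X)"

locale ribbon_k_category =
  fixes C :: "('o, 'm, 'k::field) rcat" (structure)
  assumes dom_obj: "f \<in> Mor C \<Longrightarrow> Dom C f \<in> Obj C"
    and cod_obj: "f \<in> Mor C \<Longrightarrow> Cod C f \<in> Obj C"
    and id_hom: "X \<in> Obj C \<Longrightarrow> Idm C X \<in> Hom C X X"
    and cmp_hom: "\<lbrakk>f \<in> Hom C X Y; g \<in> Hom C Y Z\<rbrakk> \<Longrightarrow> g \<cdot> f \<in> Hom C X Z"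
    and cmp_assoc: "\<lbrakk>f \<in> Hom C X Y; g \<in> Hom C Y Z; h \<in> Hom C Z W\<rbrakk>
          \<Longrightarrow> (h \<cdot> g) \<cdot> f = h \<cdot> (g \<cdot> f)"
    and cmp_id_right: "f \<in> Hom C X Y \<Longrightarrow> f \<cdot> Idm C X = f"
    and cmp_id_left: "f \<in> Hom C X Y \<Longrightarrow> Idm C Y \<cdot> f = f"
    \<comment> \<open>strict monoidal structure\<close>
    and unit_obj: "\<I> \<in> Obj C"
    and ten_obj: "\<lbrakk>X \<in> Obj C; Y \<in> Obj C\<rbrakk> \<Longrightarrow> X \<diamondop> Y \<in> Obj C"
    and ten_obj_assoc: "\<lbrakk>X \<in> Obj C; Y \<in> Obj C; Z \<in> Obj C\<rbrakk>
          \<Longrightarrow> (X \<diamondop> Y) \<diamondop> Z = X \<diamondop> (Y \<diamondop> Z)"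
    and ten_obj_unit: "X \<in> Obj C \<Longrightarrow> \<I> \<diamondop> X = X" "X \<in> Obj C \<Longrightarrow> X \<diamondop> \<I> = X"
    and ten_hom: "\<lbrakk>f \<in> Hom C X Y; g \<in> Hom C Z W\<rbrakk> \<Longrightarrow> f \<star> g \<in> Hom C (X \<diamondop> Z) (Y \<diamondop> W)"
    and ten_id: "\<lbrakk>X \<in> Obj C; Y \<in> Obj C\<rbrakk> \<Longrightarrow> Idm C X \<star> Idm C Y = Idm C (X \<diamondop> Y)"
    and ten_cmp: "\<lbrakk>f \<in> Hom C X Y; g \<in> Hom C Y Z; f' \<in> Hom C X' Y'; g' \<in> Hom C Y' Z'\<rbrakk>
          \<Longrightarrow> (g \<cdot> f) \<star> (g' \<cdot> f') = (g \<star> g') \<cdot> (f \<star> f')"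
    and ten_assoc: "\<lbrakk>f \<in> Mor C; g \<in> Mor C; h \<in> Mor C\<rbrakk> \<Longrightarrow> (f \<star> g) \<star> h = f \<star> (g \<star> h)"
    and ten_unit: "f \<in> Mor C \<Longrightarrow> Idm C \<I> \<star> f = f" "f \<in> Mor C \<Longrightarrow> f \<star> Idm C \<I> = f"
    \<comment> \<open>left duality\<close>
    and dual_obj: "X \<in> Obj C \<Longrightarrow> Dual C X \<in> Obj C"
    and dual_unit: "Dual C \<I> = \<I>"
    and ev_hom: "X \<in> Obj C \<Longrightarrow> Ev C X \<in> Hom C (Dual C X \<diamondop> X) \<I>"
    and coev_hom: "X \<in> Obj C \<Longrightarrow> Coev C X \<in> Hom C \<I> (X \<diamondop> Dual C X)"
    and duality: "X \<in> Obj C \<Longrightarrow>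
          (Idm C X \<star> Ev C X) \<cdot> (Coev C X \<star> Idm C X) = Idm C X"
          "X \<in> Obj C \<Longrightarrow>
          (Ev C X \<star> Idm C (Dual C X)) \<cdot> (Idm C (Dual C X) \<star> Coev C X) = Idm C (Dual C X)"
    \<comment> \<open>braiding\<close>
    and braid_hom: "\<lbrakk>X \<in> Obj C; Y \<in> Obj C\<rbrakk> \<Longrightarrow> Braid C X Y \<in> Hom C (X \<diamondop> Y) (Y \<diamondop> X)"
    and braid_iso: "\<lbrakk>X \<in> Obj C; Y \<in> Obj C\<rbrakk> \<Longrightarrow> iso_mor C (Braid C X Y)"
    and braid_natural: "\<lbrakk>f \<in> Hom C X X'; g \<in> Hom C Y Y'\<rbrakk>
          \<Longrightarrow> Braid C X' Y' \<cdot> (f \<star> g) = (g \<star> f) \<cdot> Braid C X Y"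
    and braid_ten: "\<lbrakk>X \<in> Obj C; Y \<in> Obj C; Z \<in> Obj C\<rbrakk> \<Longrightarrow>
          Braid C X (Y \<diamondop> Z) = (Idm C Y \<star> Braid C X Z) \<cdot> (Braid C X Y \<star> Idm C Z)"
          "\<lbrakk>X \<in> Obj C; Y \<in> Obj C; Z \<in> Obj C\<rbrakk> \<Longrightarrow>
          Braid C (X \<diamondop> Y) Z = (Braid C X Z \<star> Idm C Y) \<cdot> (Idm C X \<star> Braid C Y Z)"
    \<comment> \<open>twist\<close>
    and twist_hom: "X \<in> Obj C \<Longrightarrow> Twist C X \<in> Hom C X X"
    and twist_iso: "X \<in> Obj C \<Longrightarrow> iso_mor C (Twist C X)"
    and twist_natural: "f \<in> Hom C X Y \<Longrightarrow> Twist C Y \<cdot> f = f \<cdot> Twist C X"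
    and twist_ten: "\<lbrakk>X \<in> Obj C; Y \<in> Obj C\<rbrakk> \<Longrightarrow>
          Twist C (X \<diamondop> Y) = Braid C Y X \<cdot> Braid C X Y \<cdot> (Twist C X \<star> Twist C Y)"
    and twist_dual: "X \<in> Obj C \<Longrightarrow> Twist C (Dual C X) = dual_mor C (Twist C X)"
    \<comment> \<open>linear structure\<close>
    and hom_abelian: "\<lbrakk>X \<in> Obj C; Y \<in> Obj C\<rbrakk> \<Longrightarrow> comm_group (hom_group C X Y)"
    and scl_hom: "f \<in> Hom C X Y \<Longrightarrow> Scl C a f \<in> Hom C X Y"
    and scl_one: "f \<in> Mor C \<Longrightarrow> Scl C 1 f = f"
    and scl_mult: "f \<in> Mor C \<Longrightarrow> Scl C (a * b) f = Scl C a (Scl C b f)"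
    and scl_add_left: "f \<in> Mor C \<Longrightarrow> Scl C (a + b) f = Add C (Scl C a f) (Scl C b f)"
    and scl_add_right: "\<lbrakk>f \<in> Hom C X Y; g \<in> Hom C X Y\<rbrakk>
          \<Longrightarrow> Scl C a (Add C f g) = Add C (Scl C a f) (Scl C a g)"
    and cmp_add: "\<lbrakk>f \<in> Hom C X Y; f' \<in> Hom C X Y; g \<in> Hom C Y Z\<rbrakk>
          \<Longrightarrow> g \<cdot> Add C f f' = Add C (g \<cdot> f) (g \<cdot> f')"
          "\<lbrakk>f \<in> Hom C X Y; g \<in> Hom C Y Z; g' \<in> Hom C Y Z\<rbrakk>
          \<Longrightarrow> Add C g g' \<cdot> f = Add C (g \<cdot> f) (g' \<cdot> f)"
    and cmp_scl: "\<lbrakk>f \<in> Hom C X Y; g \<in> Hom C Y Z\<rbrakk> \<Longrightarrow> g \<cdot> Scl C a f = Scl C a (g \<cdot> f)"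
          "\<lbrakk>f \<in> Hom C X Y; g \<in> Hom C Y Z\<rbrakk> \<Longrightarrow> Scl C a g \<cdot> f = Scl C a (g \<cdot> f)"
    and ten_add: "\<lbrakk>f \<in> Hom C X Y; f' \<in> Hom C X Y; g \<in> Hom C Z W\<rbrakk>
          \<Longrightarrow> Add C f f' \<star> g = Add C (f \<star> g) (f' \<star> g)"
          "\<lbrakk>f \<in> Hom C X Y; g \<in> Hom C Z W; g' \<in> Hom C Z W\<rbrakk>
          \<Longrightarrow> f \<star> Add C g g' = Add C (f \<star> g) (f \<star> g')"
    and ten_scl: "\<lbrakk>f \<in> Mor C; g \<in> Mor C\<rbrakk> \<Longrightarrow> Scl C a f \<star> g = Scl C a (f \<star> g)"
          "\<lbrakk>f \<in> Mor C; g \<in> Mor C\<rbrakk> \<Longrightarrow> f \<star> Scl C a g = Scl C a (f \<star> g)"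
    and unit_scalar: "scalar_object C \<I>"

definition finite_dim_homs :: "('o, 'm, 'k) rcat \<Rightarrow> bool" where
  "finite_dim_homs C \<longleftrightarrow> (\<forall>X\<in>Obj C. \<forall>Y\<in>Obj C. \<exists>S. finite S \<and> S \<subseteq> Hom C X Y \<and>
     (\<forall>f\<in>Hom C X Y. \<exists>a. f = msum C X Y (\<lambda>s. Scl C (a s) s) S))"

text \<open>The identification of \<open>End(\<one>)\<close> with the ground field.\<close>

definition to_scalar :: "('o, 'm, 'k) rcat \<Rightarrow> 'm \<Rightarrow> 'k" where
  "to_scalar C f = (THE a. f = Scl C a (Idm C \<I>\<^bsub>C\<^esub>))"

definition ev_right :: "('o, 'm, 'k) rcat \<Rightarrow> 'o \<Rightarrow> 'm" where
  "ev_right C X = Ev C X \<cdot>\<^bsub>C\<^esub> Braid C X (Dual C X) \<cdot>\<^bsub>C\<^esub> (Twist C X \<star>\<^bsub>C\<^esub> Idm C (Dual C X))"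

definition coev_right :: "('o, 'm, 'k) rcat \<Rightarrow> 'o \<Rightarrow> 'm" where
  "coev_right C X = (Idm C (Dual C X) \<star>\<^bsub>C\<^esub> minv C (Twist C X))
     \<cdot>\<^bsub>C\<^esub> minv C (Braid C (Dual C X) X) \<cdot>\<^bsub>C\<^esub> Coev C X"

definition qtrace :: "('o, 'm, 'k) rcat \<Rightarrow> 'm \<Rightarrow> 'k" where
  "qtrace C f = (let X = Dom C f in
     to_scalar C (ev_right C X \<cdot>\<^bsub>C\<^esub> (f \<star>\<^bsub>C\<^esub> Idm C (Dual C X)) \<cdot>\<^bsub>C\<^esub> Coev C X))"

definition Negl :: "('o, 'm, 'k::field) rcat \<Rightarrow> 'o \<Rightarrow> 'o \<Rightarrow> 'm set" where
  "Negl C X Y = {f \<in> Hom C X Y. \<forall>g\<in>Hom C Y X. qtrace C (g \<cdot>\<^bsub>C\<^esub> f) = 0}"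


section \<open>Semisimplification\<close>

definition proj_mor :: "('o, 'm, 'k::field) rcat \<Rightarrow> 'm \<Rightarrow> 'm set" where
  "proj_mor C f = {g \<in> Hom C (Dom C f) (Cod C f). msub C g f \<in> Negl C (Dom C f) (Cod C f)}"

definition rep_mor :: "'m set \<Rightarrow> 'm" where
  "rep_mor F = (SOME f. f \<in> F)"

definition semisimplification :: "('o, 'm, 'k::field) rcat \<Rightarrow> ('o, 'm set, 'k) rcat" where
  "semisimplification C =
     \<lparr>Obj = Obj C,
      Mor = proj_mor C ` Mor C,
      Dom = (\<lambda>F. Dom C (rep_mor F)),
      Cod = (\<lambda>F. Cod C (rep_mor F)),
      Idm = (\<lambda>X. proj_mor C (Idm C X)),
      Cmp = (\<lambda>G F. proj_mor C (rep_mor G \<cdot>\<^bsub>C\<^esub> rep_mor F)),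
      TUnit = \<I>\<^bsub>C\<^esub>,
      TOb = TOb C,
      TMo = (\<lambda>F G. proj_mor C (rep_mor F \<star>\<^bsub>C\<^esub> rep_mor G)),
      Dual = Dual C,
      Ev = (\<lambda>X. proj_mor C (Ev C X)),
      Coev = (\<lambda>X. proj_mor C (Coev C X)),
      Braid = (\<lambda>X Y. proj_mor C (Braid C X Y)),
      Twist = (\<lambda>X. proj_mor C (Twist C X)),
      Zer = (\<lambda>X Y. proj_mor C (Zer C X Y)),
      Add = (\<lambda>F G. proj_mor C (Add C (rep_mor F) (rep_mor G))),
      Scl = (\<lambda>a F. proj_mor C (Scl C a (rep_mor F)))\<rparr>"


section \<open>Abelian and semisimple categories\<close>

definition zero_object :: "('o, 'm, 'k) rcat \<Rightarrow> 'o \<Rightarrow> bool" where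
  "zero_object D Z \<longleftrightarrow> Z \<in> Obj D \<and>
     (\<forall>X\<in>Obj D. (\<exists>!f. f \<in> Hom D X Z) \<and> (\<exists>!f. f \<in> Hom D Z X))"

definition is_direct_sum ::
  "('o, 'm, 'k) rcat \<Rightarrow> 'i set \<Rightarrow> ('i \<Rightarrow> 'o) \<Rightarrow> 'o \<Rightarrow> ('i \<Rightarrow> 'm) \<Rightarrow> ('i \<Rightarrow> 'm) \<Rightarrow> bool" where
  "is_direct_sum D I Y X p q \<longleftrightarrow> finite I \<and> X \<in> Obj D \<and>
     (\<forall>i\<in>I. Y i \<in> Obj D \<and> p i \<in> Hom D X (Y i) \<and> q i \<in> Hom D (Y i) X) \<and>
     (\<forall>i\<in>I. \<forall>j\<in>I. p i \<cdot>\<^bsub>D\<^esub> q j = (if i = j then Idm D (Y i) else Zer D (Y j) (Y i))) \<and>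
     msum D X X (\<lambda>i. q i \<cdot>\<^bsub>D\<^esub> p i) I = Idm D X"

definition monic :: "('o, 'm, 'k) rcat \<Rightarrow> 'm \<Rightarrow> bool" where
  "monic D f \<longleftrightarrow> f \<in> Mor D \<and>
     (\<forall>W. \<forall>g\<in>Hom D W (Dom D f). \<forall>h\<in>Hom D W (Dom D f). f \<cdot>\<^bsub>D\<^esub> g = f \<cdot>\<^bsub>D\<^esub> h \<longrightarrow> g = h)"

definition epic :: "('o, 'm, 'k) rcat \<Rightarrow> 'm \<Rightarrow> bool" where
  "epic D f \<longleftrightarrow> f \<in> Mor D \<and>
     (\<forall>W. \<forall>g\<in>Hom D (Cod D f) W. \<forall>h\<in>Hom D (Cod D f) W. g \<cdot>\<^bsub>D\<^esub> f = h \<cdot>\<^bsub>D\<^esub> f \<longrightarrow> g = h)"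

definition is_kernel :: "('o, 'm, 'k) rcat \<Rightarrow> 'm \<Rightarrow> 'm \<Rightarrow> bool" where
  "is_kernel D k f \<longleftrightarrow> k \<in> Mor D \<and> Cod D k = Dom D f \<and>
     f \<cdot>\<^bsub>D\<^esub> k = Zer D (Dom D k) (Cod D f) \<and>
     (\<forall>W. \<forall>g\<in>Hom D W (Dom D f). f \<cdot>\<^bsub>D\<^esub> g = Zer D W (Cod D f) \<longrightarrow>
        (\<exists>!u. u \<in> Hom D W (Dom D k) \<and> k \<cdot>\<^bsub>D\<^esub> u = g))"

definition is_cokernel :: "('o, 'm, 'k) rcat \<Rightarrow> 'm \<Rightarrow> 'm \<Rightarrow> bool" where
  "is_cokernel D c f \<longleftrightarrow> c \<in> Mor D \<and> Dom D c = Cod D f \<and>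
     c \<cdot>\<^bsub>D\<^esub> f = Zer D (Dom D f) (Cod D c) \<and>
     (\<forall>W. \<forall>g\<in>Hom D (Cod D f) W. g \<cdot>\<^bsub>D\<^esub> f = Zer D (Dom D f) W \<longrightarrow>
        (\<exists>!u. u \<in> Hom D (Cod D c) W \<and> u \<cdot>\<^bsub>D\<^esub> c = g))"

text \<open>Additivity of the Hom-groups is not repeated here: the predicate is only applied to full
  subcategories of categories with bilinear composition.\<close>

definition abelian_category :: "('o, 'm, 'k) rcat \<Rightarrow> bool" where
  "abelian_category D \<longleftrightarrow>
     (\<exists>Z. zero_object D Z) \<and>
     (\<forall>Y::bool \<Rightarrow> 'o. range Y \<subseteq> Obj D \<longrightarrow> (\<exists>X p q. is_direct_sum D UNIV Y X p q)) \<and>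
     (\<forall>f\<in>Mor D. (\<exists>k. is_kernel D k f) \<and> (\<exists>c. is_cokernel D c f)) \<and>
     (\<forall>m. monic D m \<longrightarrow> (\<exists>f\<in>Mor D. is_kernel D m f)) \<and>
     (\<forall>e. epic D e \<longrightarrow> (\<exists>f\<in>Mor D. is_cokernel D e f))"

definition full_subcategory :: "('o, 'm, 'k) rcat \<Rightarrow> 'o set \<Rightarrow> ('o, 'm, 'k) rcat" where
  "full_subcategory D Ob =
     D\<lparr>Obj := Ob, Mor := {f \<in> Mor D. Dom D f \<in> Ob \<and> Cod D f \<in> Ob}\<rparr>"

definition full_ribbon_abelian_subcategory ::
  "('o, 'm, 'k) rcat \<Rightarrow> ('o, 'm, 'k) rcat \<Rightarrow> bool" where
  "full_ribbon_abelian_subcategory B D \<longleftrightarrow>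
     Obj B \<subseteq> Obj D \<and> B = full_subcategory D (Obj B) \<and>
     \<I>\<^bsub>D\<^esub> \<in> Obj B \<and>
     (\<forall>X\<in>Obj B. \<forall>Y\<in>Obj B. X \<diamondop>\<^bsub>D\<^esub> Y \<in> Obj B) \<and>
     (\<forall>X\<in>Obj B. Dual D X \<in> Obj B) \<and>
     abelian_category B"

definition simple_object :: "('o, 'm, 'k) rcat \<Rightarrow> 'o \<Rightarrow> bool" where
  "simple_object D X \<longleftrightarrow> X \<in> Obj D \<and> \<not> zero_object D X \<and>
     (\<forall>f. monic D f \<and> Cod D f = X \<longrightarrow> zero_object D (Dom D f) \<or> iso_mor D f)"

definition isomorphic :: "('o, 'm, 'k) rcat \<Rightarrow> 'o \<Rightarrow> 'o \<Rightarrow> bool" where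
  "isomorphic D X Y \<longleftrightarrow> (\<exists>f\<in>Hom D X Y. iso_mor D f)"

definition semisimple_category :: "('o, 'm, 'k) rcat \<Rightarrow> bool" where
  "semisimple_category D \<longleftrightarrow> (\<forall>X\<in>Obj D. \<exists>(n::nat) Y p q.
     is_direct_sum D {..<n} Y X p q \<and> (\<forall>k<n. simple_object D (Y k)))"

definition finitely_many_simples :: "('o, 'm, 'k) rcat \<Rightarrow> bool" where
  "finitely_many_simples D \<longleftrightarrow>
     finite ((\<lambda>X. {Y. simple_object D Y \<and> isomorphic D X Y}) ` {X. simple_object D X})"

definition simple_representatives :: "('o, 'm, 'k) rcat \<Rightarrow> 'o set \<Rightarrow> bool" where
  "simple_representatives D \<Lambda> \<longleftrightarrow> finite \<Lambda> \<and> \<I>\<^bsub>D\<^esub> \<in> \<Lambda> \<and> (\<forall>l\<in>\<Lambda>. simple_object D l) \<and>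
     (\<forall>X. simple_object D X \<longrightarrow> (\<exists>!l. l \<in> \<Lambda> \<and> isomorphic D X l))"


section \<open>The coend and its structural morphisms\<close>

definition dinatural :: "('o, 'm, 'k) rcat \<Rightarrow> 'o \<Rightarrow> ('o \<Rightarrow> 'm) \<Rightarrow> bool" where
  "dinatural C Z d \<longleftrightarrow> (\<forall>X\<in>Obj C. d X \<in> Hom C (Dual C X \<diamondop>\<^bsub>C\<^esub> X) Z) \<and>
     (\<forall>X Y. \<forall>f\<in>Hom C X Y. d X \<cdot>\<^bsub>C\<^esub> (dual_mor C f \<star>\<^bsub>C\<^esub> Idm C X)
                        = d Y \<cdot>\<^bsub>C\<^esub> (Idm C (Dual C Y) \<star>\<^bsub>C\<^esub> f))"

definition is_coend :: "('o, 'm, 'k) rcat \<Rightarrow> 'o \<Rightarrow> ('o \<Rightarrow> 'm) \<Rightarrow> bool" where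
  "is_coend C A i \<longleftrightarrow> A \<in> Obj C \<and> dinatural C A i \<and>
     (\<forall>Z\<in>Obj C. \<forall>d. dinatural C Z d \<longrightarrow>
        (\<exists>!g. g \<in> Hom C A Z \<and> (\<forall>X\<in>Obj C. d X = g \<cdot>\<^bsub>C\<^esub> i X)))"

definition coend_comult :: "('o, 'm, 'k) rcat \<Rightarrow> 'o \<Rightarrow> ('o \<Rightarrow> 'm) \<Rightarrow> 'm" where
  "coend_comult C A i = (THE d. d \<in> Hom C A (A \<diamondop>\<^bsub>C\<^esub> A) \<and>
     (\<forall>X\<in>Obj C. d \<cdot>\<^bsub>C\<^esub> i X =
        (i X \<star>\<^bsub>C\<^esub> i X) \<cdot>\<^bsub>C\<^esub> (Idm C (Dual C X) \<star>\<^bsub>C\<^esub> Coev C X \<star>\<^bsub>C\<^esub> Idm C X)))"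

definition dual_ten :: "('o, 'm, 'k) rcat \<Rightarrow> 'o \<Rightarrow> 'o \<Rightarrow> 'm" where
  "dual_ten C X Y = (let U = Y \<diamondop>\<^bsub>C\<^esub> X in
     ((Ev C X \<cdot>\<^bsub>C\<^esub> (Idm C (Dual C X) \<star>\<^bsub>C\<^esub> Ev C Y \<star>\<^bsub>C\<^esub> Idm C X)) \<star>\<^bsub>C\<^esub> Idm C (Dual C U))
     \<cdot>\<^bsub>C\<^esub> (Idm C (Dual C X \<diamondop>\<^bsub>C\<^esub> Dual C Y) \<star>\<^bsub>C\<^esub> Coev C U))"

definition coend_mult :: "('o, 'm, 'k) rcat \<Rightarrow> 'o \<Rightarrow> ('o \<Rightarrow> 'm) \<Rightarrow> 'm" where
  "coend_mult C A i = (THE m. m \<in> Hom C (A \<diamondop>\<^bsub>C\<^esub> A) A \<and>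
     (\<forall>X\<in>Obj C. \<forall>Y\<in>Obj C. m \<cdot>\<^bsub>C\<^esub> (i X \<star>\<^bsub>C\<^esub> i Y) =
        i (Y \<diamondop>\<^bsub>C\<^esub> X)
        \<cdot>\<^bsub>C\<^esub> (dual_ten C X Y \<star>\<^bsub>C\<^esub> Idm C (Y \<diamondop>\<^bsub>C\<^esub> X))
        \<cdot>\<^bsub>C\<^esub> (Idm C (Dual C X) \<star>\<^bsub>C\<^esub> Braid C X (Dual C Y \<diamondop>\<^bsub>C\<^esub> Y))))"

definition bidual :: "('o, 'm, 'k) rcat \<Rightarrow> 'o \<Rightarrow> 'm" where
  "bidual C X = (ev_right C X \<star>\<^bsub>C\<^esub> Idm C (Dual C (Dual C X)))
     \<cdot>\<^bsub>C\<^esub> (Idm C X \<star>\<^bsub>C\<^esub> Coev C (Dual C X))"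

definition coend_antipode :: "('o, 'm, 'k) rcat \<Rightarrow> 'o \<Rightarrow> ('o \<Rightarrow> 'm) \<Rightarrow> 'm" where
  "coend_antipode C A i = (THE s. s \<in> Hom C A A \<and>
     (\<forall>X\<in>Obj C. s \<cdot>\<^bsub>C\<^esub> i X =
        i (Dual C X) \<cdot>\<^bsub>C\<^esub> (bidual C X \<star>\<^bsub>C\<^esub> Twist C (Dual C X)) \<cdot>\<^bsub>C\<^esub> Braid C (Dual C X) X))"

definition Gamma_l :: "('o, 'm, 'k) rcat \<Rightarrow> 'o \<Rightarrow> ('o \<Rightarrow> 'm) \<Rightarrow> 'm" where
  "Gamma_l C A i = (Idm C A \<star>\<^bsub>C\<^esub> coend_mult C A i) \<cdot>\<^bsub>C\<^esub> (coend_comult C A i \<star>\<^bsub>C\<^esub> Idm C A)"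

definition Theta_plus :: "('o, 'm, 'k) rcat \<Rightarrow> 'o \<Rightarrow> ('o \<Rightarrow> 'm) \<Rightarrow> 'm" where
  "Theta_plus C A i = (THE t. t \<in> Hom C A \<I>\<^bsub>C\<^esub> \<and>
     (\<forall>X\<in>Obj C. t \<cdot>\<^bsub>C\<^esub> i X = Ev C X \<cdot>\<^bsub>C\<^esub> (Idm C (Dual C X) \<star>\<^bsub>C\<^esub> Twist C X)))"

definition Theta_minus :: "('o, 'm, 'k) rcat \<Rightarrow> 'o \<Rightarrow> ('o \<Rightarrow> 'm) \<Rightarrow> 'm" where
  "Theta_minus C A i = (THE t. t \<in> Hom C A \<I>\<^bsub>C\<^esub> \<and>
     (\<forall>X\<in>Obj C. t \<cdot>\<^bsub>C\<^esub> i X = Ev C X \<cdot>\<^bsub>C\<^esub> (Idm C (Dual C X) \<star>\<^bsub>C\<^esub> minv C (Twist C X))))"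

definition Kirby :: "('o, 'm, 'k::field) rcat \<Rightarrow> 'o \<Rightarrow> ('o \<Rightarrow> 'm) \<Rightarrow> 'm set" where
  "Kirby C A i = {\<alpha> \<in> Hom C \<I>\<^bsub>C\<^esub> A.
     msub C (coend_antipode C A i \<cdot>\<^bsub>C\<^esub> \<alpha>) \<alpha> \<in> Negl C \<I>\<^bsub>C\<^esub> A \<and>
     msub C (Gamma_l C A i \<cdot>\<^bsub>C\<^esub> (\<alpha> \<star>\<^bsub>C\<^esub> \<alpha>)) (\<alpha> \<star>\<^bsub>C\<^esub> \<alpha>) \<in> Negl C \<I>\<^bsub>C\<^esub> (A \<diamondop>\<^bsub>C\<^esub> A)}"

definition Kirby_norm :: "('o, 'm, 'k::field) rcat \<Rightarrow> 'o \<Rightarrow> ('o \<Rightarrow> 'm) \<Rightarrow> 'm set" where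
  "Kirby_norm C A i = {\<alpha> \<in> Kirby C A i.
     to_scalar C (Theta_plus C A i \<cdot>\<^bsub>C\<^esub> \<alpha>) \<noteq> 0 \<and> to_scalar C (Theta_minus C A i \<cdot>\<^bsub>C\<^esub> \<alpha>) \<noteq> 0}"

text \<open>The coend morphisms of a semisimple category, for a set \<open>\<Lambda>\<close> of representatives of its
  simple objects and \<open>B\<close> the direct sum of the \<open>l* \<otimes> l\<close> (\<open>l \<in> \<Lambda>\<close>) with injections \<open>q\<close>; the value
  does not depend on the chosen decomposition of \<open>X\<close>.\<close>

definition semisimple_coend_mor ::
  "('o, 'm, 'k) rcat \<Rightarrow> 'o set \<Rightarrow> 'o \<Rightarrow> ('o \<Rightarrow> 'm) \<Rightarrow> 'o \<Rightarrow> 'm" where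
  "semisimple_coend_mor D \<Lambda> B q X =
     (SOME j. \<exists>(n::nat) l pX qX. is_direct_sum D {..<n} l X pX qX \<and> l ` {..<n} \<subseteq> \<Lambda> \<and>
        j = msum D (Dual D X \<diamondop>\<^bsub>D\<^esub> X) B
              (\<lambda>k. q (l k) \<cdot>\<^bsub>D\<^esub> (dual_mor D (qX k) \<star>\<^bsub>D\<^esub> pX k)) {..<n})"

definition comparison_mor ::
  "('o, 'm, 'k::field) rcat \<Rightarrow> 'o \<Rightarrow> ('o \<Rightarrow> 'm) \<Rightarrow> 'o set \<Rightarrow> 'o \<Rightarrow> ('o \<Rightarrow> 'm set) \<Rightarrow> 'm set" where
  "comparison_mor C A i \<Lambda> B p = (let Cs = semisimplification C in
     msum Cs B A (\<lambda>l. proj_mor C (i l) \<cdot>\<^bsub>Cs\<^esub> p l) \<Lambda>)"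


section \<open>Smooth maps and framed curves\<close>

text \<open>\<open>Ck_on m S f\<close>: \<open>f\<close> is of class \<open>C^m\<close> on the open set \<open>S\<close>.\<close>

primrec Ck_on :: "nat \<Rightarrow> 'a::euclidean_space set \<Rightarrow> ('a \<Rightarrow> 'b::euclidean_space) \<Rightarrow> bool" where
  "Ck_on 0 S f \<longleftrightarrow> continuous_on S f"
| "Ck_on (Suc m) S f \<longleftrightarrow> (\<forall>x\<in>S. f differentiable at x) \<and>
     (\<forall>v. Ck_on m S (\<lambda>x. frechet_derivative f (at x) v))"

definition smooth_on :: "'a::euclidean_space set \<Rightarrow> ('a \<Rightarrow> 'b::euclidean_space) \<Rightarrow> bool" where
  "smooth_on S f \<longleftrightarrow> (\<forall>m. Ck_on m S f)"

abbreviation velocity :: "(real \<Rightarrow> 'v::euclidean_space) \<Rightarrow> real \<Rightarrow> 'v" where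
  "velocity c t \<equiv> vector_derivative c (at t)"

abbreviation xc :: "real^3 \<Rightarrow> real" where "xc P \<equiv> vec_nth P 1"
abbreviation yc :: "real^3 \<Rightarrow> real" where "yc P \<equiv> vec_nth P 2"
abbreviation zc :: "real^3 \<Rightarrow> real" where "zc P \<equiv> vec_nth P 3"

definition lin_indep2 :: "'v::real_vector \<Rightarrow> 'v \<Rightarrow> bool" where
  "lin_indep2 u v \<longleftrightarrow> (\<forall>a b. a *\<^sub>R u + b *\<^sub>R v = 0 \<longrightarrow> a = 0 \<and> b = 0)"

text \<open>Finitely many parametrized curves (numbered from \<open>0\<close>) with a vector field along each.\<close>

record 'v framed_curves =
  ncomp :: nat
  curve :: "nat \<Rightarrow> real \<Rightarrow> 'v"
  framing :: "nat \<Rightarrow> real \<Rightarrow> 'v"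

text \<open>Closed curves are parametrized with period \<open>1\<close>.\<close>

definition framed_closed_curves :: "'v::euclidean_space framed_curves \<Rightarrow> bool" where
  "framed_closed_curves L \<longleftrightarrow>
     (\<forall>k<ncomp L. smooth_on UNIV (curve L k) \<and> smooth_on UNIV (framing L k) \<and>
        (\<forall>t. curve L k (t + 1) = curve L k t \<and> framing L k (t + 1) = framing L k t \<and>
             lin_indep2 (velocity (curve L k) t) (framing L k t))) \<and>
     (\<forall>k<ncomp L. \<forall>l<ncomp L. \<forall>s\<in>{0..<1}. \<forall>t\<in>{0..<1}.
        curve L k s = curve L l t \<longrightarrow> k = l \<and> s = t)"

text \<open>\<open>S^3\<close> is the unit sphere of \<open>\<real>^4\<close>.\<close>

definition framed_link :: "(real^4) framed_curves \<Rightarrow> bool" where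
  "framed_link L \<longleftrightarrow> framed_closed_curves L \<and>
     (\<forall>k<ncomp L. \<forall>t. norm (curve L k t) = 1 \<and> inner (framing L k t) (curve L k t) = 0)"

text \<open>Isotopy of framed links, which are unoriented and have unordered components: the components
  may be permuted by \<open>\<sigma>\<close>, and reversed where \<open>e\<close> is \<open>-1\<close>.\<close>

definition link_isotopic :: "(real^4) framed_curves \<Rightarrow> (real^4) framed_curves \<Rightarrow> bool" where
  "link_isotopic L L' \<longleftrightarrow> ncomp L = ncomp L' \<and>
     (\<exists>\<sigma> (e :: nat \<Rightarrow> real) (G :: nat \<Rightarrow> real \<times> real \<Rightarrow> real^4) (V :: nat \<Rightarrow> real \<times> real \<Rightarrow> real^4).
        \<sigma> permutes {..<ncomp L} \<and> (\<forall>k. e k \<in> {1, -1}) \<and>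
        (\<forall>k<ncomp L. smooth_on UNIV (G k) \<and> smooth_on UNIV (V k)) \<and>
        (\<forall>s\<in>{0..1}. framed_link \<lparr>ncomp = ncomp L, curve = (\<lambda>k t. G k (s, t)),
                                 framing = (\<lambda>k t. V k (s, t))\<rparr>) \<and>
        (\<forall>k<ncomp L. \<forall>t.
           G k (0, t) = curve L (\<sigma> k) (e k * t) \<and> V k (0, t) = framing L (\<sigma> k) (e k * t) \<and>
           G k (1, t) = curve L' k t \<and> V k (1, t) = framing L' k t))"

text \<open>The inclusion of \<open>\<real>^3\<close> into \<open>S^3\<close>; the orientation of \<open>S^3\<close> is the one extending the
  standard orientation of \<open>\<real>^3\<close> along this map.\<close>

definition stereo :: "real^3 \<Rightarrow> real^4" where
  "stereo P = (let r = (norm P)\<^sup>2 in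
     vector [2 * xc P / (r + 1), 2 * yc P / (r + 1), 2 * zc P / (r + 1), (r - 1) / (r + 1)])"

definition to_sphere :: "(real^3) framed_curves \<Rightarrow> (real^4) framed_curves" where
  "to_sphere K = \<lparr>ncomp = ncomp K,
     curve = (\<lambda>k t. stereo (curve K k t)),
     framing = (\<lambda>k t. frechet_derivative stereo (at (curve K k t)) (framing K k t))\<rparr>"


section \<open>Special tangles\<close>

text \<open>Diagrams are projections along the second coordinate, read bottom to top along the third;
  the third axis points up, the first to the right and the second away from the reader. The
  \<open>k\<close>-th arc starts at the foot \<open>2k+1\<close>, going up, and ends at the foot \<open>2k+2\<close>, going down.\<close>

definition e_y :: "real^3" where "e_y = axis 2 1"

definition foot :: "nat \<Rightarrow> real^3" where "foot j = vector [real j, 0, 0]"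

definition special_tangle :: "(real^3) framed_curves \<Rightarrow> bool" where
  "special_tangle T \<longleftrightarrow>
     (\<forall>k<ncomp T. smooth_on UNIV (curve T k) \<and> smooth_on UNIV (framing T k) \<and>
        (\<forall>t\<in>{0..1}. lin_indep2 (velocity (curve T k) t) (framing T k t)) \<and>
        (\<forall>t\<in>{0<..<1}. 0 < zc (curve T k t) \<and> zc (curve T k t) < 1) \<and>
        curve T k 0 = foot (2 * k + 1) \<and> curve T k 1 = foot (2 * k + 2) \<and>
        0 < zc (velocity (curve T k) 0) \<and> zc (velocity (curve T k) 1) < 0 \<and>
        framing T k 0 = e_y \<and> framing T k 1 = e_y) \<and>
     (\<forall>k<ncomp T. \<forall>l<ncomp T. \<forall>s\<in>{0..1}. \<forall>t\<in>{0..1}.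
        curve T k s = curve T l t \<longrightarrow> k = l \<and> s = t)"

definition tangle_isotopic :: "(real^3) framed_curves \<Rightarrow> (real^3) framed_curves \<Rightarrow> bool" where
  "tangle_isotopic T T' \<longleftrightarrow> ncomp T = ncomp T' \<and>
     (\<exists>(G :: nat \<Rightarrow> real \<times> real \<Rightarrow> real^3) (V :: nat \<Rightarrow> real \<times> real \<Rightarrow> real^3).
        (\<forall>k<ncomp T. smooth_on UNIV (G k) \<and> smooth_on UNIV (V k)) \<and>
        (\<forall>s\<in>{0..1}. special_tangle \<lparr>ncomp = ncomp T, curve = (\<lambda>k t. G k (s, t)),
                                    framing = (\<lambda>k t. V k (s, t))\<rparr>) \<and>
        (\<forall>k<ncomp T. \<forall>t\<in>{0..1}.
           G k (0, t) = curve T k t \<and> V k (0, t) = framing T k t \<and>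
           G k (1, t) = curve T' k t \<and> V k (1, t) = framing T' k t))"

text \<open>\<open>K\<close> is \<open>T\<close> composed with \<open>n\<close> clockwise cups: the second half of each component is a planar
  arc below the tangle, leading back from the foot \<open>2k+2\<close> to the foot \<open>2k+1\<close>.\<close>

definition cup_closure :: "(real^3) framed_curves \<Rightarrow> (real^3) framed_curves \<Rightarrow> bool" where
  "cup_closure T K \<longleftrightarrow> ncomp K = ncomp T \<and> framed_closed_curves K \<and>
     (\<forall>k<ncomp T.
        (\<forall>t\<in>{0..1/2}. curve K k t = curve T k (2 * t) \<and> framing K k t = framing T k (2 * t)) \<and>
        (\<forall>t\<in>{1/2<..<1}. real (2 * k + 1) \<le> xc (curve K k t) \<and> xc (curve K k t) \<le> real (2 * k + 2) \<and>
           yc (curve K k t) = 0 \<and> zc (curve K k t) < 0 \<and> framing K k t = e_y))"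


section \<open>Diagrams of special tangles\<close>

text \<open>Each arc of a generic special tangle is cut by its critical points (for the height) into
  monotone pieces, numbered \<open>0, 1, \<dots>\<close> along the arc: even pieces run upwards, odd ones downwards.
  A horizontal section is described by the list, from left to right, of pairs (arc, piece).\<close>

type_synonym section_word = "(nat \<times> nat) list"

text \<open>The argument \<open>a\<close> is the number of strands to the left of the event.
  \<open>Crossing True a\<close>: the strand going from bottom left to top right is over the other one.
  \<open>Minimum a k j b\<close>: a minimum of the \<open>k\<close>-th arc, between its pieces \<open>j\<close> and \<open>j + 1\<close>, whose left
  strand is the piece \<open>j\<close> if \<open>b\<close> holds and \<open>j + 1\<close> otherwise.\<close>

datatype diagram_event =
    Crossing bool nat
  | Maximum nat
  | Minimum nat nat nat bool

fun event_ok :: "section_word \<Rightarrow> diagram_event \<Rightarrow> bool" where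
  "event_ok w (Crossing b a) \<longleftrightarrow> a + 1 < length w"
| "event_ok w (Maximum a) \<longleftrightarrow> a + 1 < length w \<and>
     (\<exists>k j. even j \<and> (w ! a = (k, j) \<and> w ! (a + 1) = (k, j + 1) \<or>
                      w ! a = (k, j + 1) \<and> w ! (a + 1) = (k, j)))"
| "event_ok w (Minimum a k j b) \<longleftrightarrow> a \<le> length w \<and> odd j"

fun event_apply :: "section_word \<Rightarrow> diagram_event \<Rightarrow> section_word" where
  "event_apply w (Crossing b a) = take a w @ [w ! (a + 1), w ! a] @ drop (a + 2) w"
| "event_apply w (Maximum a) = take a w @ drop (a + 2) w"
| "event_apply w (Minimum a k j b) =
     take a w @ (if b then [(k, j), (k, j + 1)] else [(k, j + 1), (k, j)]) @ drop a w"

primrec diagram_ok :: "section_word \<Rightarrow> diagram_event list \<Rightarrow> bool" where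
  "diagram_ok w [] \<longleftrightarrow> w = []"
| "diagram_ok w (x # D) \<longleftrightarrow> event_ok w x \<and> diagram_ok (event_apply w x) D"

text \<open>\<open>r k\<close> is the number of the last piece of the \<open>k\<close>-th arc.\<close>

definition bottom_word :: "nat \<Rightarrow> (nat \<Rightarrow> nat) \<Rightarrow> section_word" where
  "bottom_word n r = concat (map (\<lambda>k. [(k, 0), (k, r k)]) [0..<n])"

definition points_at :: "(real^3) framed_curves \<Rightarrow> real \<Rightarrow> (nat \<times> real) set" where
  "points_at T h = {(k, t). k < ncomp T \<and> t \<in> {0..1} \<and> zc (curve T k t) = h}"

definition crit_params :: "(real^3) framed_curves \<Rightarrow> nat \<Rightarrow> real set" where
  "crit_params T k = {t \<in> {0..1}. zc (velocity (curve T k) t) = 0}"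

definition x_at :: "(real^3) framed_curves \<Rightarrow> nat \<times> real \<Rightarrow> real" where
  "x_at T = (\<lambda>(k, t). xc (curve T k t))"

definition regular_at :: "(real^3) framed_curves \<Rightarrow> nat \<times> real \<Rightarrow> bool" where
  "regular_at T = (\<lambda>(k, t). t \<notin> crit_params T k)"

definition slope_at :: "(real^3) framed_curves \<Rightarrow> nat \<times> real \<Rightarrow> real" where
  "slope_at T = (\<lambda>(k, t). xc (velocity (curve T k) t) / zc (velocity (curve T k) t))"

definition left_of :: "(real^3) framed_curves \<Rightarrow> real \<Rightarrow> real \<Rightarrow> nat" where
  "left_of T h x = card {P \<in> points_at T h. x_at T P < x}"

definition regular_height :: "(real^3) framed_curves \<Rightarrow> real \<Rightarrow> bool" where
  "regular_height T h \<longleftrightarrow> inj_on (x_at T) (points_at T h) \<and> (\<forall>P\<in>points_at T h. regular_at T P)"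

text \<open>\<open>event_at T h x\<close>: the height \<open>h\<close> contains a single singularity of the projection of \<open>T\<close>,
  which is either a nondegenerate critical point of the height function or a transversal double
  point, and it is described by \<open>x\<close>.\<close>

fun event_at :: "(real^3) framed_curves \<Rightarrow> real \<Rightarrow> diagram_event \<Rightarrow> bool" where
  "event_at T h (Maximum a) \<longleftrightarrow>
     inj_on (x_at T) (points_at T h) \<and>
     (\<exists>(k, t)\<in>points_at T h. t \<in> crit_params T k \<and>
        zc (velocity (velocity (curve T k)) t) < 0 \<and>
        (\<forall>P\<in>points_at T h - {(k, t)}. regular_at T P) \<and>
        a = left_of T h (xc (curve T k t)))"
| "event_at T h (Minimum a k j b) \<longleftrightarrow>
     inj_on (x_at T) (points_at T h) \<and>
     (\<exists>t. (k, t) \<in> points_at T h \<and> t \<in> crit_params T k \<and>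
        0 < zc (velocity (velocity (curve T k)) t) \<and>
        (\<forall>P\<in>points_at T h - {(k, t)}. regular_at T P) \<and>
        a = left_of T h (xc (curve T k t)) \<and>
        j = card {u \<in> crit_params T k. u < t} \<and>
        (b \<longleftrightarrow> 0 < xc (velocity (curve T k) t)))"
| "event_at T h (Crossing b a) \<longleftrightarrow>
     (\<forall>P\<in>points_at T h. regular_at T P) \<and>
     (\<exists>(k, t)\<in>points_at T h. \<exists>(l, u)\<in>points_at T h.
        (k, t) \<noteq> (l, u) \<and> x_at T (k, t) = x_at T (l, u) \<and>
        inj_on (x_at T) (points_at T h - {(l, u)}) \<and>
        slope_at T (l, u) < slope_at T (k, t) \<and>
        a = left_of T h (x_at T (k, t)) \<and>
        (b \<longleftrightarrow> yc (curve T k t) < yc (curve T l u)))"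

text \<open>\<open>T\<close> is in generic position, with blackboard framing (a framing constantly orthogonal to the
  plane of projection), and its events are, from bottom to top, the entries of \<open>D\<close>. The last two
  conditions hold for every such \<open>T\<close>; they record that the labels attached to the strands are
  consistent.\<close>

definition has_diagram ::
  "(real^3) framed_curves \<Rightarrow> (nat \<Rightarrow> nat) \<Rightarrow> diagram_event list \<Rightarrow> bool" where
  "has_diagram T r D \<longleftrightarrow> special_tangle T \<and>
     (\<forall>k<ncomp T. \<forall>t\<in>{0..1}. framing T k t = e_y) \<and>
     (\<exists>hs. sorted_wrt (<) hs \<and> length hs = length D \<and>
        set hs = {h \<in> {0<..<1}. \<not> regular_height T h} \<and>
        (\<forall>m<length D. event_at T (hs ! m) (D ! m))) \<and>
     (\<forall>k<ncomp T. r k = card (crit_params T k)) \<and>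
     (\<forall>k<ncomp T. odd (r k)) \<and>
     diagram_ok (bottom_word (ncomp T) r) D"


section \<open>Evaluation of diagrams\<close>

definition ten_obs :: "('o, 'm, 'k) rcat \<Rightarrow> 'o list \<Rightarrow> 'o" where
  "ten_obs C Xs = foldr (TOb C) Xs \<I>\<^bsub>C\<^esub>"

definition ten_mors :: "('o, 'm, 'k) rcat \<Rightarrow> 'm list \<Rightarrow> 'm" where
  "ten_mors C fs = foldr (TMo C) fs (Idm C \<I>\<^bsub>C\<^esub>)"

definition strand_obj :: "('o, 'm, 'k) rcat \<Rightarrow> (nat \<Rightarrow> 'o) \<Rightarrow> nat \<times> nat \<Rightarrow> 'o" where
  "strand_obj C X = (\<lambda>(k, j). if even j then Dual C (X k) else X k)"

definition section_obj :: "('o, 'm, 'k) rcat \<Rightarrow> (nat \<Rightarrow> 'o) \<Rightarrow> section_word \<Rightarrow> 'o" where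
  "section_obj C X w = ten_obs C (map (strand_obj C X) w)"

fun event_core ::
  "('o, 'm, 'k) rcat \<Rightarrow> (nat \<Rightarrow> 'o) \<Rightarrow> section_word \<Rightarrow> diagram_event \<Rightarrow> 'm" where
  "event_core C X w (Crossing b a) =
     (let U = strand_obj C X (w ! a); V = strand_obj C X (w ! (a + 1))
      in if b then Braid C U V else minv C (Braid C V U))"
| "event_core C X w (Maximum a) =
     (let (k, j) = w ! a in if even j then Ev C (X k) else ev_right C (X k))"
| "event_core C X w (Minimum a k j b) = (if b then Coev C (X k) else coev_right C (X k))"

fun event_bounds :: "diagram_event \<Rightarrow> nat \<times> nat" where
  "event_bounds (Crossing b a) = (a, a + 2)"
| "event_bounds (Maximum a) = (a, a + 2)"
| "event_bounds (Minimum a k j b) = (a, a)"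

definition event_mor ::
  "('o, 'm, 'k) rcat \<Rightarrow> (nat \<Rightarrow> 'o) \<Rightarrow> section_word \<Rightarrow> diagram_event \<Rightarrow> 'm" where
  "event_mor C X w x = (let (a, b) = event_bounds x in
     Idm C (section_obj C X (take a w)) \<star>\<^bsub>C\<^esub> event_core C X w x
       \<star>\<^bsub>C\<^esub> Idm C (section_obj C X (drop b w)))"

primrec diagram_mor ::
  "('o, 'm, 'k) rcat \<Rightarrow> (nat \<Rightarrow> 'o) \<Rightarrow> diagram_event list \<Rightarrow> section_word \<Rightarrow> 'm" where
  "diagram_mor C X [] w = Idm C (section_obj C X w)"
| "diagram_mor C X (x # D) w = diagram_mor C X D (event_apply w x) \<cdot>\<^bsub>C\<^esub> event_mor C X w x"

text \<open>\<open>F X\<close> is the morphism represented by \<open>T\<close> with \<open>k\<close>-th component coloured by \<open>X k\<close>.\<close>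

definition represents ::
  "('o, 'm, 'k) rcat \<Rightarrow> (real^3) framed_curves \<Rightarrow> ((nat \<Rightarrow> 'o) \<Rightarrow> 'm) \<Rightarrow> bool" where
  "represents C T F \<longleftrightarrow> (\<exists>T' r D. tangle_isotopic T T' \<and> has_diagram T' r D \<and>
     F = (\<lambda>X. diagram_mor C X D (bottom_word (ncomp T) r)))"

definition is_phi ::
  "('o, 'm, 'k) rcat \<Rightarrow> 'o \<Rightarrow> ('o \<Rightarrow> 'm) \<Rightarrow> (real^3) framed_curves \<Rightarrow> 'm \<Rightarrow> bool" where
  "is_phi C A i T \<phi> \<longleftrightarrow> \<phi> \<in> Hom C (ten_obs C (replicate (ncomp T) A)) \<I>\<^bsub>C\<^esub> \<and>
     (\<exists>F. represents C T F \<and>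
        (\<forall>X. (\<forall>k<ncomp T. X k \<in> Obj C) \<longrightarrow>
             F X = \<phi> \<cdot>\<^bsub>C\<^esub> ten_mors C (map (\<lambda>k. i (X k)) [0..<ncomp T])))"

definition tau_link ::
  "('o, 'm, 'k) rcat \<Rightarrow> 'o \<Rightarrow> ('o \<Rightarrow> 'm) \<Rightarrow> (real^4) framed_curves \<Rightarrow> 'm \<Rightarrow> 'k" where
  "tau_link C A i L \<alpha> = (THE c. \<exists>T K \<phi>. special_tangle T \<and> cup_closure T K \<and>
     link_isotopic L (to_sphere K) \<and> is_phi C A i T \<phi> \<and>
     c = to_scalar C (\<phi> \<cdot>\<^bsub>C\<^esub> ten_mors C (replicate (ncomp T) \<alpha>)))"


section \<open>Surgery presentations and 3-manifold invariants\<close>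

text \<open>Gauss' integral for the linking number of disjoint closed curves.\<close>

definition linking_number :: "(real \<Rightarrow> real^3) \<Rightarrow> (real \<Rightarrow> real^3) \<Rightarrow> real" where
  "linking_number c d = 1 / (4 * pi) * integral {0..1} (\<lambda>s. integral {0..1} (\<lambda>t.
     inner (c s - d t) (cross3 (velocity c s) (velocity d t)) / norm (c s - d t) ^ 3))"

definition self_linking :: "(real \<Rightarrow> real^3) \<Rightarrow> (real \<Rightarrow> real^3) \<Rightarrow> real" where
  "self_linking c v = (THE m. \<forall>\<^sub>F e in at_right 0. linking_number c (\<lambda>t. c t + e *\<^sub>R v t) = m)"

definition linking_matrix :: "(real^3) framed_curves \<Rightarrow> real Matrix.mat" where
  "linking_matrix K = Matrix.mat (ncomp K) (ncomp K) (\<lambda>(k, l).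
     if k = l then self_linking (curve K k) (framing K k)
     else linking_number (curve K k) (curve K l))"

definition negative_eigenvalues :: "real Matrix.mat \<Rightarrow> nat" where
  "negative_eigenvalues Q =
     (\<Sum>a | a < 0 \<and> eigenvalue Q a. Polynomial.order a (char_poly Q))"

definition b_minus :: "(real^4) framed_curves \<Rightarrow> nat" where
  "b_minus L = (THE b. \<exists>K. framed_closed_curves K \<and> link_isotopic L (to_sphere K) \<and>
     b = negative_eigenvalues (linking_matrix K))"

text \<open>The orientation is given by a smooth oriented atlas.\<close>

definition closed_oriented_3_manifold ::
  "'x topology \<Rightarrow> ('x set \<times> ('x \<Rightarrow> real^3)) set \<Rightarrow> bool" where
  "closed_oriented_3_manifold M At \<longleftrightarrow>
     topspace M \<noteq> {} \<and> Hausdorff_space M \<and> compact_space M \<and> connected_space M \<and>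
     (\<Union>(U, f)\<in>At. U) = topspace M \<and>
     (\<forall>(U, f)\<in>At. openin M U \<and> open (f ` U) \<and>
        homeomorphic_map (subtopology M U) (top_of_set (f ` U)) f) \<and>
     (\<forall>(U, f)\<in>At. \<forall>(V, g)\<in>At. smooth_on (f ` (U \<inter> V)) (g \<circ> inv_into U f) \<and>
        (\<forall>P\<in>f ` (U \<inter> V).
           0 < Determinants.det (matrix (frechet_derivative (g \<circ> inv_into U f) (at P)))))"

text \<open>\<open>M\<close> is obtained from \<open>S^3\<close> by surgery along \<open>L\<close>. The maps \<open>\<psi> k\<close> parametrize disjoint tubular
  neighbourhoods of the components, the first coordinate modulo \<open>1\<close>, in such a way that the
  framing is the direction \<open>1\<close> of the disc factor; \<open>h\<close> embeds the exterior of the solid tori of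
  radius \<open>1\<close> into \<open>M\<close>, preserving the orientation, and the rest of \<open>M\<close> consists of solid tori
  \<open>D^2 \<times> S^1\<close> embedded by the \<open>\<xi> k\<close>, which agree with \<open>h \<circ> \<psi> k\<close> on \<open>S^1 \<times> S^1\<close>.\<close>

definition surgery_presentation ::
  "(real^4) framed_curves \<Rightarrow> 'x topology \<Rightarrow> ('x set \<times> ('x \<Rightarrow> real^3)) set \<Rightarrow> bool" where
  "surgery_presentation L M At \<longleftrightarrow> framed_link L \<and>
     (\<exists>(\<psi> :: nat \<Rightarrow> real \<times> complex \<Rightarrow> real^4) (h :: real^4 \<Rightarrow> 'x) (\<xi> :: nat \<Rightarrow> complex \<times> complex \<Rightarrow> 'x) E E'.
        (\<forall>k<ncomp L. smooth_on (UNIV \<times> ball 0 2) (\<psi> k) \<and>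
           (\<forall>t. \<forall>w\<in>ball 0 2. norm (\<psi> k (t, w)) = 1 \<and> \<psi> k (t + 1, w) = \<psi> k (t, w) \<and>
                              inj (frechet_derivative (\<psi> k) (at (t, w)))) \<and>
           (\<forall>t. \<psi> k (t, 0) = curve L k t \<and>
                frechet_derivative (\<psi> k) (at (t, 0)) (0, 1) = framing L k t)) \<and>
        (\<forall>k<ncomp L. \<forall>l<ncomp L. \<forall>s\<in>{0..<1}. \<forall>t\<in>{0..<1}. \<forall>w\<in>ball 0 2. \<forall>w'\<in>ball 0 2.
           \<psi> k (s, w) = \<psi> l (t, w') \<longrightarrow> k = l \<and> s = t \<and> w = w') \<and>
        E = sphere 0 1 - (\<Union>k<ncomp L. \<psi> k ` (UNIV \<times> ball 0 1)) \<and>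
        E' = sphere 0 1 - (\<Union>k<ncomp L. \<psi> k ` (UNIV \<times> cball 0 1)) \<and>
        embedding_map (top_of_set E) M h \<and>
        (\<forall>k<ncomp L. embedding_map (top_of_set (cball 0 1 \<times> sphere 0 1)) M (\<xi> k) \<and>
           (\<forall>t. \<forall>w\<in>sphere 0 1. h (\<psi> k (t, w)) = \<xi> k (cis (2 * pi * t), w)) \<and>
           \<xi> k ` (ball 0 1 \<times> sphere 0 1) \<inter> h ` E = {} \<and>
           (\<forall>l<ncomp L. k \<noteq> l \<longrightarrow>
              \<xi> k ` (cball 0 1 \<times> sphere 0 1) \<inter> \<xi> l ` (cball 0 1 \<times> sphere 0 1) = {})) \<and>
        topspace M = h ` E \<union> (\<Union>k<ncomp L. \<xi> k ` (cball 0 1 \<times> sphere 0 1)) \<and>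
        (\<forall>(U, f)\<in>At. \<forall>W. W = {P. stereo P \<in> E' \<and> h (stereo P) \<in> U} \<longrightarrow>
           smooth_on W (f \<circ> h \<circ> stereo) \<and>
           (\<forall>P\<in>W. 0 < Determinants.det
              (matrix (frechet_derivative (f \<circ> h \<circ> stereo) (at P))))))"

definition tau_manifold ::
  "('o, 'm, 'k::field) rcat \<Rightarrow> 'o \<Rightarrow> ('o \<Rightarrow> 'm) \<Rightarrow>
   'x topology \<Rightarrow> ('x set \<times> ('x \<Rightarrow> real^3)) set \<Rightarrow> 'm \<Rightarrow> 'k" where
  "tau_manifold C A i M At \<alpha> = (THE c. \<exists>L. surgery_presentation L M At \<and>
     c = to_scalar C (Theta_plus C A i \<cdot>\<^bsub>C\<^esub> \<alpha>) powi (int (b_minus L) - int (ncomp L))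
         * to_scalar C (Theta_minus C A i \<cdot>\<^bsub>C\<^esub> \<alpha>) powi (- int (b_minus L))
         * tau_link C A i L \<alpha>)"

end

theory Submission
  imports Defs
begin

text \<open>A morphism out of a coend is determined by its composites with the universal dinatural family.
  Since \<open>\<phi> j\<^sub>X = \<pi>(i\<^sub>X)\<close> for \<open>X\<close> in \<open>\<B>\<close>, every structural morphism \<open>f\<^sub>A\<close> of \<open>A\<close> and its analogue
  \<open>f\<^sub>B\<close> are intertwined by tensor powers of \<open>\<phi>\<close>, because both are given on the dinatural families by
  the same formula, which \<open>\<pi>\<close> preserves. The same applies to the morphisms represented by a diagram of
  a special tangle. In \<open>\<B>\<close> negligible morphisms vanish, so the conditions defining \<open>\<I>(\<B>)\<close> are
  equalities; \<open>\<phi>\<close> carries them to equalities in the semisimplification, that is, to congruences modulo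
  negligible morphisms in \<open>\<C>\<close>. The morphism \<open>\<phi>\<^sub>T\<close> exists because the value of a diagram is dinatural in
  the colour of each arc: a coupon on an arc can be pushed along it through the critical points.\<close>

section \<open>Ribbon categories\<close>

text \<open>The coend property of B is available only inside \<B>, whereas \<phi> has the target
  \<pi>(A), which need not lie in \<B>; nor is \<pi>(A) shown to be a coend of the
  semisimplification. Equalities of morphisms out of B with such a target are therefore tested on
  the injections of the direct sum B. These are jointly epic in the whole semisimplification, also
  after tensoring, and they are the dinatural morphisms at the representatives of the simple
  objects. The second obstacle is at the minima of a diagram. A coevaluation cannot absorb a
  morphism that changes the colours on both of its sides at once, so an arc is not recoloured in one
  step: the boundary between old and new colours travels along it from one minimum to the next.
  Finally, the quotient is a ribbon category only because negligible morphisms form a tensor ideal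
  in which the identity of the unit does not lie. Closure under tensor products rests on the
  universality of evaluations and coevaluations.\<close>

lemma Hom_iff: "f \<in> Hom C X Y \<longleftrightarrow> f \<in> Mor C \<and> Dom C f = X \<and> Cod C f = Y"
  by (auto simp: Hom_def)

context ribbon_k_category
begin

abbreviation ide where "ide X \<equiv> Idm C X"
abbreviation du where "du X \<equiv> Dual C X"

lemma HomD:
  assumes "f \<in> Hom C X Y"
  shows "f \<in> Mor C" "Dom C f = X" "Cod C f = Y" "X \<in> Obj C" "Y \<in> Obj C"
  using assms dom_obj[of f] cod_obj[of f] by (auto simp: Hom_iff)

lemma ide_ty [simp]:
  assumes "X \<in> Obj C"
  shows "ide X \<in> Mor C" "Dom C (ide X) = X" "Cod C (ide X) = X"
  using id_hom[OF assms] by (auto simp: Hom_iff)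

lemma cmp_ty [simp]:
  assumes "f \<in> Mor C" "g \<in> Mor C" "Dom C g = Cod C f"
  shows "g \<cdot> f \<in> Mor C" "Dom C (g \<cdot> f) = Dom C f" "Cod C (g \<cdot> f) = Cod C g"
  using cmp_hom[of f "Dom C f" "Cod C f" g "Cod C g"] assms by (auto simp: Hom_iff)

lemma ten_ty [simp]:
  assumes "f \<in> Mor C" "g \<in> Mor C"
  shows "f \<star> g \<in> Mor C" "Dom C (f \<star> g) = Dom C f \<diamondop> Dom C g" "Cod C (f \<star> g) = Cod C f \<diamondop> Cod C g"
  using ten_hom[of f "Dom C f" "Cod C f" g "Dom C g" "Cod C g"] assms by (auto simp: Hom_iff)

lemma cmp_asc [simp]:
  assumes "f \<in> Mor C" "g \<in> Mor C" "h \<in> Mor C" "Dom C g = Cod C f" "Dom C h = Cod C g"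
  shows "(h \<cdot> g) \<cdot> f = h \<cdot> g \<cdot> f"
  using cmp_assoc[of f "Dom C f" "Cod C f" g "Cod C g" h "Cod C h"] assms by (auto simp: Hom_iff)

lemma cmp_ide [simp]:
  "f \<in> Mor C \<Longrightarrow> Dom C f = X \<Longrightarrow> f \<cdot> ide X = f"
  "f \<in> Mor C \<Longrightarrow> Cod C f = X \<Longrightarrow> ide X \<cdot> f = f"
  using cmp_id_right[of f X "Cod C f"] cmp_id_left[of f "Dom C f" X] by (auto simp: Hom_iff)

declare unit_obj [simp] ten_obj [simp] ten_obj_assoc [simp] ten_obj_unit [simp]
  dual_obj [simp] dual_unit [simp] ten_unit [simp] ten_assoc [simp] dom_obj [simp] cod_obj [simp]

lemma Ev_ty [simp]:
  assumes "X \<in> Obj C"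
  shows "Ev C X \<in> Mor C" "Dom C (Ev C X) = du X \<diamondop> X" "Cod C (Ev C X) = \<I>"
  using ev_hom[OF assms] by (auto simp: Hom_iff)

lemma Coev_ty [simp]:
  assumes "X \<in> Obj C"
  shows "Coev C X \<in> Mor C" "Dom C (Coev C X) = \<I>" "Cod C (Coev C X) = X \<diamondop> du X"
  using coev_hom[OF assms] by (auto simp: Hom_iff)

lemma Braid_ty [simp]:
  assumes "X \<in> Obj C" "Y \<in> Obj C"
  shows "Braid C X Y \<in> Mor C" "Dom C (Braid C X Y) = X \<diamondop> Y" "Cod C (Braid C X Y) = Y \<diamondop> X"
  using braid_hom[OF assms] by (auto simp: Hom_iff)

lemma Twist_ty [simp]:
  assumes "X \<in> Obj C"
  shows "Twist C X \<in> Mor C" "Dom C (Twist C X) = X" "Cod C (Twist C X) = X"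
  using twist_hom[OF assms] by (auto simp: Hom_iff)

section \<open>Inverses of isomorphisms\<close>

lemma inverse_mor_unique:
  assumes "f \<in> Mor C" "inverse_mor C f g" "inverse_mor C f h"
  shows "g = h"
proof -
  have "g = g \<cdot> f \<cdot> h" using assms by (auto simp: inverse_mor_def Hom_iff)
  also have "\<dots> = (g \<cdot> f) \<cdot> h" using assms by (subst cmp_asc) (auto simp: inverse_mor_def Hom_iff)
  also have "\<dots> = h" using assms by (auto simp: inverse_mor_def Hom_iff)
  finally show ?thesis .
qed

lemma minv_inverse:
  assumes "iso_mor C f" shows "inverse_mor C f (minv C f)"
proof -
  from assms obtain g where g: "inverse_mor C f g" and f: "f \<in> Mor C" by (auto simp: iso_mor_def)
  have "minv C f = g" unfolding minv_def
    by (rule the_equality[where P="\<lambda>g. inverse_mor C f g", OF g]) (rule inverse_mor_unique[OF f _ g])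
  then show ?thesis using g by simp
qed

lemma minv_eq:
  assumes "f \<in> Mor C" "inverse_mor C f g" shows "minv C f = g"
  using inverse_mor_unique[OF assms(1) minv_inverse assms(2)] assms by (auto simp: iso_mor_def)

lemma minv_ty [simp]:
  assumes "iso_mor C f"
  shows "minv C f \<in> Mor C" "Dom C (minv C f) = Cod C f" "Cod C (minv C f) = Dom C f"
    "minv C f \<cdot> f = ide (Dom C f)" "f \<cdot> minv C f = ide (Cod C f)"
  using minv_inverse[OF assms] by (auto simp: inverse_mor_def Hom_iff)

lemma iso_mor_Mor: "iso_mor C f \<Longrightarrow> f \<in> Mor C" by (simp add: iso_mor_def)

lemma minv_cmp [simp]:
  assumes "iso_mor C f" "h \<in> Mor C"
  shows "Cod C h = Dom C f \<Longrightarrow> minv C f \<cdot> f \<cdot> h = h" "Cod C h = Cod C f \<Longrightarrow> f \<cdot> minv C f \<cdot> h = h"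
  using assms by (simp_all add: cmp_asc[symmetric] iso_mor_Mor)

text \<open>Rewriting with the interchange law produces identities of tensor products in split form.
  These rules cancel them without a general rule that joins them.\<close>

lemma cmp_ide_ten [simp]:
  assumes "f \<in> Mor C" "X \<in> Obj C" "Y \<in> Obj C"
  shows "Dom C f = X \<diamondop> Y \<Longrightarrow> f \<cdot> (ide X \<star> ide Y) = f"
    "Cod C f = X \<diamondop> Y \<Longrightarrow> (ide X \<star> ide Y) \<cdot> f = f"
    "Z \<in> Obj C \<Longrightarrow> Dom C f = X \<diamondop> Y \<diamondop> Z \<Longrightarrow> f \<cdot> (ide X \<star> ide Y \<star> ide Z) = f"
    "Z \<in> Obj C \<Longrightarrow> Cod C f = X \<diamondop> Y \<diamondop> Z \<Longrightarrow> (ide X \<star> ide Y \<star> ide Z) \<cdot> f = f"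
  using assms by (simp_all add: ten_id)

declare braid_iso [simp] twist_iso [simp]

section \<open>The interchange law and the adjunction given by duals\<close>

lemma ide_ten: "X \<in> Obj C \<Longrightarrow> Y \<in> Obj C \<Longrightarrow> ide (X \<diamondop> Y) = ide X \<star> ide Y"
  by (simp add: ten_id)

text \<open>Oriented towards a tensor product of composites, so that the tensor factors can be
  simplified independently.\<close>

lemma fuse:
  assumes "f \<in> Mor C" "g \<in> Mor C" "f' \<in> Mor C" "g' \<in> Mor C" "Dom C g = Cod C f" "Dom C g' = Cod C f'"
  shows "(g \<star> g') \<cdot> (f \<star> f') = (g \<cdot> f) \<star> (g' \<cdot> f')"
  using ten_cmp[of f "Dom C f" "Cod C f" g "Cod C g" f' "Dom C f'" "Cod C f'" g' "Cod C g'"] assms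
  by (auto simp: Hom_iff)

text \<open>Composition is normalised to the right, so two adjacent layers of a longer composite
  meet only in front of a tail \<open>h\<close>.\<close>

lemma fuse_cmp:
  assumes "f \<in> Mor C" "g \<in> Mor C" "f' \<in> Mor C" "g' \<in> Mor C" "Dom C g = Cod C f" "Dom C g' = Cod C f'"
    "h \<in> Mor C" "Cod C h = Dom C f \<diamondop> Dom C f'"
  shows "(g \<star> g') \<cdot> (f \<star> f') \<cdot> h = ((g \<cdot> f) \<star> (g' \<cdot> f')) \<cdot> h"
  using assms by (simp add: fuse cmp_asc[symmetric])

lemma whr:
  assumes "f \<in> Mor C" "g \<in> Mor C" "Dom C g = Cod C f" "X \<in> Obj C"
  shows "(g \<cdot> f) \<star> ide X = (g \<star> ide X) \<cdot> (f \<star> ide X)"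
  using assms by (simp add: fuse)

lemma whl:
  assumes "f \<in> Mor C" "g \<in> Mor C" "Dom C g = Cod C f" "X \<in> Obj C"
  shows "ide X \<star> (g \<cdot> f) = (ide X \<star> g) \<cdot> (ide X \<star> f)"
  using assms by (simp add: fuse)

lemma zigzag:
  assumes "X \<in> Obj C"
  shows "(ide X \<star> Ev C X) \<cdot> (Coev C X \<star> ide X) = ide X"
    "(Ev C X \<star> ide (du X)) \<cdot> (ide (du X) \<star> Coev C X) = ide (du X)"
  using duality[OF assms] by auto

text \<open>\<open>bend\<close> and \<open>unbend\<close> are the two directions of the adjunction between tensoring on the right
  with \<open>X\<close> and with its dual.\<close>

definition bend where "bend W X h = (h \<star> ide (du X)) \<cdot> (ide W \<star> Coev C X)"
definition unbend where "unbend Z X k = (ide Z \<star> Ev C X) \<cdot> (k \<star> ide X)"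

lemma bend_ty [simp]:
  assumes "h \<in> Mor C" "Dom C h = W \<diamondop> X" "W \<in> Obj C" "X \<in> Obj C"
  shows "bend W X h \<in> Mor C" "Dom C (bend W X h) = W" "Cod C (bend W X h) = Cod C h \<diamondop> du X"
  using assms by (simp_all add: bend_def)

lemma unbend_ty [simp]:
  assumes "k \<in> Mor C" "Cod C k = Z \<diamondop> du X" "Z \<in> Obj C" "X \<in> Obj C"
  shows "unbend Z X k \<in> Mor C" "Dom C (unbend Z X k) = Dom C k \<diamondop> X" "Cod C (unbend Z X k) = Z"
  using assms by (simp_all add: unbend_def)

text \<open>By interchange \<open>h\<close> can be taken after the evaluation; the coevaluation and
  the evaluation then meet and straighten by the first zigzag identity.\<close>

lemma unbend_bend:
  assumes [simp]: "h \<in> Mor C" "Dom C h = W \<diamondop> X" "Cod C h = Z" "W \<in> Obj C" "X \<in> Obj C"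
  shows "unbend Z X (bend W X h) = h"
proof -
  have [simp]: "Z \<in> Obj C" using cod_obj[OF assms(1)] by simp
  have "unbend Z X (bend W X h)
      = (ide Z \<star> Ev C X) \<cdot> (h \<star> ide (du X) \<star> ide X) \<cdot> (ide W \<star> Coev C X \<star> ide X)"
    unfolding unbend_def bend_def by (simp add: whr)
  also have "\<dots> = ((ide Z \<star> Ev C X) \<cdot> (h \<star> ide (du X) \<star> ide X)) \<cdot> (ide W \<star> Coev C X \<star> ide X)"
    by simp
  also have "(ide Z \<star> Ev C X) \<cdot> (h \<star> ide (du X) \<star> ide X) = h \<star> Ev C X"
    by (simp add: fuse ten_id)
  also have "h \<star> Ev C X = h \<cdot> (ide W \<star> ide X \<star> Ev C X)"
    using fuse[of "ide (W \<diamondop> X)" h "Ev C X" "ide \<I>"] by (simp add: ide_ten)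
  also have "(h \<cdot> (ide W \<star> ide X \<star> Ev C X)) \<cdot> (ide W \<star> Coev C X \<star> ide X)
      = h \<cdot> (ide W \<star> ((ide X \<star> Ev C X) \<cdot> (Coev C X \<star> ide X)))"
    by (simp add: fuse)
  also have "\<dots> = h" by (simp add: zigzag ten_id)
  finally show ?thesis .
qed


text \<open>Here \<open>k\<close> is taken first, and the second zigzag identity straightens the
  dual strand.\<close>

lemma bend_unbend:
  assumes [simp]: "k \<in> Mor C" "Dom C k = W" "Cod C k = Z \<diamondop> du X" "Z \<in> Obj C" "X \<in> Obj C"
  shows "bend W X (unbend Z X k) = k"
proof -
  have [simp]: "W \<in> Obj C" using dom_obj[OF assms(1)] by simp
  have "bend W X (unbend Z X k)
      = (ide Z \<star> Ev C X \<star> ide (du X)) \<cdot> (k \<star> ide X \<star> ide (du X)) \<cdot> (ide W \<star> Coev C X)"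
    unfolding unbend_def bend_def by (simp add: whr)
  also have "(k \<star> ide X \<star> ide (du X)) \<cdot> (ide W \<star> Coev C X) = k \<star> Coev C X"
    by (simp add: fuse)
  also have "k \<star> Coev C X = (ide Z \<star> ide (du X) \<star> Coev C X) \<cdot> k"
    using fuse[of k "ide (Z \<diamondop> du X)" "ide \<I>" "Coev C X"] by (simp add: ide_ten)
  also have "(ide Z \<star> Ev C X \<star> ide (du X)) \<cdot> (ide Z \<star> ide (du X) \<star> Coev C X) \<cdot> k
      = (ide Z \<star> ((Ev C X \<star> ide (du X)) \<cdot> (ide (du X) \<star> Coev C X))) \<cdot> k"
    by (simp add: fuse_cmp)
  also have "\<dots> = k" by (simp add: zigzag)
  finally show ?thesis .
qed

section \<open>Universality of evaluation and coevaluation\<close>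

lemma unbend_inj:
  assumes "k \<in> Hom C W (Z \<diamondop> du X)" "k' \<in> Hom C W (Z \<diamondop> du X)" "Z \<in> Obj C" "X \<in> Obj C"
    and "unbend Z X k = unbend Z X k'"
  shows "k = k'"
  by (metis bend_unbend[OF HomD(1-3)[OF assms(1)] assms(3,4)] bend_unbend[OF HomD(1-3)[OF assms(2)] assms(3,4)]
    assms(5))

text \<open>The witness is the mate of \<open>K\<close>. Together with \<open>ev_rep\<close> it
  replaces a morphism of unknown shape by a coupon next to a single turn; this is how traces over a
  tensor product are reduced to traces over one factor.\<close>

lemma coev_rep:
  assumes "K \<in> Hom C \<I> (X \<diamondop> V)" "X \<in> Obj C" "V \<in> Obj C"
  obtains k where "k \<in> Hom C (du X) V" "K = (ide X \<star> k) \<cdot> Coev C X"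
proof
  note [simp] = HomD[OF assms(1)] assms(2,3)
  let ?k = "(Ev C X \<star> ide V) \<cdot> (ide (du X) \<star> K)"
  show "?k \<in> Hom C (du X) V" by (simp add: Hom_iff)
  have "(ide X \<star> ?k) \<cdot> Coev C X
      = (ide X \<star> Ev C X \<star> ide V) \<cdot> (ide X \<star> ide (du X) \<star> K) \<cdot> Coev C X"
    by (simp add: whl)
  also have "(ide X \<star> ide (du X) \<star> K) \<cdot> Coev C X = Coev C X \<star> K"
    using fuse[of "Coev C X" "ide X \<star> ide (du X)" "ide \<I>" K] by simp
  also have "\<dots> = (Coev C X \<star> ide X \<star> ide V) \<cdot> K"
    using fuse[of "ide \<I>" "Coev C X" K "ide X \<star> ide V"] by simp
  also have "(ide X \<star> Ev C X \<star> ide V) \<cdot> (Coev C X \<star> ide X \<star> ide V) \<cdot> K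
      = (((ide X \<star> Ev C X) \<cdot> (Coev C X \<star> ide X)) \<star> ide V) \<cdot> K"
    using fuse_cmp[of "Coev C X \<star> ide X" "ide X \<star> Ev C X" "ide V" "ide V" K] by simp
  also have "\<dots> = K" by (simp add: zigzag)
  finally show "K = (ide X \<star> ?k) \<cdot> Coev C X" ..
qed

lemma ev_rep:
  assumes "K \<in> Hom C (du X \<diamondop> Y) \<I>" "X \<in> Obj C" "Y \<in> Obj C"
  obtains k where "k \<in> Hom C Y X" "K = Ev C X \<cdot> (ide (du X) \<star> k)"
proof
  note [simp] = HomD[OF assms(1)] assms(2,3)
  let ?k = "(ide X \<star> K) \<cdot> (Coev C X \<star> ide Y)"
  show "?k \<in> Hom C Y X" by (simp add: Hom_iff)
  have "Ev C X \<cdot> (ide (du X) \<star> ?k)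
      = Ev C X \<cdot> (ide (du X) \<star> ide X \<star> K) \<cdot> (ide (du X) \<star> Coev C X \<star> ide Y)"
    by (simp add: whl)
  also have "\<dots> = (Ev C X \<cdot> (ide (du X) \<star> ide X \<star> K)) \<cdot> (ide (du X) \<star> Coev C X \<star> ide Y)"
    by simp
  also have "Ev C X \<cdot> (ide (du X) \<star> ide X \<star> K) = Ev C X \<star> K"
    using fuse[of "ide (du X) \<star> ide X" "Ev C X" K "ide \<I>"] by simp
  also have "\<dots> = K \<cdot> (Ev C X \<star> ide (du X) \<star> ide Y)"
    using fuse[of "Ev C X" "ide \<I>" "ide (du X) \<star> ide Y" K] by simp
  also have "(K \<cdot> (Ev C X \<star> ide (du X) \<star> ide Y)) \<cdot> (ide (du X) \<star> Coev C X \<star> ide Y)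
      = K \<cdot> (((Ev C X \<star> ide (du X)) \<cdot> (ide (du X) \<star> Coev C X)) \<star> ide Y)"
    using fuse[of "ide (du X) \<star> Coev C X" "Ev C X \<star> ide (du X)" "ide Y" "ide Y"] by simp
  also have "\<dots> = K" by (simp add: zigzag)
  finally show "K = Ev C X \<cdot> (ide (du X) \<star> ?k)" ..
qed

subsection \<open>Dual morphisms\<close>

text \<open>Identifies the dual as a mate, so that \<open>ev_dual\<close> and
  \<open>dual_mor_unique\<close> become instances of the bijectivity of bending.\<close>

lemma dual_mor_bend:
  assumes "f \<in> Hom C X Y"
  shows "dual_mor C f = bend (du Y) X (Ev C Y \<cdot> (ide (du Y) \<star> f))"
proof -
  note [simp] = HomD[OF assms]
  show ?thesis
    by (simp add: dual_mor_def Let_def bend_def whr)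
qed

lemma dual_mor_hom:
  assumes "f \<in> Hom C X Y" shows "dual_mor C f \<in> Hom C (du Y) (du X)"
proof -
  note [simp] = HomD[OF assms]
  show ?thesis by (simp add: dual_mor_bend[OF assms] Hom_iff)
qed

lemma dual_mor_ty [simp]:
  assumes "f \<in> Mor C"
  shows "dual_mor C f \<in> Mor C" "Dom C (dual_mor C f) = du (Cod C f)" "Cod C (dual_mor C f) = du (Dom C f)"
  using dual_mor_hom[of f "Dom C f" "Cod C f"] assms by (auto simp: Hom_iff)

lemma ev_dual:
  assumes "f \<in> Hom C X Y"
  shows "Ev C X \<cdot> (dual_mor C f \<star> ide X) = Ev C Y \<cdot> (ide (du Y) \<star> f)"
proof -
  note [simp] = HomD[OF assms]
  show ?thesis
    using unbend_bend[of "Ev C Y \<cdot> (ide (du Y) \<star> f)" "du Y" X \<I>]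
    by (simp add: dual_mor_bend[OF assms] unbend_def)
qed

lemma dual_mor_unique:
  assumes "f \<in> Hom C X Y" "h \<in> Hom C (du Y) (du X)"
    and "Ev C X \<cdot> (h \<star> ide X) = Ev C Y \<cdot> (ide (du Y) \<star> f)"
  shows "h = dual_mor C f"
proof (rule unbend_inj[of h "du Y" \<I> X])
  note [simp] = HomD[OF assms(1)] HomD[OF assms(2)]
  show "h \<in> Hom C (du Y) (\<I> \<diamondop> du X)" "dual_mor C f \<in> Hom C (du Y) (\<I> \<diamondop> du X)" "\<I> \<in> Obj C" "X \<in> Obj C"
    by (simp_all add: Hom_iff)
  show "unbend \<I> X h = unbend \<I> X (dual_mor C f)"
    by (simp add: unbend_def assms(3) ev_dual[OF assms(1)])
qed

text \<open>The last tensor factor of the target is a dual, so both sides may be compared after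
  \<open>unbend\<close>; on either side a zigzag leaves just \<open>f\<close>.\<close>

lemma coev_dual:
  assumes "f \<in> Hom C X Y"
  shows "(f \<star> ide (du X)) \<cdot> Coev C X = (ide Y \<star> dual_mor C f) \<cdot> Coev C Y"
proof (rule unbend_inj[of _ \<I> Y X])
  note [simp] = HomD[OF assms]
  show "(f \<star> ide (du X)) \<cdot> Coev C X \<in> Hom C \<I> (Y \<diamondop> du X)"
    "(ide Y \<star> dual_mor C f) \<cdot> Coev C Y \<in> Hom C \<I> (Y \<diamondop> du X)" "Y \<in> Obj C" "X \<in> Obj C"
    by (simp_all add: Hom_iff)
  have "unbend Y X ((f \<star> ide (du X)) \<cdot> Coev C X)
      = (ide Y \<star> Ev C X) \<cdot> (f \<star> ide (du X) \<star> ide X) \<cdot> (Coev C X \<star> ide X)"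
    by (simp add: unbend_def whr)
  also have "\<dots> = (f \<star> Ev C X) \<cdot> (Coev C X \<star> ide X)" by (simp add: fuse_cmp)
  also have "f \<star> Ev C X = f \<cdot> (ide X \<star> Ev C X)"
    using fuse[of "ide X" f "Ev C X" "ide \<I>"] by simp
  also have "(f \<cdot> (ide X \<star> Ev C X)) \<cdot> (Coev C X \<star> ide X) = f" by (simp add: zigzag)
  finally have 1: "unbend Y X ((f \<star> ide (du X)) \<cdot> Coev C X) = f" .
  have "unbend Y X ((ide Y \<star> dual_mor C f) \<cdot> Coev C Y)
      = (ide Y \<star> (Ev C X \<cdot> (dual_mor C f \<star> ide X))) \<cdot> (Coev C Y \<star> ide X)"
  proof -
    have "unbend Y X ((ide Y \<star> dual_mor C f) \<cdot> Coev C Y)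
      = (ide Y \<star> Ev C X) \<cdot> (ide Y \<star> dual_mor C f \<star> ide X) \<cdot> (Coev C Y \<star> ide X)"
      by (simp add: unbend_def whr)
    then show ?thesis by (simp add: fuse_cmp)
  qed
  also have "\<dots> = (ide Y \<star> Ev C Y) \<cdot> (ide Y \<star> ide (du Y) \<star> f) \<cdot> (Coev C Y \<star> ide X)"
    by (simp add: ev_dual[OF assms] whl)
  also have "(ide Y \<star> ide (du Y) \<star> f) \<cdot> (Coev C Y \<star> ide X) = (Coev C Y \<star> ide Y) \<cdot> f"
    using fuse[of "ide \<I>" "Coev C Y" f "ide Y"] fuse[of "Coev C Y" "ide Y \<star> ide (du Y)" "ide X" f] by simp
  also have "(ide Y \<star> Ev C Y) \<cdot> (Coev C Y \<star> ide Y) \<cdot> f = ((ide Y \<star> Ev C Y) \<cdot> (Coev C Y \<star> ide Y)) \<cdot> f"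
    by simp
  also have "\<dots> = f" unfolding zigzag(1)[OF \<open>Y \<in> Obj C\<close>] by simp
  finally show "unbend Y X ((f \<star> ide (du X)) \<cdot> Coev C X) = unbend Y X ((ide Y \<star> dual_mor C f) \<cdot> Coev C Y)"
    using 1 by simp
qed

lemma dual_mor_ide [simp]: "X \<in> Obj C \<Longrightarrow> dual_mor C (ide X) = ide (du X)"
  by (rule dual_mor_unique[symmetric, of _ X X]) (simp_all add: Hom_iff)

lemma dual_mor_cmp:
  assumes "f \<in> Hom C X Y" "g \<in> Hom C Y Z"
  shows "dual_mor C (g \<cdot> f) = dual_mor C f \<cdot> dual_mor C g"
proof (rule dual_mor_unique[symmetric, of _ X Z])
  note [simp] = HomD[OF assms(1)] HomD[OF assms(2)]
  show "g \<cdot> f \<in> Hom C X Z" "dual_mor C f \<cdot> dual_mor C g \<in> Hom C (du Z) (du X)" by (simp_all add: Hom_iff)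
  have "Ev C X \<cdot> ((dual_mor C f \<cdot> dual_mor C g) \<star> ide X)
      = (Ev C X \<cdot> (dual_mor C f \<star> ide X)) \<cdot> (dual_mor C g \<star> ide X)"
    by (simp add: fuse)
  also have "\<dots> = Ev C Y \<cdot> (dual_mor C g \<star> f)"
    unfolding ev_dual[OF assms(1)] by (simp add: fuse)
  also have "\<dots> = (Ev C Y \<cdot> (dual_mor C g \<star> ide Y)) \<cdot> (ide (du Z) \<star> f)" by (simp add: fuse)
  also have "\<dots> = Ev C Z \<cdot> (ide (du Z) \<star> (g \<cdot> f))"
    unfolding ev_dual[OF assms(2)] by (simp add: fuse)
  finally show "Ev C X \<cdot> ((dual_mor C f \<cdot> dual_mor C g) \<star> ide X) = Ev C Z \<cdot> (ide (du Z) \<star> (g \<cdot> f))" .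
qed

section \<open>The right evaluation and coevaluation\<close>

lemma ev_right_ty [simp]:
  assumes "X \<in> Obj C"
  shows "ev_right C X \<in> Mor C" "Dom C (ev_right C X) = X \<diamondop> du X" "Cod C (ev_right C X) = \<I>"
  using assms by (simp_all add: ev_right_def)

lemma coev_right_ty [simp]:
  assumes "X \<in> Obj C"
  shows "coev_right C X \<in> Mor C" "Dom C (coev_right C X) = \<I>" "Cod C (coev_right C X) = du X \<diamondop> X"
  using assms by (simp_all add: coev_right_def)

lemma braid_nat:
  assumes "f \<in> Mor C" "g \<in> Mor C" "Cod C f = X'" "Cod C g = Y'"
  shows "Braid C X' Y' \<cdot> (f \<star> g) = (g \<star> f) \<cdot> Braid C (Dom C f) (Dom C g)"
  using braid_natural[of f "Dom C f" "Cod C f" g "Dom C g" "Cod C g"] assms by (simp add: Hom_iff)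

lemma braid_inv_nat:
  assumes [simp]: "f \<in> Mor C" "g \<in> Mor C" and "Cod C f = X'" "Cod C g = Y'"
  shows "minv C (Braid C Y' X') \<cdot> (f \<star> g) = (g \<star> f) \<cdot> minv C (Braid C (Dom C g) (Dom C f))"
proof -
  have [simp]: "X' \<in> Obj C" "Y' \<in> Obj C" using assms by auto
  note [simp] = assms(3,4)
  let ?c = "Braid C (Dom C g) (Dom C f)"
  have "minv C (Braid C Y' X') \<cdot> (f \<star> g) = minv C (Braid C Y' X') \<cdot> ((f \<star> g) \<cdot> ?c) \<cdot> minv C ?c"
    by simp
  also have "(f \<star> g) \<cdot> ?c = Braid C Y' X' \<cdot> (g \<star> f)" by (simp add: braid_nat)
  finally show ?thesis by simp
qed

lemma twist_nat:
  assumes "f \<in> Mor C" "Cod C f = Y"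
  shows "Twist C Y \<cdot> f = f \<cdot> Twist C (Dom C f)"
  using twist_natural[of f "Dom C f" "Cod C f"] assms by (simp add: Hom_iff)

lemma twist_inv_nat:
  assumes [simp]: "f \<in> Mor C" and "Cod C f = Y"
  shows "minv C (Twist C Y) \<cdot> f = f \<cdot> minv C (Twist C (Dom C f))"
proof -
  have [simp]: "Y \<in> Obj C" using assms by auto
  note [simp] = assms(2)
  let ?t = "Twist C (Dom C f)"
  have "minv C (Twist C Y) \<cdot> f = minv C (Twist C Y) \<cdot> (f \<cdot> ?t) \<cdot> minv C ?t" by simp
  also have "f \<cdot> ?t = Twist C Y \<cdot> f" by (simp add: twist_nat)
  finally show ?thesis by simp
qed

text \<open>The right evaluation is the left one preceded by twist and braiding. Naturality carries
  \<open>f\<close> through both to the left evaluation, where it becomes its dual, and the dual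
  returns through the braiding.\<close>

lemma ev_right_dual:
  assumes "f \<in> Hom C X Y"
  shows "ev_right C Y \<cdot> (f \<star> ide (du Y)) = ev_right C X \<cdot> (ide X \<star> dual_mor C f)"
proof -
  note [simp] = HomD[OF assms]
  have "ev_right C Y \<cdot> (f \<star> ide (du Y)) = Ev C Y \<cdot> Braid C Y (du Y) \<cdot> (f \<star> ide (du Y)) \<cdot> (Twist C X \<star> ide (du Y))"
    by (simp add: ev_right_def fuse twist_nat)
  also have "\<dots> = Ev C Y \<cdot> (Braid C Y (du Y) \<cdot> (f \<star> ide (du Y))) \<cdot> (Twist C X \<star> ide (du Y))" by simp
  also have "\<dots> = (Ev C Y \<cdot> (ide (du Y) \<star> f)) \<cdot> Braid C X (du Y) \<cdot> (Twist C X \<star> ide (du Y))"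
    by (subst braid_nat) simp_all
  also have "\<dots> = Ev C X \<cdot> ((dual_mor C f \<star> ide X) \<cdot> Braid C X (du Y)) \<cdot> (Twist C X \<star> ide (du Y))"
    by (simp add: ev_dual[OF assms, symmetric])
  also have "(dual_mor C f \<star> ide X) \<cdot> Braid C X (du Y) = Braid C X (du X) \<cdot> (ide X \<star> dual_mor C f)"
    by (simp add: braid_nat)
  also have "Ev C X \<cdot> (Braid C X (du X) \<cdot> (ide X \<star> dual_mor C f)) \<cdot> (Twist C X \<star> ide (du Y))
      = Ev C X \<cdot> Braid C X (du X) \<cdot> (Twist C X \<star> dual_mor C f)"
    by (simp add: fuse)
  finally show ?thesis by (simp add: ev_right_def fuse)
qed

lemma coev_right_dual:
  assumes "f \<in> Hom C X Y"
  shows "(ide (du X) \<star> f) \<cdot> coev_right C X = (dual_mor C f \<star> ide Y) \<cdot> coev_right C Y"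
proof -
  note [simp] = HomD[OF assms]
  have "(ide (du X) \<star> f) \<cdot> coev_right C X
      = (ide (du X) \<star> minv C (Twist C Y)) \<cdot> (ide (du X) \<star> f) \<cdot> minv C (Braid C (du X) X) \<cdot> Coev C X"
    by (simp add: coev_right_def fuse_cmp twist_inv_nat)
  also have "\<dots> = (ide (du X) \<star> minv C (Twist C Y)) \<cdot> ((ide (du X) \<star> f) \<cdot> minv C (Braid C (du X) X)) \<cdot> Coev C X"
    by simp
  also have "(ide (du X) \<star> f) \<cdot> minv C (Braid C (du X) X) = minv C (Braid C (du X) Y) \<cdot> (f \<star> ide (du X))"
    by (simp add: braid_inv_nat)
  also have "(ide (du X) \<star> minv C (Twist C Y)) \<cdot> (minv C (Braid C (du X) Y) \<cdot> (f \<star> ide (du X))) \<cdot> Coev C X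
      = (ide (du X) \<star> minv C (Twist C Y)) \<cdot> (minv C (Braid C (du X) Y) \<cdot> (ide Y \<star> dual_mor C f)) \<cdot> Coev C Y"
    by (simp add: coev_dual[OF assms])
  also have "minv C (Braid C (du X) Y) \<cdot> (ide Y \<star> dual_mor C f) = (dual_mor C f \<star> ide Y) \<cdot> minv C (Braid C (du Y) Y)"
    by (subst braid_inv_nat) simp_all
  finally show ?thesis by (simp add: coev_right_def fuse_cmp)
qed

subsection \<open>Linear structure\<close>

lemma Scl_ty [simp]:
  assumes "f \<in> Mor C"
  shows "Scl C a f \<in> Mor C" "Dom C (Scl C a f) = Dom C f" "Cod C (Scl C a f) = Cod C f"
  using scl_hom[of f "Dom C f" "Cod C f" a] assms by (auto simp: Hom_iff)

lemma Zer_hom: "X \<in> Obj C \<Longrightarrow> Y \<in> Obj C \<Longrightarrow> Zer C X Y \<in> Hom C X Y"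
  using comm_group.axioms(2)[OF hom_abelian, of X Y, THEN group.is_monoid, THEN monoid.one_closed]
  by (simp add: hom_group_def)

lemma Zer_ty [simp]:
  assumes "X \<in> Obj C" "Y \<in> Obj C"
  shows "Zer C X Y \<in> Mor C" "Dom C (Zer C X Y) = X" "Cod C (Zer C X Y) = Y"
  using Zer_hom[OF assms] by (auto simp: Hom_iff)

lemma Add_hom:
  assumes "f \<in> Hom C X Y" "g \<in> Hom C X Y" shows "Add C f g \<in> Hom C X Y"
  using comm_group.axioms(2)[OF hom_abelian, of X Y, THEN group.is_monoid, THEN monoid.m_closed] assms HomD[OF assms(1)]
  by (simp add: hom_group_def)

lemma Add_ty [simp]:
  assumes "f \<in> Mor C" "g \<in> Mor C" "Dom C g = Dom C f" "Cod C g = Cod C f"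
  shows "Add C f g \<in> Mor C" "Dom C (Add C f g) = Dom C f" "Cod C (Add C f g) = Cod C f"
  using Add_hom[of f "Dom C f" "Cod C f" g] assms by (auto simp: Hom_iff)

lemma Add_comm: 
  assumes "f \<in> Hom C X Y" "g \<in> Hom C X Y" shows "Add C f g = Add C g f"
  using comm_monoid.m_comm[OF comm_group.axioms(1)[OF hom_abelian], of X Y f g] assms HomD[OF assms(1)]
  by (simp add: hom_group_def)

lemma Add_assoc:
  assumes "f \<in> Hom C X Y" "g \<in> Hom C X Y" "h \<in> Hom C X Y"
  shows "Add C (Add C f g) h = Add C f (Add C g h)"
  using monoid.m_assoc[OF group.is_monoid[OF comm_group.axioms(2)[OF hom_abelian]], of X Y f g h]
    assms HomD[OF assms(1)]
  by (simp add: hom_group_def)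

lemma Add_Zer [simp]:
  assumes "f \<in> Mor C" "Dom C f = X" "Cod C f = Y"
  shows "Add C f (Zer C X Y) = f" "Add C (Zer C X Y) f = f"
  using monoid.r_one[OF group.is_monoid[OF comm_group.axioms(2)[OF hom_abelian]], of X Y f]
    monoid.l_one[OF group.is_monoid[OF comm_group.axioms(2)[OF hom_abelian]], of X Y f] 
    assms dom_obj[of f] cod_obj[of f]
  by (auto simp: hom_group_def Hom_iff)

lemma Add_cancel:
  assumes "f \<in> Hom C X Y" "g \<in> Hom C X Y" "h \<in> Hom C X Y" "Add C f g = Add C f h"
  shows "g = h"
proof -
  have G: "group (hom_group C X Y)" using comm_group.axioms(2)[OF hom_abelian] HomD[OF assms(1)] by blast
  show ?thesis
    using monoid.Units_l_cancel[OF group.is_monoid[OF G], of f g h] assms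
    unfolding group.Units_eq[OF G] by (simp add: hom_group_def)
qed

lemma Scl_0 [simp]:
  assumes f: "f \<in> Mor C" shows "Scl C 0 f = Zer C (Dom C f) (Cod C f)"
proof (rule Add_cancel[of "Scl C 0 f" "Dom C f" "Cod C f"])
  have "Add C (Scl C 0 f) (Scl C 0 f) = Scl C (0 + 0) f" using scl_add_left[OF f, of 0 0] by simp
  then show "Add C (Scl C 0 f) (Scl C 0 f) = Add C (Scl C 0 f) (Zer C (Dom C f) (Cod C f))"
    using f by simp
qed (use f in \<open>simp_all add: Hom_iff\<close>)

lemma Scl_1 [simp]: "f \<in> Mor C \<Longrightarrow> Scl C 1 f = f" by (rule scl_one)

lemma cmp_Scl [simp]:
  assumes "f \<in> Mor C" "g \<in> Mor C" "Dom C g = Cod C f"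
  shows "g \<cdot> Scl C a f = Scl C a (g \<cdot> f)" "Scl C a g \<cdot> f = Scl C a (g \<cdot> f)"
  using cmp_scl[of f "Dom C f" "Cod C f" g "Cod C g"] assms by (auto simp: Hom_iff)

lemma ten_Scl [simp]:
  assumes "f \<in> Mor C" "g \<in> Mor C"
  shows "Scl C a f \<star> g = Scl C a (f \<star> g)" "f \<star> Scl C a g = Scl C a (f \<star> g)"
  using ten_scl assms by auto

lemma Scl_Add:
  assumes "f \<in> Mor C" "g \<in> Mor C" "Dom C g = Dom C f" "Cod C g = Cod C f"
  shows "Scl C a (Add C f g) = Add C (Scl C a f) (Scl C a g)"
  using scl_add_right[of f "Dom C f" "Cod C f" g] assms by (auto simp: Hom_iff)

lemma cmp_Add:
  assumes "f \<in> Mor C" "f' \<in> Mor C" "Dom C f' = Dom C f" "Cod C f' = Cod C f" "h \<in> Mor C"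
  shows "Dom C h = Cod C f \<Longrightarrow> h \<cdot> Add C f f' = Add C (h \<cdot> f) (h \<cdot> f')"
    "Dom C f = Cod C h \<Longrightarrow> Add C f f' \<cdot> h = Add C (f \<cdot> h) (f' \<cdot> h)"
  using cmp_add(1)[of f "Dom C f" "Cod C f" f' h "Cod C h"] 
    cmp_add(2)[of h "Dom C h" "Cod C h" f "Cod C f" f'] assms by (auto simp: Hom_iff)

lemma ten_Add:
  assumes "f \<in> Mor C" "f' \<in> Mor C" "Dom C f' = Dom C f" "Cod C f' = Cod C f" "h \<in> Mor C"
  shows "h \<star> Add C f f' = Add C (h \<star> f) (h \<star> f')" "Add C f f' \<star> h = Add C (f \<star> h) (f' \<star> h)"
  using ten_add(2)[of h "Dom C h" "Cod C h" f "Dom C f" "Cod C f" f'] 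
    ten_add(1)[of f "Dom C f" "Cod C f" f' h "Dom C h" "Cod C h"] assms by (auto simp: Hom_iff)

lemma cmp_Zer [simp]:
  assumes "X \<in> Obj C" "Y \<in> Obj C" "h \<in> Mor C"
  shows "Dom C h = Y \<Longrightarrow> h \<cdot> Zer C X Y = Zer C X (Cod C h)"
    "Cod C h = X \<Longrightarrow> Zer C X Y \<cdot> h = Zer C (Dom C h) Y"
  using cmp_Scl(1)[of "Zer C X Y" h 0] cmp_Scl(2)[of h "Zer C X Y" 0] assms by auto

lemma ten_Zer [simp]:
  assumes "X \<in> Obj C" "Y \<in> Obj C" "h \<in> Mor C"
  shows "h \<star> Zer C X Y = Zer C (Dom C h \<diamondop> X) (Cod C h \<diamondop> Y)"
    "Zer C X Y \<star> h = Zer C (X \<diamondop> Dom C h) (Y \<diamondop> Cod C h)"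
  using ten_Scl(1)[of "Zer C X Y" h 0] ten_Scl(2)[of h "Zer C X Y" 0] assms by auto

lemma Scl_Zer [simp]: "X \<in> Obj C \<Longrightarrow> Y \<in> Obj C \<Longrightarrow> Scl C a (Zer C X Y) = Zer C X Y"
  using scl_mult[of "Zer C X Y" a 0] by simp

lemma msub_hom: "f \<in> Hom C X Y \<Longrightarrow> g \<in> Hom C X Y \<Longrightarrow> msub C f g \<in> Hom C X Y"
  unfolding msub_def by (rule Add_hom) (simp_all add: Hom_iff)

lemma msub_self: "f \<in> Mor C \<Longrightarrow> msub C f f = Zer C (Dom C f) (Cod C f)"
  using scl_add_left[of f 1 "- 1"] by (simp add: msub_def)

lemma Add_msub:
  assumes "f \<in> Hom C X Y" "g \<in> Hom C X Y" shows "Add C (msub C f g) g = f"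
proof -
  note [simp] = HomD[OF assms(1)] HomD[OF assms(2)]
  have "Add C (msub C f g) g = Add C f (msub C g g)"
    unfolding msub_def using assms
    by (subst Add_assoc[of _ X Y]) (simp_all add: Add_comm[of _ X Y] Hom_iff)
  then show ?thesis by (simp add: msub_self)
qed

lemma msub_eq_Zer:
  assumes "f \<in> Hom C X Y" "g \<in> Hom C X Y" shows "msub C f g = Zer C X Y \<longleftrightarrow> f = g"
proof
  note [simp] = HomD[OF assms(1)] HomD[OF assms(2)]
  show "f = g" if "msub C f g = Zer C X Y" using Add_msub[OF assms] by (simp add: that)
  show "msub C f g = Zer C X Y" if "f = g" by (simp add: that msub_self)
qed

lemma cmp_msub:
  assumes "f \<in> Mor C" "f' \<in> Mor C" "Dom C f' = Dom C f" "Cod C f' = Cod C f" "h \<in> Mor C"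
  shows "Dom C h = Cod C f \<Longrightarrow> h \<cdot> msub C f f' = msub C (h \<cdot> f) (h \<cdot> f')"
    "Dom C f = Cod C h \<Longrightarrow> msub C f f' \<cdot> h = msub C (f \<cdot> h) (f' \<cdot> h)"
  using assms by (simp_all add: msub_def cmp_Add)

lemma ten_msub:
  assumes "f \<in> Mor C" "f' \<in> Mor C" "Dom C f' = Dom C f" "Cod C f' = Cod C f" "h \<in> Mor C"
  shows "h \<star> msub C f f' = msub C (h \<star> f) (h \<star> f')" "msub C f f' \<star> h = msub C (f \<star> h) (f' \<star> h)"
  using assms by (simp_all add: msub_def ten_Add)

section \<open>Finite sums of morphisms\<close>

lemma msum_empty [simp]: "X \<in> Obj C \<Longrightarrow> Y \<in> Obj C \<Longrightarrow> msum C X Y f {} = Zer C X Y"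
  using comm_monoid.finprod_empty[OF comm_group.axioms(1)[OF hom_abelian], of X Y f]
  by (simp add: msum_def hom_group_def)

lemma msum_insert:
  assumes "finite I" "a \<notin> I" "\<And>i. i \<in> insert a I \<Longrightarrow> f i \<in> Hom C X Y" "X \<in> Obj C" "Y \<in> Obj C"
  shows "msum C X Y f (insert a I) = Add C (f a) (msum C X Y f I)"
  using comm_monoid.finprod_insert[OF comm_group.axioms(1)[OF hom_abelian], of X Y I a f] assms
  by (auto simp: msum_def hom_group_def)

lemma msum_hom:
  assumes "finite I" "\<And>i. i \<in> I \<Longrightarrow> f i \<in> Hom C X Y" "X \<in> Obj C" "Y \<in> Obj C"
  shows "msum C X Y f I \<in> Hom C X Y"
  using assms(1,2)
proof (induction I rule: finite_induct)
  case (insert a I)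
  then show ?case using assms(3,4) by (subst msum_insert) (auto intro: Add_hom)
qed (simp add: assms Zer_hom)

lemma msum_cong:
  assumes "finite I" "\<And>i. i \<in> I \<Longrightarrow> f i \<in> Hom C X Y" "\<And>i. i \<in> I \<Longrightarrow> f i = g i" "X \<in> Obj C" "Y \<in> Obj C"
  shows "msum C X Y f I = msum C X Y g I"
  using assms(1,2,3)
proof (induction I rule: finite_induct)
  case (insert a I)
  have "g i \<in> Hom C X Y" if "i \<in> insert a I" for i using insert.prems[OF that] by simp
  then have "msum C X Y g (insert a I) = Add C (g a) (msum C X Y g I)"
    using insert.hyps assms(4,5) by (intro msum_insert) auto
  then show ?case using insert by (subst msum_insert) (auto simp: assms(4,5))
qed (simp add: assms(4,5))

text \<open>Stated for an arbitrary additive map between Hom-groups: besides composition it is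
  applied to longer expressions that contain the summand in one place.\<close>

lemma msum_additive:
  assumes "finite I" "\<And>i. i \<in> I \<Longrightarrow> f i \<in> Hom C X Y"
    and F: "\<And>u v. u \<in> Hom C X Y \<Longrightarrow> v \<in> Hom C X Y \<Longrightarrow> F (Add C u v) = Add C (F u) (F v)"
    and "\<And>u. u \<in> Hom C X Y \<Longrightarrow> F u \<in> Hom C X' Y'" and "F (Zer C X Y) = Zer C X' Y'"
    and "X \<in> Obj C" "Y \<in> Obj C" "X' \<in> Obj C" "Y' \<in> Obj C"
  shows "F (msum C X Y f I) = msum C X' Y' (\<lambda>i. F (f i)) I"
  using assms(1,2)
proof (induction I rule: finite_induct)
  case (insert a I)
  then show ?case using assms(4-)
    by (subst (1 2) msum_insert) (auto simp: F msum_hom)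
qed (simp add: assms)

lemma cmp_msum:
  assumes "finite I" "\<And>i. i \<in> I \<Longrightarrow> f i \<in> Hom C X Y" "X \<in> Obj C" "Y \<in> Obj C" "h \<in> Mor C"
  shows "Dom C h = Y \<Longrightarrow> h \<cdot> msum C X Y f I = msum C X (Cod C h) (\<lambda>i. h \<cdot> f i) I"
    "Cod C h = X \<Longrightarrow> msum C X Y f I \<cdot> h = msum C (Dom C h) Y (\<lambda>i. f i \<cdot> h) I"
   apply (rule msum_additive[of I f X Y "\<lambda>u. h \<cdot> u"]; use assms in \<open>auto simp: cmp_Add Hom_iff\<close>)
  apply (rule msum_additive[of I f X Y "\<lambda>u. u \<cdot> h"]; use assms in \<open>auto simp: cmp_Add Hom_iff\<close>)
  done

lemma dual_mor_Add:
  assumes "f \<in> Hom C X Y" "g \<in> Hom C X Y"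
  shows "dual_mor C (Add C f g) = Add C (dual_mor C f) (dual_mor C g)"
proof -
  note [simp] = HomD[OF assms(1)] HomD[OF assms(2)]
  show ?thesis by (simp add: dual_mor_def Let_def ten_Add cmp_Add)
qed

lemma dual_mor_Scl:
  assumes [simp]: "f \<in> Mor C" shows "dual_mor C (Scl C a f) = Scl C a (dual_mor C f)"
  by (simp add: dual_mor_def Let_def)

lemma dual_mor_Zer:
  assumes [simp]: "X \<in> Obj C" "Y \<in> Obj C" shows "dual_mor C (Zer C X Y) = Zer C (du Y) (du X)"
  by (simp add: dual_mor_def Let_def)

lemma msum_delta:
  assumes "finite I" "a \<in> I" "u \<in> Hom C X Y" "X \<in> Obj C" "Y \<in> Obj C"
    and "\<And>i. i \<in> I \<Longrightarrow> f i = (if i = a then u else Zer C X Y)"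
  shows "msum C X Y f I = u"
proof -
  have H: "f i \<in> Hom C X Y" if "i \<in> I" for i using assms(3-5) assms(6)[OF that] by (simp add: Zer_hom)
  have Z: "finite J \<Longrightarrow> J \<subseteq> I - {a} \<Longrightarrow> msum C X Y f J = Zer C X Y" for J
  proof (induction J rule: finite_induct)
    case (insert b J)
    have "msum C X Y f (insert b J) = Add C (f b) (msum C X Y f J)"
      using insert assms(4,5) H by (intro msum_insert) auto
    then show ?case using insert assms(4,5,6) by simp
  qed (use assms in simp)
  have "msum C X Y f (insert a (I - {a})) = Add C (f a) (msum C X Y f (I - {a}))"
    using assms(1,2,4,5) H by (intro msum_insert) auto
  then show ?thesis using Z[of "I - {a}"] assms(1,2,6) HomD[OF assms(3)] by (simp add: insert_absorb)
qed

subsection \<open>Traces and negligible morphisms\<close>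

lemma scalar_hom:
  assumes "f \<in> Hom C \<I> \<I>" shows "f = Scl C (to_scalar C f) (ide \<I>)"
proof -
  have b: "bij_betw (\<lambda>a. Scl C a (ide \<I>)) UNIV (Hom C \<I> \<I>)" using unit_scalar by (simp add: scalar_object_def)
  have "\<exists>!a. f = Scl C a (ide \<I>)"
    using b assms by (auto simp: bij_betw_def inj_on_def)
  then show ?thesis unfolding to_scalar_def by (rule theI')
qed

lemma to_scalar_Scl [simp]: "to_scalar C (Scl C a (ide \<I>)) = a"
proof -
  have b: "bij_betw (\<lambda>a. Scl C a (ide \<I>)) UNIV (Hom C \<I> \<I>)" using unit_scalar by (simp add: scalar_object_def)
  then have "Scl C a (ide \<I>) \<in> Hom C \<I> \<I>" by (auto simp: Hom_iff)
  from scalar_hom[OF this] b show ?thesis by (auto simp: bij_betw_def inj_on_def)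
qed

lemma to_scalar_eq_0: "f \<in> Hom C \<I> \<I> \<Longrightarrow> to_scalar C f = 0 \<longleftrightarrow> f = Zer C \<I> \<I>"
  using scalar_hom[of f] to_scalar_Scl[of 0] by auto

text \<open>The trace as an endomorphism of the unit. It avoids the definite description in
  \<open>to_scalar\<close>, so that linearity and cyclicity become plain equations between
  morphisms.\<close>

definition tr_mor where "tr_mor X f = ev_right C X \<cdot> (f \<star> ide (du X)) \<cdot> Coev C X"

lemma tr_mor_hom:
  assumes "f \<in> Hom C X X" shows "tr_mor X f \<in> Hom C \<I> \<I>"
proof -
  note [simp] = HomD[OF assms]
  show ?thesis by (simp add: tr_mor_def Hom_iff)
qed

lemma qtrace_0_iff:
  assumes "f \<in> Hom C X X" shows "qtrace C f = 0 \<longleftrightarrow> tr_mor X f = Zer C \<I> \<I>"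
  using to_scalar_eq_0[OF tr_mor_hom[OF assms]] HomD[OF assms] by (simp add: qtrace_def tr_mor_def)

text \<open>\<open>g\<close> is slid around the closed strand: across the right evaluation it
  becomes its dual on the returning strand, and across the coevaluation it comes back on the other
  side of \<open>f\<close>.\<close>

lemma tr_mor_cyclic:
  assumes "f \<in> Hom C X Y" "g \<in> Hom C Y X" shows "tr_mor X (g \<cdot> f) = tr_mor Y (f \<cdot> g)"
proof -
  note [simp] = HomD[OF assms(1)] HomD[OF assms(2)]
  have "tr_mor X (g \<cdot> f) = (ev_right C X \<cdot> (g \<star> ide (du X))) \<cdot> (f \<star> ide (du X)) \<cdot> Coev C X"
    by (simp add: tr_mor_def whr)
  also have "\<dots> = ev_right C Y \<cdot> (f \<star> dual_mor C g) \<cdot> Coev C X"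
    unfolding ev_right_dual[OF assms(2)] by (simp add: fuse_cmp)
  also have "(f \<star> dual_mor C g) \<cdot> Coev C X = (f \<star> ide (du Y)) \<cdot> (ide X \<star> dual_mor C g) \<cdot> Coev C X"
    by (simp add: fuse_cmp)
  also have "\<dots> = (f \<star> ide (du Y)) \<cdot> (g \<star> ide (du Y)) \<cdot> Coev C Y"
    by (simp add: coev_dual[OF assms(2)])
  finally show ?thesis by (simp add: tr_mor_def fuse_cmp)
qed

lemma Negl_iff:
  "f \<in> Negl C X Y \<longleftrightarrow> f \<in> Hom C X Y \<and> (\<forall>g\<in>Hom C Y X. tr_mor X (g \<cdot> f) = Zer C \<I> \<I>)"
  using qtrace_0_iff[OF cmp_hom] by (auto simp: Negl_def)

lemma Negl_hom: "f \<in> Negl C X Y \<Longrightarrow> f \<in> Hom C X Y" by (simp add: Negl_def)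

lemma Negl_Zer: "X \<in> Obj C \<Longrightarrow> Y \<in> Obj C \<Longrightarrow> Zer C X Y \<in> Negl C X Y"
  by (auto simp: Negl_iff tr_mor_def Hom_iff)

lemma Negl_Add:
  assumes "f \<in> Negl C X Y" "g \<in> Negl C X Y" shows "Add C f g \<in> Negl C X Y"
proof -
  have f: "f \<in> Hom C X Y" and g: "g \<in> Hom C X Y" using assms by (simp_all add: Negl_hom)
  note [simp] = HomD[OF f] HomD[OF g]
  have "tr_mor X (h \<cdot> Add C f g) = Add C (tr_mor X (h \<cdot> f)) (tr_mor X (h \<cdot> g))" if h: "h \<in> Hom C Y X" for h
    using HomD[OF h] by (simp add: tr_mor_def cmp_Add ten_Add)
  then show ?thesis using assms by (simp add: Negl_iff Add_hom)
qed

lemma Negl_Scl: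
  assumes "f \<in> Negl C X Y" shows "Scl C a f \<in> Negl C X Y"
proof -
  have f: "f \<in> Hom C X Y" using assms by (simp add: Negl_hom)
  note [simp] = HomD[OF f]
  have "tr_mor X (h \<cdot> Scl C a f) = Scl C a (tr_mor X (h \<cdot> f))" if h: "h \<in> Hom C Y X" for h
    using HomD[OF h] by (simp add: tr_mor_def)
  then show ?thesis using assms by (simp add: Negl_iff scl_hom)
qed

lemma Negl_cmp_left:
  assumes "f \<in> Negl C X Y" "h \<in> Hom C Y Z" shows "h \<cdot> f \<in> Negl C X Z"
proof -
  have f: "f \<in> Hom C X Y" using assms by (simp add: Negl_hom)
  have "tr_mor X (g \<cdot> h \<cdot> f) = Zer C \<I> \<I>" if g: "g \<in> Hom C Z X" for g
    using assms(1) cmp_hom[OF assms(2) g] cmp_assoc[OF f assms(2) g] unfolding Negl_iff by metis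
  then show ?thesis using cmp_hom[OF f assms(2)] by (simp add: Negl_iff)
qed

text \<open>The definition tests only with morphisms composed afterwards; cyclicity of the trace
  moves \<open>h\<close> to that end.\<close>

lemma Negl_cmp_right:
  assumes "f \<in> Negl C X Y" "h \<in> Hom C W X" shows "f \<cdot> h \<in> Negl C W Y"
proof -
  have f: "f \<in> Hom C X Y" using assms by (simp add: Negl_hom)
  have "tr_mor W (g \<cdot> f \<cdot> h) = Zer C \<I> \<I>" if g: "g \<in> Hom C Y W" for g
  proof -
    have "tr_mor W (g \<cdot> f \<cdot> h) = tr_mor W ((g \<cdot> f) \<cdot> h)" using cmp_assoc[OF assms(2) f g] by simp
    also have "\<dots> = tr_mor X (h \<cdot> g \<cdot> f)" using tr_mor_cyclic[OF assms(2) cmp_hom[OF f g]] .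
    also have "\<dots> = tr_mor X ((h \<cdot> g) \<cdot> f)" using cmp_assoc[OF f g assms(2)] by simp
    also have "\<dots> = Zer C \<I> \<I>" using assms(1) cmp_hom[OF g assms(2)] by (simp add: Negl_iff)
    finally show ?thesis .
  qed
  then show ?thesis using cmp_hom[OF assms(2) f] by (simp add: Negl_iff)
qed

text \<open>Follows from \<open>ev_rep\<close> once the braiding is removed; the inverse twist in
  the witness cancels the twist contained in \<open>ev_right\<close>.\<close>

lemma ev_right_rep:
  assumes "K \<in> Hom C (Y \<diamondop> du X) \<I>" "X \<in> Obj C" "Y \<in> Obj C"
  obtains k where "k \<in> Hom C Y X" "K = ev_right C X \<cdot> (k \<star> ide (du X))"
proof -
  note [simp] = HomD[OF assms(1)] assms(2,3)
  have "K \<cdot> minv C (Braid C Y (du X)) \<in> Hom C (du X \<diamondop> Y) \<I>" by (simp add: Hom_iff)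
  then obtain k where k: "k \<in> Hom C Y X" "K \<cdot> minv C (Braid C Y (du X)) = Ev C X \<cdot> (ide (du X) \<star> k)"
    using assms(2,3) by (rule ev_rep)
  note [simp] = HomD[OF k(1)]
  let ?g = "minv C (Twist C X) \<cdot> k"
  have "ev_right C X \<cdot> (?g \<star> ide (du X)) = Ev C X \<cdot> Braid C X (du X) \<cdot> (k \<star> ide (du X))"
    by (simp add: ev_right_def fuse)
  also have "Braid C X (du X) \<cdot> (k \<star> ide (du X)) = (ide (du X) \<star> k) \<cdot> Braid C Y (du X)"
    by (simp add: braid_nat)
  also have "Ev C X \<cdot> (ide (du X) \<star> k) \<cdot> Braid C Y (du X) = (Ev C X \<cdot> (ide (du X) \<star> k)) \<cdot> Braid C Y (du X)"
    by simp
  also have "\<dots> = (K \<cdot> minv C (Braid C Y (du X))) \<cdot> Braid C Y (du X)" by (simp only: k(2))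
  also have "\<dots> = K" by simp
  finally have "K = ev_right C X \<cdot> (?g \<star> ide (du X))" by simp
  moreover have "?g \<in> Hom C Y X" by (simp add: Hom_iff)
  ultimately show thesis using that by blast
qed

text \<open>Because evaluations and coevaluations are universal, the functional \<open>f \<mapsto> tr (g (f \<star> id))\<close> has
  the form \<open>f \<mapsto> tr (h f)\<close>; neither a partial trace nor the trace of a tensor product is computed.\<close>

lemma Negl_ten_right:
  assumes "f \<in> Negl C X Y" "Z \<in> Obj C" shows "f \<star> ide Z \<in> Negl C (X \<diamondop> Z) (Y \<diamondop> Z)"
proof -
  have f: "f \<in> Hom C X Y" using assms by (simp add: Negl_hom)
  note [simp] = HomD[OF f] assms(2)
  have "tr_mor (X \<diamondop> Z) (g \<cdot> (f \<star> ide Z)) = Zer C \<I> \<I>" if g: "g \<in> Hom C (Y \<diamondop> Z) (X \<diamondop> Z)" for g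
  proof -
    note [simp] = HomD[OF g]
    let ?U = "du (X \<diamondop> Z)"
    have "Coev C (X \<diamondop> Z) \<in> Hom C \<I> (X \<diamondop> Z \<diamondop> ?U)" by (simp add: Hom_iff)
    then obtain k where k: "k \<in> Hom C (du X) (Z \<diamondop> ?U)" "Coev C (X \<diamondop> Z) = (ide X \<star> k) \<cdot> Coev C X"
      by (rule coev_rep) simp_all
    note [simp] = HomD[OF k(1)]
    let ?K = "ev_right C (X \<diamondop> Z) \<cdot> (g \<star> ide ?U) \<cdot> (ide Y \<star> k)"
    have "?K \<in> Hom C (Y \<diamondop> du X) \<I>" by (simp add: Hom_iff)
    then obtain h where h: "h \<in> Hom C Y X" "?K = ev_right C X \<cdot> (h \<star> ide (du X))"
      by (rule ev_right_rep) simp_all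
    note [simp] = HomD[OF h(1)]
    have "tr_mor (X \<diamondop> Z) (g \<cdot> (f \<star> ide Z))
        = ev_right C (X \<diamondop> Z) \<cdot> (g \<star> ide ?U) \<cdot> (f \<star> ide Z \<star> ide ?U) \<cdot> (ide X \<star> k) \<cdot> Coev C X"
      by (simp add: tr_mor_def k(2) whr)
    also have "(f \<star> ide Z \<star> ide ?U) \<cdot> (ide X \<star> k) \<cdot> Coev C X = (ide Y \<star> k) \<cdot> (f \<star> ide (du X)) \<cdot> Coev C X"
      by (simp add: fuse_cmp)
    also have "ev_right C (X \<diamondop> Z) \<cdot> (g \<star> ide ?U) \<cdot> (ide Y \<star> k) \<cdot> (f \<star> ide (du X)) \<cdot> Coev C X
        = ?K \<cdot> (f \<star> ide (du X)) \<cdot> Coev C X" by simp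
    also have "\<dots> = tr_mor X (h \<cdot> f)" unfolding h(2) by (simp add: tr_mor_def fuse_cmp)
    also have "\<dots> = Zer C \<I> \<I>" using assms(1) h(1) by (simp add: Negl_iff)
    finally show ?thesis .
  qed
  then show ?thesis by (simp add: Negl_iff) (simp add: Hom_iff)
qed

text \<open>By naturality, conjugation with the braiding interchanges tensoring on the right and on
  the left.\<close>

lemma Negl_ten_left:
  assumes "f \<in> Negl C X Y" "Z \<in> Obj C" shows "ide Z \<star> f \<in> Negl C (Z \<diamondop> X) (Z \<diamondop> Y)"
proof -
  have f: "f \<in> Hom C X Y" using assms by (simp add: Negl_hom)
  note [simp] = HomD[OF f] assms(2)
  have "minv C (Braid C Z Y) \<cdot> (f \<star> ide Z) \<cdot> Braid C Z X = ide Z \<star> f"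
    using braid_nat[of "ide Z" f Z Y, symmetric] by simp
  moreover have "minv C (Braid C Z Y) \<cdot> (f \<star> ide Z) \<cdot> Braid C Z X \<in> Negl C (Z \<diamondop> X) (Z \<diamondop> Y)"
    by (rule Negl_cmp_left[OF Negl_cmp_right[OF Negl_ten_right[OF assms]]]) (simp_all add: Hom_iff)
  ultimately show ?thesis by simp
qed

subsection \<open>The unit object\<close>

lemma ev_coev_unit: "Ev C \<I> \<cdot> Coev C \<I> = ide \<I>"
  using duality(1)[OF unit_obj] by simp

text \<open>At the unit object, the hexagon and the compatibility of the twist with tensor products
  say only that braiding and twist are idempotent; invertibility then makes them identities.\<close>

lemma iso_idem:
  assumes "iso_mor C f" "f \<cdot> f = f" "Dom C f = X" "Cod C f = X"
  shows "f = ide X"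
proof -
  have f: "f \<in> Mor C" using assms(1) by (rule iso_mor_Mor)
  have "f = minv C f \<cdot> f \<cdot> f" using assms(1,3,4) f by simp
  also have "\<dots> = ide X" using assms f by simp
  finally show ?thesis .
qed

lemma braid_unit: "Braid C \<I> \<I> = ide \<I>"
  using braid_ten(1)[of \<I> \<I> \<I>] by (intro iso_idem) simp_all

lemma twist_unit: "Twist C \<I> = ide \<I>"
proof (rule iso_idem)
  have "Twist C \<I> = Twist C \<I> \<star> Twist C \<I>" using twist_ten[of \<I> \<I>] by (simp add: braid_unit)
  also have "\<dots> = Twist C \<I> \<cdot> Twist C \<I>"
    using fuse[of "ide \<I>" "Twist C \<I>" "Twist C \<I>" "ide \<I>"] by simp
  finally show "Twist C \<I> \<cdot> Twist C \<I> = Twist C \<I>" by simp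
qed simp_all

text \<open>On the unit object the trace of a scalar is that scalar, since braiding, twist and the
  composite of the two turns are trivial there. This keeps the endomorphisms of the unit equal to
  the field in the quotient.\<close>

lemma ide_unit_not_negl: "a \<noteq> 0 \<Longrightarrow> Scl C a (ide \<I>) \<notin> Negl C \<I> \<I>"
proof
  assume a: "a \<noteq> 0" and n: "Scl C a (ide \<I>) \<in> Negl C \<I> \<I>"
  have "tr_mor \<I> (ide \<I> \<cdot> Scl C a (ide \<I>)) = Zer C \<I> \<I>" using n by (auto simp: Negl_iff Hom_iff)
  moreover have "tr_mor \<I> (ide \<I> \<cdot> Scl C a (ide \<I>)) = Scl C a (ide \<I>)"
    by (simp add: tr_mor_def ev_right_def braid_unit twist_unit ev_coev_unit)
  ultimately show False using a to_scalar_eq_0[of "Scl C a (ide \<I>)"] by (simp add: Hom_iff)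
qed

section \<open>The semisimplification\<close>

abbreviation \<pi> where "\<pi> \<equiv> proj_mor C"
abbreviation Cs where "Cs \<equiv> semisimplification C"

text \<open>Membership in the Hom-set is part of the relation, so that each instance carries its own
  typing.\<close>

definition equiv_mor where
  "equiv_mor X Y f g \<longleftrightarrow> f \<in> Hom C X Y \<and> g \<in> Hom C X Y \<and> msub C f g \<in> Negl C X Y"

text \<open>A congruence given by an explicit negligible summand is easier to add, scale and
  reassociate than one given by a difference.\<close>

lemma equiv_mor_iff:
  assumes "f \<in> Hom C X Y" "g \<in> Hom C X Y"
  shows "equiv_mor X Y f g \<longleftrightarrow> (\<exists>n\<in>Negl C X Y. f = Add C n g)"
proof
  show "\<exists>n\<in>Negl C X Y. f = Add C n g" if "equiv_mor X Y f g"
    using that Add_msub[OF assms] by (auto simp: equiv_mor_def intro!: bexI[of _ "msub C f g"])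
next
  assume "\<exists>n\<in>Negl C X Y. f = Add C n g"
  then obtain n where n: "n \<in> Negl C X Y" "f = Add C n g" by blast
  have "Scl C (-1) g \<in> Hom C X Y" using assms(2) by (rule scl_hom)
  then have "msub C f g = Add C n (msub C g g)"
    unfolding n(2) msub_def using Add_assoc[OF Negl_hom[OF n(1)] assms(2)] by simp
  then show "equiv_mor X Y f g" using n(1) assms HomD[OF assms(2)] HomD[OF Negl_hom[OF n(1)]]
    by (simp add: equiv_mor_def msub_self)
qed

lemma equiv_mor_refl: "f \<in> Hom C X Y \<Longrightarrow> equiv_mor X Y f f"
  using HomD[of f X Y] by (simp add: equiv_mor_def msub_self Negl_Zer)

lemma equiv_mor_sym:
  assumes "equiv_mor X Y f g" shows "equiv_mor X Y g f"
proof -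
  have fg: "f \<in> Hom C X Y" "g \<in> Hom C X Y" using assms by (auto simp: equiv_mor_def)
  then obtain n where n: "n \<in> Negl C X Y" "f = Add C n g" using assms equiv_mor_iff[OF fg] by blast
  note nh = Negl_hom[OF n(1)]
  note [simp] = HomD[OF fg(1)] HomD[OF fg(2)] HomD[OF nh]
  have "Add C (Scl C (-1) n) f = Add C (Add C n (Scl C (-1) n)) g"
    unfolding n(2) using Add_assoc[OF scl_hom[OF nh, of "-1"] nh fg(2)] Add_comm[OF scl_hom[OF nh, of "-1"] nh] by simp
  also have "\<dots> = g" using msub_self[of n] by (simp add: msub_def)
  finally show ?thesis using equiv_mor_iff[OF fg(2,1)] Negl_Scl[OF n(1), of "-1"] by metis
qed

lemma equiv_mor_trans:
  assumes "equiv_mor X Y f g" "equiv_mor X Y g h" shows "equiv_mor X Y f h"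
proof -
  have fgh: "f \<in> Hom C X Y" "g \<in> Hom C X Y" "h \<in> Hom C X Y" using assms by (auto simp: equiv_mor_def)
  obtain n where n: "n \<in> Negl C X Y" "f = Add C n g" using assms equiv_mor_iff[OF fgh(1,2)] by blast
  obtain m where m: "m \<in> Negl C X Y" "g = Add C m h" using assms equiv_mor_iff[OF fgh(2,3)] by blast
  have "f = Add C (Add C n m) h" unfolding n(2) m(2) using Add_assoc[OF Negl_hom[OF n(1)] Negl_hom[OF m(1)] fgh(3)] by simp
  then show ?thesis using equiv_mor_iff[OF fgh(1,3)] Negl_Add[OF n(1) m(1)] by blast
qed

lemma proj_mem: "f \<in> Hom C X Y \<Longrightarrow> g \<in> \<pi> f \<longleftrightarrow> equiv_mor X Y g f"
  by (auto simp: proj_mor_def equiv_mor_def Hom_iff)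

lemma proj_eq:
  assumes "f \<in> Hom C X Y" "g \<in> Hom C X Y"
  shows "\<pi> f = \<pi> g \<longleftrightarrow> equiv_mor X Y f g"
proof
  show "equiv_mor X Y f g" if "\<pi> f = \<pi> g"
    using proj_mem[OF assms(1), of f] proj_mem[OF assms(2), of f] equiv_mor_refl[OF assms(1)] that by simp
  show "\<pi> f = \<pi> g" if "equiv_mor X Y f g"
    using proj_mem[OF assms(1)] proj_mem[OF assms(2)] that equiv_mor_trans equiv_mor_sym by blast
qed

lemma equiv_proj: "equiv_mor X Y f g \<Longrightarrow> \<pi> f = \<pi> g"
  using proj_eq[of f X Y g] by (auto simp: equiv_mor_def)

text \<open>The operations of the quotient are defined through representatives picked by
  \<open>SOME\<close>. That the choice is harmless up to congruence is what yields the rules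
  \<open>Cs_cmp\<close>, \<open>Cs_ten\<close>, \<open>Cs_Add\<close> and
  \<open>Cs_Scl\<close>.\<close>

lemma rep_proj:
  assumes "f \<in> Hom C X Y"
  shows "equiv_mor X Y (rep_mor (\<pi> f)) f"
  using someI[of "\<lambda>g. g \<in> \<pi> f" f] proj_mem[OF assms] equiv_mor_refl[OF assms] by (simp add: rep_mor_def)

lemma rep_hom: "f \<in> Hom C X Y \<Longrightarrow> rep_mor (\<pi> f) \<in> Hom C X Y"
  using rep_proj by (auto simp: equiv_mor_def)

lemma rep_ty [simp]:
  assumes "f \<in> Mor C"
  shows "rep_mor (\<pi> f) \<in> Mor C" "Dom C (rep_mor (\<pi> f)) = Dom C f" "Cod C (rep_mor (\<pi> f)) = Cod C f"
  using rep_hom[of f "Dom C f" "Cod C f"] assms by (auto simp: Hom_iff)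

lemma equiv_cmp:
  assumes "equiv_mor X Y f f'" "equiv_mor Y Z g g'" shows "equiv_mor X Z (g \<cdot> f) (g' \<cdot> f')"
proof (rule equiv_mor_trans)
  have h: "f \<in> Hom C X Y" "f' \<in> Hom C X Y" "g \<in> Hom C Y Z" "g' \<in> Hom C Y Z" using assms by (auto simp: equiv_mor_def)
  note [simp] = HomD[OF h(1)] HomD[OF h(2)] HomD[OF h(3)] HomD[OF h(4)]
  show "equiv_mor X Z (g \<cdot> f) (g \<cdot> f')"
    using Negl_cmp_left[of "msub C f f'" X Y g Z] assms h by (auto simp: equiv_mor_def cmp_msub cmp_hom)
  show "equiv_mor X Z (g \<cdot> f') (g' \<cdot> f')"
    using Negl_cmp_right[of "msub C g g'" Y Z f' X] assms h by (auto simp: equiv_mor_def cmp_msub cmp_hom)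
qed

lemma equiv_ten:
  assumes "equiv_mor X Y f f'" "equiv_mor Z W g g'"
  shows "equiv_mor (X \<diamondop> Z) (Y \<diamondop> W) (f \<star> g) (f' \<star> g')"
proof -
  have h: "f \<in> Hom C X Y" "f' \<in> Hom C X Y" "g \<in> Hom C Z W" "g' \<in> Hom C Z W" using assms by (auto simp: equiv_mor_def)
  note [simp] = HomD[OF h(1)] HomD[OF h(2)] HomD[OF h(3)] HomD[OF h(4)]
  have "equiv_mor (X \<diamondop> Z) (Y \<diamondop> Z) (f \<star> ide Z) (f' \<star> ide Z)"
    using Negl_ten_right[of "msub C f f'" X Y Z] assms by (auto simp: equiv_mor_def ten_msub Hom_iff)
  moreover have "equiv_mor (Y \<diamondop> Z) (Y \<diamondop> W) (ide Y \<star> g) (ide Y \<star> g')"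
    using Negl_ten_left[of "msub C g g'" Z W Y] assms by (auto simp: equiv_mor_def ten_msub Hom_iff)
  ultimately show ?thesis using equiv_cmp by (fastforce simp: fuse)
qed

lemma equiv_Add:
  assumes "equiv_mor X Y f f'" "equiv_mor X Y g g'" shows "equiv_mor X Y (Add C f g) (Add C f' g')"
proof -
  have h: "f \<in> Hom C X Y" "f' \<in> Hom C X Y" "g \<in> Hom C X Y" "g' \<in> Hom C X Y" using assms by (auto simp: equiv_mor_def)
  have 1: "equiv_mor X Y (Add C u w) (Add C v w)" if e: "equiv_mor X Y u v" and w: "w \<in> Hom C X Y" for u v w
  proof -
    have uv: "u \<in> Hom C X Y" "v \<in> Hom C X Y" using e by (auto simp: equiv_mor_def)
    then obtain n where n: "n \<in> Negl C X Y" "u = Add C n v" using e equiv_mor_iff[OF uv] by blast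
    then have "Add C u w = Add C n (Add C v w)" using Add_assoc[OF Negl_hom[OF n(1)] uv(2) w] by simp
    then show ?thesis using equiv_mor_iff[OF Add_hom[OF uv(1) w] Add_hom[OF uv(2) w]] n(1) by blast
  qed
  show ?thesis
    using equiv_mor_trans[OF 1[OF assms(1) h(3)]] 1[OF assms(2) h(2)] Add_comm[OF h(2) h(3)] Add_comm[OF h(2) h(4)]
    by simp
qed

lemma equiv_Scl:
  assumes "equiv_mor X Y f f'" shows "equiv_mor X Y (Scl C a f) (Scl C a f')"
proof -
  have h: "f \<in> Hom C X Y" "f' \<in> Hom C X Y" using assms by (auto simp: equiv_mor_def)
  then obtain n where n: "n \<in> Negl C X Y" "f = Add C n f'" using assms equiv_mor_iff[OF h] by blast
  then have "Scl C a f = Add C (Scl C a n) (Scl C a f')" using scl_add_right[OF Negl_hom[OF n(1)] h(2)] by simp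
  then show ?thesis using equiv_mor_iff[OF scl_hom[OF h(1)] scl_hom[OF h(2)]] Negl_Scl[OF n(1)] by blast
qed

section \<open>The structure of the quotient in terms of representatives\<close>

lemma Cs_sel [simp]:
  "Obj Cs = Obj C" "Idm Cs X = \<pi> (ide X)" "TUnit Cs = \<I>" "TOb Cs = TOb C" "Dual Cs = Dual C"
  "Ev Cs X = \<pi> (Ev C X)" "Coev Cs X = \<pi> (Coev C X)" "Braid Cs X Y = \<pi> (Braid C X Y)"
  "Twist Cs X = \<pi> (Twist C X)" "Zer Cs X Y = \<pi> (Zer C X Y)" "Mor Cs = \<pi> ` Mor C"
  by (simp_all add: semisimplification_def)

lemma Cs_dom [simp]:
  assumes "f \<in> Mor C" shows "Dom Cs (\<pi> f) = Dom C f" "Cod Cs (\<pi> f) = Cod C f"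
  using assms by (simp_all add: semisimplification_def)

lemma Hom_Cs: "Hom Cs X Y = \<pi> ` Hom C X Y"
  by (auto simp: Hom_def image_iff)

lemma Cs_cmp [simp]:
  assumes "f \<in> Mor C" "g \<in> Mor C" "Dom C g = Cod C f"
  shows "\<pi> g \<cdot>\<^bsub>Cs\<^esub> \<pi> f = \<pi> (g \<cdot> f)"
proof -
  have "equiv_mor (Dom C f) (Cod C g) (rep_mor (\<pi> g) \<cdot> rep_mor (\<pi> f)) (g \<cdot> f)"
    by (rule equiv_cmp[of _ "Cod C f"]) (use assms in \<open>auto intro!: rep_proj simp: Hom_iff\<close>)
  then show ?thesis using equiv_proj by (simp add: semisimplification_def)
qed

lemma Cs_ten [simp]:
  assumes "f \<in> Mor C" "g \<in> Mor C"
  shows "\<pi> f \<star>\<^bsub>Cs\<^esub> \<pi> g = \<pi> (f \<star> g)"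
proof -
  have "equiv_mor (Dom C f \<diamondop> Dom C g) (Cod C f \<diamondop> Cod C g) (rep_mor (\<pi> f) \<star> rep_mor (\<pi> g)) (f \<star> g)"
    by (rule equiv_ten) (use assms in \<open>auto intro!: rep_proj simp: Hom_iff\<close>)
  then show ?thesis using equiv_proj by (simp add: semisimplification_def)
qed

lemma Cs_Add [simp]:
  assumes "f \<in> Mor C" "g \<in> Mor C" "Dom C g = Dom C f" "Cod C g = Cod C f"
  shows "Add Cs (\<pi> f) (\<pi> g) = \<pi> (Add C f g)"
proof -
  have "equiv_mor (Dom C f) (Cod C f) (Add C (rep_mor (\<pi> f)) (rep_mor (\<pi> g))) (Add C f g)"
    by (rule equiv_Add) (use assms in \<open>auto intro!: rep_proj simp: Hom_iff\<close>)
  then show ?thesis using equiv_proj by (simp add: semisimplification_def)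
qed

lemma Cs_Scl [simp]:
  assumes "f \<in> Mor C"
  shows "Scl Cs a (\<pi> f) = \<pi> (Scl C a f)"
proof -
  have "equiv_mor (Dom C f) (Cod C f) (Scl C a (rep_mor (\<pi> f))) (Scl C a f)"
    by (rule equiv_Scl) (use assms in \<open>auto intro!: rep_proj simp: Hom_iff\<close>)
  then show ?thesis using equiv_proj by (simp add: semisimplification_def)
qed

lemma Cs_inverse: "f \<in> Mor C \<Longrightarrow> inverse_mor C f g \<Longrightarrow> inverse_mor Cs (\<pi> f) (\<pi> g)"
  by (auto simp: inverse_mor_def Hom_Cs) (auto simp: Hom_iff)

lemma Cs_iso [simp]: "iso_mor C f \<Longrightarrow> iso_mor Cs (\<pi> f)"
  using Cs_inverse[OF _ minv_inverse] by (auto simp: iso_mor_def)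

lemma Cs_dual [simp]: "f \<in> Mor C \<Longrightarrow> dual_mor Cs (\<pi> f) = \<pi> (dual_mor C f)"
  by (simp add: dual_mor_def Let_def)

lemma Cs_homE: 
  assumes "f \<in> Hom Cs X Y" obtains f' where "f = \<pi> f'" "f' \<in> Mor C" "Dom C f' = X" "Cod C f' = Y"
  using assms by (auto simp: Hom_Cs Hom_iff)

lemma Cs_hom [simp]: "f \<in> Mor C \<Longrightarrow> \<pi> f \<in> Hom Cs X Y \<longleftrightarrow> Dom C f = X \<and> Cod C f = Y"
  using Cs_dom[of f] by (auto simp: Hom_iff)

lemma proj_Zer: 
  assumes "f \<in> Hom C X Y" shows "\<pi> f = \<pi> (Zer C X Y) \<longleftrightarrow> f \<in> Negl C X Y"
proof -
  note [simp] = HomD[OF assms]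
  have "msub C f (Zer C X Y) = f" by (simp add: msub_def)
  then show ?thesis using proj_eq[OF assms, of "Zer C X Y"] by (simp add: equiv_mor_def Zer_hom assms)
qed

lemma carrier_Cs: "carrier (hom_group Cs X Y) = \<pi> ` Hom C X Y"
  by (simp add: hom_group_def Hom_Cs)

text \<open>The equational axioms are images under \<pi> of the same axioms. An argument is needed
  for the Hom-groups, whose inverses have to be exhibited, and for the unit, where distinct
  multiples of the identity must stay distinct modulo negligible morphisms.\<close>

lemma semisimplification_ribbon: "ribbon_k_category Cs"
proof (rule ribbon_k_category.intro)
  note [elim!] = Cs_homE
  fix X Y
  show "\<lbrakk>X \<in> Obj Cs; Y \<in> Obj Cs\<rbrakk> \<Longrightarrow> comm_group (hom_group Cs X Y)"
  proof (rule comm_groupI)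
    assume [simp]: "X \<in> Obj Cs" "Y \<in> Obj Cs"
    then have [simp]: "X \<in> Obj C" "Y \<in> Obj C" by simp_all
    fix u v w
    show "\<one>\<^bsub>hom_group Cs X Y\<^esub> \<in> carrier (hom_group Cs X Y)" by (simp add: hom_group_def)
    assume u: "u \<in> carrier (hom_group Cs X Y)"
    then show "\<one>\<^bsub>hom_group Cs X Y\<^esub> \<otimes>\<^bsub>hom_group Cs X Y\<^esub> u = u" by (auto simp: hom_group_def)
    show "\<exists>y\<in>carrier (hom_group Cs X Y). y \<otimes>\<^bsub>hom_group Cs X Y\<^esub> u = \<one>\<^bsub>hom_group Cs X Y\<^esub>"
    proof -
      from u obtain f where f: "u = \<pi> f" "f \<in> Mor C" "Dom C f = X" "Cod C f = Y" by (auto simp: hom_group_def)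
      then have "Add C (Scl C (-1) f) f = Zer C X Y"
        using msub_self[of f] Add_comm[of f X Y "Scl C (-1) f"] by (simp add: msub_def Hom_iff)
      then show ?thesis using f by (auto simp: hom_group_def intro!: bexI[of _ "\<pi> (Scl C (-1) f)"])
    qed
    assume v: "v \<in> carrier (hom_group Cs X Y)"
    show "u \<otimes>\<^bsub>hom_group Cs X Y\<^esub> v \<in> carrier (hom_group Cs X Y)" using u v by (auto simp: hom_group_def)
    from u v obtain f g where fg: "u = \<pi> f" "v = \<pi> g" "f \<in> Hom C X Y" "g \<in> Hom C X Y"
      unfolding carrier_Cs by blast
    show "u \<otimes>\<^bsub>hom_group Cs X Y\<^esub> v = v \<otimes>\<^bsub>hom_group Cs X Y\<^esub> u"
      using HomD[OF fg(3)] HomD[OF fg(4)] by (simp add: fg(1,2) hom_group_def Add_comm[OF fg(3,4)])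
    assume w: "w \<in> carrier (hom_group Cs X Y)"
    show "u \<otimes>\<^bsub>hom_group Cs X Y\<^esub> v \<otimes>\<^bsub>hom_group Cs X Y\<^esub> w = u \<otimes>\<^bsub>hom_group Cs X Y\<^esub> (v \<otimes>\<^bsub>hom_group Cs X Y\<^esub> w)"
    proof -
      from w obtain h where h: "w = \<pi> h" "h \<in> Hom C X Y" unfolding carrier_Cs by blast
      show ?thesis
        using HomD[OF fg(3)] HomD[OF fg(4)] HomD[OF h(2)]
        by (simp add: fg(1,2) h(1) hom_group_def Add_assoc[OF fg(3,4) h(2)])
    qed
  qed
  show "scalar_object Cs \<I>\<^bsub>Cs\<^esub>"
    unfolding scalar_object_def bij_betw_def
  proof
    show "inj (\<lambda>a. Scl Cs a (Idm Cs \<I>\<^bsub>Cs\<^esub>))"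
    proof (rule injI)
      fix a b assume "Scl Cs a (Idm Cs \<I>\<^bsub>Cs\<^esub>) = Scl Cs b (Idm Cs \<I>\<^bsub>Cs\<^esub>)"
      then have "equiv_mor \<I> \<I> (Scl C a (ide \<I>)) (Scl C b (ide \<I>))"
        using proj_eq[of "Scl C a (ide \<I>)" \<I> \<I> "Scl C b (ide \<I>)"] by (simp add: Hom_iff)
      then have "msub C (Scl C a (ide \<I>)) (Scl C b (ide \<I>)) \<in> Negl C \<I> \<I>" by (simp add: equiv_mor_def)
      moreover have "msub C (Scl C a (ide \<I>)) (Scl C b (ide \<I>)) = Scl C (a - b) (ide \<I>)"
        using scl_add_left[of "ide \<I>" a "- b"] scl_mult[of "ide \<I>" "-1" b] by (simp add: msub_def)
      ultimately show "a = b" using ide_unit_not_negl[of "a - b"] by auto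
    qed
    show "range (\<lambda>a. Scl Cs a (Idm Cs \<I>\<^bsub>Cs\<^esub>)) = Hom Cs \<I>\<^bsub>Cs\<^esub> \<I>\<^bsub>Cs\<^esub>"
    proof
      show "range (\<lambda>a. Scl Cs a (Idm Cs \<I>\<^bsub>Cs\<^esub>)) \<subseteq> Hom Cs \<I>\<^bsub>Cs\<^esub> \<I>\<^bsub>Cs\<^esub>" by auto
      show "Hom Cs \<I>\<^bsub>Cs\<^esub> \<I>\<^bsub>Cs\<^esub> \<subseteq> range (\<lambda>a. Scl Cs a (Idm Cs \<I>\<^bsub>Cs\<^esub>))"
      proof
        fix u assume "u \<in> Hom Cs \<I>\<^bsub>Cs\<^esub> \<I>\<^bsub>Cs\<^esub>"
        then obtain f where f: "u = \<pi> f" "f \<in> Hom C \<I> \<I>" by (auto simp: Hom_Cs)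
        have "u = Scl Cs (to_scalar C f) (Idm Cs \<I>\<^bsub>Cs\<^esub>)" using scalar_hom[OF f(2)] f(1) by simp
        then show "u \<in> range (\<lambda>a. Scl Cs a (Idm Cs \<I>\<^bsub>Cs\<^esub>))" by blast
      qed
    qed
  qed
qed (auto elim!: Cs_homE simp: fuse zigzag ten_id braid_nat braid_ten twist_nat twist_ten twist_dual scl_mult scl_add_left Scl_Add cmp_Add ten_Add)

end

subsection \<open>Full subcategories\<close>

locale full_ribbon_subcategory = ribbon_k_category C for C :: "('o, 'm, 'k::field) rcat" (structure) +
  fixes B and Ob
  assumes B: "B = full_subcategory C Ob" and Ob: "Ob \<subseteq> Obj C" "\<I> \<in> Ob"
    and Ob_ten: "\<And>X Y. X \<in> Ob \<Longrightarrow> Y \<in> Ob \<Longrightarrow> X \<diamondop> Y \<in> Ob"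
    and Ob_dual: "\<And>X. X \<in> Ob \<Longrightarrow> du X \<in> Ob"
begin

lemma sub_sel:
  "Obj B = Ob" "Dom B = Dom C" "Cod B = Cod C" "Idm B = Idm C" "Cmp B = Cmp C" "TUnit B = TUnit C"
  "TOb B = TOb C" "TMo B = TMo C" "Dual B = Dual C" "Ev B = Ev C" "Coev B = Coev C" "Braid B = Braid C"
  "Twist B = Twist C" "Zer B = Zer C" "Add B = Add C" "Scl B = Scl C"
  by (simp_all add: B full_subcategory_def)

lemma sub_Mor: "f \<in> Mor B \<longleftrightarrow> f \<in> Mor C \<and> Dom C f \<in> Ob \<and> Cod C f \<in> Ob"
  by (simp add: B full_subcategory_def)

lemma sub_Hom_iff: "f \<in> Hom B X Y \<longleftrightarrow> f \<in> Hom C X Y \<and> X \<in> Ob \<and> Y \<in> Ob"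
  by (auto simp: Hom_iff sub_sel sub_Mor)

lemma sub_Hom: "X \<in> Ob \<Longrightarrow> Y \<in> Ob \<Longrightarrow> Hom B X Y = Hom C X Y"
  by (auto simp: sub_Hom_iff)

lemma sub_inverse: "f \<in> Hom C X Y \<Longrightarrow> X \<in> Ob \<Longrightarrow> Y \<in> Ob \<Longrightarrow> inverse_mor B f g \<longleftrightarrow> inverse_mor C f g"
  unfolding inverse_mor_def sub_Hom_iff sub_sel by (auto simp: Hom_iff)

lemma sub_iso: "f \<in> Hom C X Y \<Longrightarrow> X \<in> Ob \<Longrightarrow> Y \<in> Ob \<Longrightarrow> iso_mor B f \<longleftrightarrow> iso_mor C f"
  using sub_inverse[of f X Y] by (auto simp: iso_mor_def sub_Mor Hom_iff)

lemma sub_minv: "f \<in> Hom C X Y \<Longrightarrow> X \<in> Ob \<Longrightarrow> Y \<in> Ob \<Longrightarrow> minv B f = minv C f"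
  using sub_inverse[of f X Y] by (simp add: minv_def)

lemma sub_dual_mor: "dual_mor B = dual_mor C"
  by (rule ext) (simp add: dual_mor_def sub_sel)

lemma sub_ribbon: "ribbon_k_category B"
proof -
  have sub: "X \<in> Ob \<Longrightarrow> X \<in> Obj C" for X using Ob by blast
  have hg: "X \<in> Ob \<Longrightarrow> Y \<in> Ob \<Longrightarrow> hom_group B X Y = hom_group C X Y" for X Y
    by (simp add: hom_group_def sub_sel sub_Hom)
  have so: "scalar_object B \<I> \<longleftrightarrow> scalar_object C \<I>"
    by (simp add: scalar_object_def sub_sel sub_Hom Ob)
  note [simp] = sub_sel sub_Hom_iff sub_Mor sub_dual_mor Ob_ten Ob_dual sub Ob(2)
  show ?thesis
  proof (rule ribbon_k_category.intro)
    show "X \<in> Obj B \<Longrightarrow> Y \<in> Obj B \<Longrightarrow> comm_group (hom_group B X Y)" for X Y by (simp add: hg hom_abelian)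
    show "scalar_object B \<I>\<^bsub>B\<^esub>" by (simp add: so unit_scalar)
    show "X \<in> Obj B \<Longrightarrow> Y \<in> Obj B \<Longrightarrow> iso_mor B (Braid B X Y)" for X Y by (simp add: sub_iso[OF braid_hom])
    show "X \<in> Obj B \<Longrightarrow> iso_mor B (Twist B X)" for X by (simp add: sub_iso[OF twist_hom])
  qed (auto simp: Hom_iff fuse zigzag ten_id braid_nat braid_ten twist_nat twist_ten twist_dual scl_mult scl_add_left Scl_Add cmp_Add ten_Add)
qed

end

section \<open>Coends\<close>

context ribbon_k_category
begin

text \<open>With the coend object as \<open>W\<close>, this naturality turns a test on
  \<open>i X \<star> ide V\<close> into a test on \<open>i X\<close>.\<close>

lemma bend_nat:
  assumes "h \<in> Hom C (W \<diamondop> X) Z" "k \<in> Hom C W' W" "X \<in> Obj C"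
  shows "bend W X h \<cdot> k = bend W' X (h \<cdot> (k \<star> ide X))"
proof -
  note [simp] = HomD[OF assms(1)] HomD[OF assms(2)] assms(3)
  have "(ide W \<star> Coev C X) \<cdot> k = k \<star> Coev C X"
    using fuse[of k "ide W" "ide \<I>" "Coev C X"] by simp
  also have "\<dots> = (k \<star> ide X \<star> ide (du X)) \<cdot> (ide W' \<star> Coev C X)" by (simp add: fuse)
  finally show ?thesis by (simp add: bend_def whr)
qed

lemma bend_inj:
  assumes "h \<in> Hom C (W \<diamondop> X) Z" "h' \<in> Hom C (W \<diamondop> X) Z" "W \<in> Obj C" "X \<in> Obj C"
    and "bend W X h = bend W X h'"
  shows "h = h'"
  by (metis unbend_bend[OF HomD(1-3)[OF assms(1)] assms(3,4)] unbend_bend[OF HomD(1-3)[OF assms(2)] assms(3,4)] assms(5))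

section \<open>Tensor products of lists\<close>

lemma ten_obs_simps [simp]: "ten_obs C [] = \<I>" "ten_obs C (x # xs) = x \<diamondop> ten_obs C xs"
  by (simp_all add: ten_obs_def)

lemma ten_mors_simps [simp]: "ten_mors C [] = ide \<I>" "ten_mors C (x # xs) = x \<star> ten_mors C xs"
  by (simp_all add: ten_mors_def)

lemma ten_obs_obj [simp]: "set xs \<subseteq> Obj C \<Longrightarrow> ten_obs C xs \<in> Obj C"
  by (induction xs) auto

lemma ten_obs_append: "set xs \<subseteq> Obj C \<Longrightarrow> set ys \<subseteq> Obj C \<Longrightarrow> ten_obs C (xs @ ys) = ten_obs C xs \<diamondop> ten_obs C ys"
  by (induction xs) auto

lemma ten_mors_ty [simp]:
  assumes "set fs \<subseteq> Mor C"
  shows "ten_mors C fs \<in> Mor C" "Dom C (ten_mors C fs) = ten_obs C (map (Dom C) fs)"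
    "Cod C (ten_mors C fs) = ten_obs C (map (Cod C) fs)"
  using assms by (induction fs) auto

lemma ten_mors_append: "set xs \<subseteq> Mor C \<Longrightarrow> set ys \<subseteq> Mor C \<Longrightarrow> ten_mors C (xs @ ys) = ten_mors C xs \<star> ten_mors C ys"
  by (induction xs) auto

lemma ten_mors_fuse:
  assumes "\<And>p. p \<in> set w \<Longrightarrow> a p \<in> Mor C" "\<And>p. p \<in> set w \<Longrightarrow> b p \<in> Mor C" "\<And>p. p \<in> set w \<Longrightarrow> Dom C (a p) = Cod C (b p)"
  shows "ten_mors C (map a w) \<cdot> ten_mors C (map b w) = ten_mors C (map (\<lambda>p. a p \<cdot> b p) w)"
  using assms
proof (induction w)
  case (Cons p w)
  have s: "set (map a w) \<subseteq> Mor C" "set (map b w) \<subseteq> Mor C" using Cons.prems by auto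
  have "map (Dom C) (map a w) = map (Cod C) (map b w)" using Cons.prems by simp
  then have d: "Dom C (ten_mors C (map a w)) = Cod C (ten_mors C (map b w))"
    by (simp only: ten_mors_ty(2)[OF s(1)] ten_mors_ty(3)[OF s(2)])
  have "(a p \<star> ten_mors C (map a w)) \<cdot> (b p \<star> ten_mors C (map b w))
      = (a p \<cdot> b p) \<star> (ten_mors C (map a w) \<cdot> ten_mors C (map b w))"
    by (rule fuse[OF _ _ _ _ _ d]) (use Cons.prems s in auto)
  then show ?case using Cons by simp
qed simp

lemma ten_mors_ide: "(\<And>p. p \<in> set w \<Longrightarrow> ob p \<in> Obj C) \<Longrightarrow>
    ten_mors C (map (\<lambda>p. ide (ob p)) w) = ide (ten_obs C (map ob w))"
proof (induction w)
  case (Cons p w)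
  moreover have "ob ` set w \<subseteq> Obj C" using Cons.prems by auto
  ultimately show ?case by (simp add: ide_ten)
qed simp

text \<open>Dinaturality in one colour with spectator objects \<open>W\<close> on the left and
  \<open>V\<close> on the right: the form taken by a family in several colours when the other
  colours are held fixed.\<close>

definition pdinatural where
  "pdinatural W V Z d \<longleftrightarrow> (\<forall>X\<in>Obj C. d X \<in> Hom C (W \<diamondop> du X \<diamondop> X \<diamondop> V) Z) \<and>
     (\<forall>X Y. \<forall>f\<in>Hom C X Y. d X \<cdot> (ide W \<star> dual_mor C f \<star> ide X \<star> ide V)
                        = d Y \<cdot> (ide W \<star> ide (du Y) \<star> f \<star> ide V))"

section \<open>Naturality of the canonical morphisms between duals\<close>

lemma dual_ten_ty [simp]:
  assumes "X \<in> Obj C" "Y \<in> Obj C"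
  shows "dual_ten C X Y \<in> Mor C" "Dom C (dual_ten C X Y) = du X \<diamondop> du Y" "Cod C (dual_ten C X Y) = du (Y \<diamondop> X)"
  using assms by (simp_all add: dual_ten_def Let_def)

text \<open>\<open>dual_ten\<close> is the bend of the nested evaluation on the right; afterwards
  this equation is used in place of its formula.\<close>

lemma dual_ten_ev:
  assumes [simp]: "X \<in> Obj C" "Y \<in> Obj C"
  shows "Ev C (Y \<diamondop> X) \<cdot> (dual_ten C X Y \<star> ide Y \<star> ide X) = Ev C X \<cdot> (ide (du X) \<star> Ev C Y \<star> ide X)"
proof -
  have "dual_ten C X Y = bend (du X \<diamondop> du Y) (Y \<diamondop> X) (Ev C X \<cdot> (ide (du X) \<star> Ev C Y \<star> ide X))"
    by (simp add: dual_ten_def bend_def Let_def)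
  then have "unbend \<I> (Y \<diamondop> X) (dual_ten C X Y) = Ev C X \<cdot> (ide (du X) \<star> Ev C Y \<star> ide X)"
    by (simp add: unbend_bend)
  then show ?thesis by (simp add: unbend_def ide_ten)
qed

text \<open>Morphisms into the dual of a tensor product are compared after evaluation, where both
  sides become the nested evaluation with \<open>f\<close> and \<open>g\<close> on the strands that
  are not dualised.\<close>

lemma dual_ten_nat:
  assumes "f \<in> Hom C X X'" "g \<in> Hom C Y Y'"
  shows "dual_ten C X Y \<cdot> (dual_mor C f \<star> dual_mor C g) = dual_mor C (g \<star> f) \<cdot> dual_ten C X' Y'"
proof (rule unbend_inj[of _ "du X' \<diamondop> du Y'" \<I> "Y \<diamondop> X"])
  note [simp] = HomD[OF assms(1)] HomD[OF assms(2)]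
  show "dual_ten C X Y \<cdot> (dual_mor C f \<star> dual_mor C g) \<in> Hom C (du X' \<diamondop> du Y') (\<I> \<diamondop> du (Y \<diamondop> X))"
    "dual_mor C (g \<star> f) \<cdot> dual_ten C X' Y' \<in> Hom C (du X' \<diamondop> du Y') (\<I> \<diamondop> du (Y \<diamondop> X))"
    "\<I> \<in> Obj C" "Y \<diamondop> X \<in> Obj C" by (simp_all add: Hom_iff)
  have gf: "g \<star> f \<in> Hom C (Y \<diamondop> X) (Y' \<diamondop> X')" by (simp add: Hom_iff)
  have "unbend \<I> (Y \<diamondop> X) (dual_ten C X Y \<cdot> (dual_mor C f \<star> dual_mor C g))
      = (Ev C (Y \<diamondop> X) \<cdot> (dual_ten C X Y \<star> ide Y \<star> ide X)) \<cdot> (dual_mor C f \<star> dual_mor C g \<star> ide Y \<star> ide X)"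
    using fuse[of "dual_mor C f \<star> dual_mor C g" "dual_ten C X Y" "ide Y \<star> ide X" "ide Y \<star> ide X"]
    by (simp add: unbend_def ide_ten)
  also have "\<dots> = Ev C X \<cdot> (dual_mor C f \<star> (Ev C Y \<cdot> (dual_mor C g \<star> ide Y)) \<star> ide X)"
    unfolding dual_ten_ev[OF \<open>X \<in> Obj C\<close> \<open>Y \<in> Obj C\<close>]
    using fuse[of "dual_mor C g \<star> ide Y" "Ev C Y" "ide X" "ide X"] by (simp add: fuse)
  also have "\<dots> = Ev C X \<cdot> (dual_mor C f \<star> ide X) \<cdot> (ide (du X') \<star> (Ev C Y' \<cdot> (ide (du Y') \<star> g)) \<star> ide X)"
    by (simp add: ev_dual[OF assms(2)] fuse)
  also have "\<dots> = (Ev C X \<cdot> (dual_mor C f \<star> ide X)) \<cdot> (ide (du X') \<star> (Ev C Y' \<cdot> (ide (du Y') \<star> g)) \<star> ide X)"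
    by simp
  also have "\<dots> = Ev C X' \<cdot> (ide (du X') \<star> (Ev C Y' \<cdot> (ide (du Y') \<star> g)) \<star> f)"
    unfolding ev_dual[OF assms(1)]
    using fuse[of "Ev C Y' \<cdot> (ide (du Y') \<star> g)" "ide \<I>" "ide X" f] by (simp add: fuse)
  also have "\<dots> = (Ev C X' \<cdot> (ide (du X') \<star> Ev C Y' \<star> ide X')) \<cdot> (ide (du X') \<star> ide (du Y') \<star> g \<star> f)"
    using fuse[of "ide (du Y') \<star> g" "Ev C Y'" f "ide X'"] by (simp add: fuse)
  also have "\<dots> = Ev C (Y' \<diamondop> X') \<cdot> (dual_ten C X' Y' \<star> g \<star> f)"
    unfolding dual_ten_ev[OF \<open>X' \<in> Obj C\<close> \<open>Y' \<in> Obj C\<close>, symmetric]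
    using fuse[of "ide (du X') \<star> ide (du Y')" "dual_ten C X' Y'" "g \<star> f" "ide Y' \<star> ide X'"] by simp
  also have "\<dots> = (Ev C (Y' \<diamondop> X') \<cdot> (ide (du (Y' \<diamondop> X')) \<star> g \<star> f)) \<cdot> (dual_ten C X' Y' \<star> ide (Y \<diamondop> X))"
    by (simp add: fuse ide_ten)
  also have "\<dots> = unbend \<I> (Y \<diamondop> X) (dual_mor C (g \<star> f) \<cdot> dual_ten C X' Y')"
    unfolding ev_dual[OF gf, symmetric] by (simp add: unbend_def whr)
  finally show "unbend \<I> (Y \<diamondop> X) (dual_ten C X Y \<cdot> (dual_mor C f \<star> dual_mor C g))
     = unbend \<I> (Y \<diamondop> X) (dual_mor C (g \<star> f) \<cdot> dual_ten C X' Y')" .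
qed

lemma bidual_ty [simp]:
  assumes "X \<in> Obj C"
  shows "bidual C X \<in> Mor C" "Dom C (bidual C X) = X" "Cod C (bidual C X) = du (du X)"
  using assms by (simp_all add: bidual_def)

text \<open>Both turns in the map to the bidual can be crossed: \<open>coev_dual\<close> trades the
  double dual for a dual, and \<open>ev_right_dual\<close> trades that dual for
  \<open>f\<close>.\<close>

lemma bidual_nat:
  assumes "f \<in> Hom C X Y"
  shows "bidual C Y \<cdot> f = dual_mor C (dual_mor C f) \<cdot> bidual C X"
proof -
  note [simp] = HomD[OF assms]
  let ?f = "dual_mor C f" and ?ff = "dual_mor C (dual_mor C f)"
  have "?ff \<cdot> bidual C X = (ev_right C X \<star> ?ff) \<cdot> (ide X \<star> Coev C (du X))"
    using fuse[of "ev_right C X" "ide \<I>" "ide (du (du X))" ?ff]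
    by (simp add: bidual_def cmp_asc[symmetric] del: cmp_asc)
  also have "\<dots> = (ev_right C X \<star> ide (du (du Y))) \<cdot> (ide X \<star> ((ide (du X) \<star> ?ff) \<cdot> Coev C (du X)))"
    using fuse[of "ide X \<star> ide (du X)" "ev_right C X" ?ff "ide (du (du Y))"] by (simp add: whl cmp_asc[symmetric] del: cmp_asc)
  also have "(ide (du X) \<star> ?ff) \<cdot> Coev C (du X) = (?f \<star> ide (du (du Y))) \<cdot> Coev C (du Y)"
    using coev_dual[OF dual_mor_hom[OF assms]] by simp
  also have "(ev_right C X \<star> ide (du (du Y))) \<cdot> (ide X \<star> ((?f \<star> ide (du (du Y))) \<cdot> Coev C (du Y)))
      = ((ev_right C X \<cdot> (ide X \<star> ?f)) \<star> ide (du (du Y))) \<cdot> (ide X \<star> Coev C (du Y))"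
    by (simp add: whl whr)
  also have "\<dots> = (ev_right C Y \<star> ide (du (du Y))) \<cdot> (f \<star> ide (du Y) \<star> ide (du (du Y))) \<cdot> (ide X \<star> Coev C (du Y))"
    unfolding ev_right_dual[OF assms, symmetric] by (simp add: whr)
  also have "(f \<star> ide (du Y) \<star> ide (du (du Y))) \<cdot> (ide X \<star> Coev C (du Y)) = (ide Y \<star> Coev C (du Y)) \<cdot> f"
    using fuse[of f "ide Y" "ide \<I>" "Coev C (du Y)"] by (simp add: fuse)
  finally show ?thesis by (simp add: bidual_def)
qed

end

section \<open>The universal property of a coend with spectator objects\<close>

locale ribbon_coend = ribbon_k_category C for C :: "('o, 'm, 'k::field) rcat" (structure) +
  fixes A :: 'o and i :: "'o \<Rightarrow> 'm"
  assumes coend: "is_coend C A i"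
begin

lemma A_obj [simp]: "A \<in> Obj C" using coend by (simp add: is_coend_def)

lemma i_hom: "X \<in> Obj C \<Longrightarrow> i X \<in> Hom C (du X \<diamondop> X) A"
  using coend by (simp add: is_coend_def dinatural_def)

lemma i_ty [simp]:
  assumes "X \<in> Obj C" shows "i X \<in> Mor C" "Dom C (i X) = du X \<diamondop> X" "Cod C (i X) = A"
  using i_hom[OF assms] by (auto simp: Hom_iff)

lemma i_dinat: "f \<in> Hom C X Y \<Longrightarrow> i X \<cdot> (dual_mor C f \<star> ide X) = i Y \<cdot> (ide (du Y) \<star> f)"
  using coend by (simp add: is_coend_def dinatural_def)

lemma coend_ex:
  assumes "dinatural C Z d" "Z \<in> Obj C"
  obtains g where "g \<in> Hom C A Z" "\<And>X. X \<in> Obj C \<Longrightarrow> g \<cdot> i X = d X"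
  using coend assms unfolding is_coend_def by metis

lemma coend_eq:
  assumes "g \<in> Hom C A Z" "h \<in> Hom C A Z" "\<And>X. X \<in> Obj C \<Longrightarrow> g \<cdot> i X = h \<cdot> i X"
  shows "g = h"
proof -
  note [simp] = HomD[OF assms(1)]
  have "dinatural C Z (\<lambda>X. g \<cdot> i X)"
    unfolding dinatural_def
  proof (intro conjI ballI allI)
    fix X Y f assume f: "f \<in> Hom C X Y"
    note [simp] = HomD[OF f]
    show "(g \<cdot> i X) \<cdot> (dual_mor C f \<star> ide X) = (g \<cdot> i Y) \<cdot> (ide (du Y) \<star> f)"
      by (simp add: i_dinat[OF f])
  qed (simp add: Hom_iff)
  then have "\<exists>!u. u \<in> Hom C A Z \<and> (\<forall>X\<in>Obj C. g \<cdot> i X = u \<cdot> i X)"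
    using coend by (simp add: is_coend_def)
  then show ?thesis using assms by metis
qed

text \<open>Tensoring with \<open>V\<close> has a right adjoint, namely tensoring with its dual, and
  therefore preserves the universal property; concretely, both morphisms are bent.\<close>

lemma coend_right_eq:
  assumes "g \<in> Hom C (A \<diamondop> V) Z" "h \<in> Hom C (A \<diamondop> V) Z" "V \<in> Obj C"
    "\<And>X. X \<in> Obj C \<Longrightarrow> g \<cdot> (i X \<star> ide V) = h \<cdot> (i X \<star> ide V)"
  shows "g = h"
proof (rule bend_inj[OF assms(1,2) A_obj assms(3)], rule coend_eq)
  note [simp] = HomD[OF assms(1)] HomD[OF assms(2)] assms(3)
  show "bend A V g \<in> Hom C A (Z \<diamondop> du V)" "bend A V h \<in> Hom C A (Z \<diamondop> du V)" by (simp_all add: Hom_iff)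
  show "bend A V g \<cdot> i X = bend A V h \<cdot> i X" if "X \<in> Obj C" for X
    using bend_nat[OF assms(1) i_hom] bend_nat[OF assms(2) i_hom] assms(4)[OF that] that by simp
qed

text \<open>The existence half of the same adjunction: the family is bent, factored through
  \<open>A\<close>, and the factor is unbent.\<close>

lemma coend_right_ex:
  assumes "pdinatural \<I> V Z d" and [simp]: "V \<in> Obj C" "Z \<in> Obj C"
  obtains g where "g \<in> Hom C (A \<diamondop> V) Z" "\<And>X. X \<in> Obj C \<Longrightarrow> g \<cdot> (i X \<star> ide V) = d X"
proof -
  have d: "d X \<in> Hom C ((du X \<diamondop> X) \<diamondop> V) Z" if "X \<in> Obj C" for X
    using assms(1) that by (simp add: pdinatural_def)
  have "dinatural C (Z \<diamondop> du V) (\<lambda>X. bend (du X \<diamondop> X) V (d X))"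
    unfolding dinatural_def
  proof (intro conjI ballI allI)
    fix X assume [simp]: "X \<in> Obj C"
    note [simp] = HomD[OF d, of X, simplified]
    show "bend (du X \<diamondop> X) V (d X) \<in> Hom C (du X \<diamondop> X) (Z \<diamondop> du V)" by (simp add: Hom_iff)
  next
    fix X Y f assume f: "f \<in> Hom C X Y"
    note [simp] = HomD[OF f]
    have 1: "dual_mor C f \<star> ide X \<in> Hom C (du Y \<diamondop> X) (du X \<diamondop> X)"
      "ide (du Y) \<star> f \<in> Hom C (du Y \<diamondop> X) (du Y \<diamondop> Y)" by (simp_all add: Hom_iff)
    have "d X \<cdot> (ide \<I> \<star> dual_mor C f \<star> ide X \<star> ide V) = d Y \<cdot> (ide \<I> \<star> ide (du Y) \<star> f \<star> ide V)"
      using assms(1) f unfolding pdinatural_def by blast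
    then show "bend (du X \<diamondop> X) V (d X) \<cdot> (dual_mor C f \<star> ide X) = bend (du Y \<diamondop> Y) V (d Y) \<cdot> (ide (du Y) \<star> f)"
      using bend_nat[OF d 1(1)] bend_nat[OF d 1(2)] by simp
  qed
  then obtain g where g: "g \<in> Hom C A (Z \<diamondop> du V)" "\<And>X. X \<in> Obj C \<Longrightarrow> g \<cdot> i X = bend (du X \<diamondop> X) V (d X)"
    by (rule coend_ex) auto
  note [simp] = HomD[OF g(1)]
  have u: "unbend Z V g \<in> Hom C (A \<diamondop> V) Z" by (simp add: Hom_iff)
  have "unbend Z V g \<cdot> (i X \<star> ide V) = d X" if [simp]: "X \<in> Obj C" for X
  proof (rule bend_inj[of _ "du X \<diamondop> X" V Z])
    show "unbend Z V g \<cdot> (i X \<star> ide V) \<in> Hom C ((du X \<diamondop> X) \<diamondop> V) Z" "d X \<in> Hom C ((du X \<diamondop> X) \<diamondop> V) Z"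
      "du X \<diamondop> X \<in> Obj C" "V \<in> Obj C" by (simp_all add: Hom_iff d[simplified Hom_iff])
    show "bend (du X \<diamondop> X) V (unbend Z V g \<cdot> (i X \<star> ide V)) = bend (du X \<diamondop> X) V (d X)"
      using bend_nat[OF u i_hom, of X] g(2)[of X] by (simp add: bend_unbend)
  qed
  then show thesis using that u by blast
qed

text \<open>The braiding moves the spectator \<open>W\<close> to the right of \<open>A\<close>,
  which leaves spectators on one side only.\<close>

lemma coend_mid_eq:
  assumes "g \<in> Hom C (W \<diamondop> A \<diamondop> V) Z" "h \<in> Hom C (W \<diamondop> A \<diamondop> V) Z" and W [simp]: "W \<in> Obj C" and V [simp]: "V \<in> Obj C"
    and eq: "\<And>X. X \<in> Obj C \<Longrightarrow> g \<cdot> (ide W \<star> i X \<star> ide V) = h \<cdot> (ide W \<star> i X \<star> ide V)"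
  shows "g = h"
proof -
  note [simp] = HomD[OF assms(1)] HomD[OF assms(2)]
  let ?b = "Braid C A W \<star> ide V"
  have *: "(u \<cdot> ?b) \<cdot> (i X \<star> ide (W \<diamondop> V)) = (u \<cdot> (ide W \<star> i X \<star> ide V)) \<cdot> (Braid C (du X \<diamondop> X) W \<star> ide V)"
    if "u \<in> Hom C (W \<diamondop> A \<diamondop> V) Z" and [simp]: "X \<in> Obj C" for u X
  proof -
    note [simp] = HomD[OF that(1)]
    have "?b \<cdot> (i X \<star> ide (W \<diamondop> V)) = (Braid C A W \<cdot> (i X \<star> ide W)) \<star> ide V"
      using fuse[of "i X \<star> ide W" "Braid C A W" "ide V" "ide V"] by (simp add: ide_ten)
    also have "\<dots> = (ide W \<star> i X \<star> ide V) \<cdot> (Braid C (du X \<diamondop> X) W \<star> ide V)"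
      by (simp add: braid_nat whr)
    finally show ?thesis by simp
  qed
  have "g \<cdot> ?b = h \<cdot> ?b"
    by (rule coend_right_eq[of _ "W \<diamondop> V" Z])
      (simp_all add: *[OF assms(1)] *[OF assms(2)] eq Hom_iff del: cmp_asc)
  then have "(g \<cdot> ?b) \<cdot> (minv C (Braid C A W) \<star> ide V) = (h \<cdot> ?b) \<cdot> (minv C (Braid C A W) \<star> ide V)" by simp
  then show ?thesis by (simp add: fuse ide_ten)
qed

lemma coend_mid_ex:
  assumes d: "pdinatural W V Z d" and [simp]: "W \<in> Obj C" "V \<in> Obj C" "Z \<in> Obj C"
  obtains g where "g \<in> Hom C (W \<diamondop> A \<diamondop> V) Z" "\<And>X. X \<in> Obj C \<Longrightarrow> g \<cdot> (ide W \<star> i X \<star> ide V) = d X"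
proof -
  have dh: "d X \<in> Hom C (W \<diamondop> du X \<diamondop> X \<diamondop> V) Z" if "X \<in> Obj C" for X
    using d that by (simp add: pdinatural_def)
  let ?b = "\<lambda>U. Braid C U W \<star> ide V"
  have "pdinatural \<I> (W \<diamondop> V) Z (\<lambda>X. d X \<cdot> ?b (du X \<diamondop> X))"
    unfolding pdinatural_def
  proof (intro conjI ballI allI)
    fix X assume [simp]: "X \<in> Obj C"
    note [simp] = HomD[OF dh, of X]
    show "d X \<cdot> ?b (du X \<diamondop> X) \<in> Hom C (\<I> \<diamondop> du X \<diamondop> X \<diamondop> W \<diamondop> V) Z" by (simp add: Hom_iff)
  next
    fix X Y f assume f: "f \<in> Hom C X Y"
    note [simp] = HomD[OF f] HomD[OF dh, of X] HomD[OF dh, of Y]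
    have 1: "?b (Cod C u) \<cdot> (u \<star> ide W \<star> ide V) = (ide W \<star> u \<star> ide V) \<cdot> ?b (Dom C u)" if [simp]: "u \<in> Mor C" for u
      using fuse[of "u \<star> ide W" "Braid C (Cod C u) W" "ide V" "ide V"] by (simp add: braid_nat whr)
    have "d X \<cdot> (ide W \<star> dual_mor C f \<star> ide X \<star> ide V) = d Y \<cdot> (ide W \<star> ide (du Y) \<star> f \<star> ide V)"
      using d f unfolding pdinatural_def by blast
    then have "(d X \<cdot> (ide W \<star> dual_mor C f \<star> ide X \<star> ide V)) \<cdot> ?b (du Y \<diamondop> X)
      = (d Y \<cdot> (ide W \<star> ide (du Y) \<star> f \<star> ide V)) \<cdot> ?b (du Y \<diamondop> X)" by simp
    then show "(d X \<cdot> ?b (du X \<diamondop> X)) \<cdot> (ide \<I> \<star> dual_mor C f \<star> ide X \<star> ide (W \<diamondop> V))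
        = (d Y \<cdot> ?b (du Y \<diamondop> Y)) \<cdot> (ide \<I> \<star> ide (du Y) \<star> f \<star> ide (W \<diamondop> V))"
      using 1[of "dual_mor C f \<star> ide X"] 1[of "ide (du Y) \<star> f"] by (simp add: ide_ten)
  qed
  then obtain g where g: "g \<in> Hom C (A \<diamondop> W \<diamondop> V) Z"
    "\<And>X. X \<in> Obj C \<Longrightarrow> g \<cdot> (i X \<star> ide (W \<diamondop> V)) = d X \<cdot> ?b (du X \<diamondop> X)"
    by (rule coend_right_ex) auto
  note [simp] = HomD[OF g(1)]
  let ?m = "\<lambda>U. minv C (Braid C U W) \<star> ide V"
  have gm: "g \<cdot> ?m A \<in> Hom C (W \<diamondop> A \<diamondop> V) Z" by (simp add: Hom_iff)
  have "(g \<cdot> ?m A) \<cdot> (ide W \<star> i X \<star> ide V) = d X" if [simp]: "X \<in> Obj C" for X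
  proof -
    note [simp] = HomD[OF dh, of X]
    have "?m A \<cdot> (ide W \<star> i X \<star> ide V) = (minv C (Braid C A W) \<cdot> (ide W \<star> i X)) \<star> ide V"
      using fuse[of "ide W \<star> i X" "minv C (Braid C A W)" "ide V" "ide V"] by simp
    also have "\<dots> = (i X \<star> ide (W \<diamondop> V)) \<cdot> ?m (du X \<diamondop> X)"
      by (simp add: braid_inv_nat whr ide_ten)
    finally have "(g \<cdot> ?m A) \<cdot> (ide W \<star> i X \<star> ide V) = (g \<cdot> (i X \<star> ide (W \<diamondop> V))) \<cdot> ?m (du X \<diamondop> X)" by simp
    also have "\<dots> = d X \<cdot> (?b (du X \<diamondop> X) \<cdot> ?m (du X \<diamondop> X))" by (simp add: g(2))
    also have "\<dots> = d X" by (simp add: fuse)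
    finally show ?thesis .
  qed
  then show thesis using that gm by blast
qed

subsection \<open>Iterated coends\<close>

abbreviation Apow where "Apow n \<equiv> ten_obs C (replicate n A)"
abbreviation imors where "imors n X \<equiv> ten_mors C (map (\<lambda>k. i (X k)) [0..<n])"
abbreviation iobs where "iobs n X \<equiv> ten_obs C (map (\<lambda>k. du (X k) \<diamondop> X k) [0..<n])"

lemma Apow_obj [simp]: "Apow n \<in> Obj C"
  by (rule ten_obs_obj) auto

lemma Apow_Suc: "Apow (Suc n) = Apow n \<diamondop> A"
  using ten_obs_append[of "replicate n A" "[A]"] by (simp add: replicate_append_same[symmetric] subset_iff del: replicate_Suc)
    (simp add: replicate_append_same)

lemma iobs_obj [simp]: "(\<And>k. X k \<in> Obj C) \<Longrightarrow> iobs n X \<in> Obj C"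
  by (rule ten_obs_obj) auto

lemma iobs_Suc: "(\<And>k. X k \<in> Obj C) \<Longrightarrow> iobs (Suc n) X = iobs n X \<diamondop> du (X n) \<diamondop> X n"
  using ten_obs_append[of "map (\<lambda>k. du (X k) \<diamondop> X k) [0..<n]" "[du (X n) \<diamondop> X n]"] by (simp add: image_subset_iff)

lemma imors_ty [simp]:
  assumes "\<And>k. X k \<in> Obj C"
  shows "imors n X \<in> Mor C" "Dom C (imors n X) = iobs n X" "Cod C (imors n X) = Apow n"
proof -
  have s: "set (map (\<lambda>k. i (X k)) [0..<n]) \<subseteq> Mor C" using assms by auto
  have "map (Dom C) (map (\<lambda>k. i (X k)) [0..<n]) = map (\<lambda>k. du (X k) \<diamondop> X k) [0..<n]"
    "map (Cod C) (map (\<lambda>k. i (X k)) [0..<n]) = replicate n A" using assms by (auto simp: list_eq_iff_nth_eq)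
  then show "imors n X \<in> Mor C" "Dom C (imors n X) = iobs n X" "Cod C (imors n X) = Apow n"
    using ten_mors_ty[OF s] by (simp_all only:)
qed

lemma imors_Suc: "(\<And>k. X k \<in> Obj C) \<Longrightarrow> imors (Suc n) X = imors n X \<star> i (X n)"
  using ten_mors_append[of "map (\<lambda>k. i (X k)) [0..<n]" "[i (X n)]"] by (simp add: image_subset_iff)

lemma imors_cong: "(\<And>k. k < n \<Longrightarrow> X k = Y k) \<Longrightarrow> imors n X = imors n Y"
  by (rule arg_cong[of _ _ "ten_mors C"]) simp

lemma iobs_cong: "(\<And>k. k < n \<Longrightarrow> X k = Y k) \<Longrightarrow> iobs n X = iobs n Y"
  by (rule arg_cong[of _ _ "ten_obs C"]) simp

text \<open>The last factor is peeled off by \<open>coend_mid_eq\<close>, after which the two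
  objects of its colour join the spectator; hence \<open>V\<close> is arbitrary in the
  induction.\<close>

lemma coend_pow_eq:
  assumes "g \<in> Hom C (Apow n \<diamondop> V) Z" "h \<in> Hom C (Apow n \<diamondop> V) Z" "V \<in> Obj C"
    and "\<And>X. (\<And>k. X k \<in> Obj C) \<Longrightarrow> g \<cdot> (imors n X \<star> ide V) = h \<cdot> (imors n X \<star> ide V)"
  shows "g = h"
  using assms
proof (induction n arbitrary: V g h)
  case 0
  then show ?case using 0(4)[of "\<lambda>k. \<I>"] HomD[OF 0(1)] HomD[OF 0(2)] by simp
next
  case (Suc n)
  note [simp] = HomD[OF Suc.prems(1)] HomD[OF Suc.prems(2)] Suc.prems(3)
  have gh: "g \<in> Hom C (Apow n \<diamondop> A \<diamondop> V) Z" "h \<in> Hom C (Apow n \<diamondop> A \<diamondop> V) Z"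
    using Suc.prems(1,2) unfolding Apow_Suc by simp_all
  show ?case
  proof (rule coend_mid_eq[OF gh])
    fix x assume [simp]: "x \<in> Obj C"
    show "g \<cdot> (ide (Apow n) \<star> i x \<star> ide V) = h \<cdot> (ide (Apow n) \<star> i x \<star> ide V)"
    proof (rule Suc.IH[of _ "du x \<diamondop> x \<diamondop> V"])
      fix X assume X: "\<And>k::nat. X k \<in> Obj C"
      then have X': "(X(n := x)) k \<in> Obj C" for k by simp
      note [simp] = imors_ty[of X, OF X]
      have s: "imors (Suc n) (X(n := x)) = imors n X \<star> i x"
        using imors_Suc[of "X(n := x)" n, OF X'] imors_cong[of n "X(n := x)" X] by (simp del: upt_Suc)
      have e: "(u \<cdot> (ide (Apow n) \<star> i x \<star> ide V)) \<cdot> (imors n X \<star> ide (du x \<diamondop> x \<diamondop> V))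
          = u \<cdot> (imors (Suc n) (X(n := x)) \<star> ide V)" if "u \<in> Hom C (Apow n \<diamondop> A \<diamondop> V) Z" for u
      proof -
        note [simp] = HomD[OF that]
        have "(ide (Apow n) \<star> i x \<star> ide V) \<cdot> (imors n X \<star> ide (du x \<diamondop> x \<diamondop> V)) = imors n X \<star> i x \<star> ide V"
          by (simp add: fuse)
        then show ?thesis unfolding s by simp
      qed
      show "(g \<cdot> (ide (Apow n) \<star> i x \<star> ide V)) \<cdot> (imors n X \<star> ide (du x \<diamondop> x \<diamondop> V))
          = (h \<cdot> (ide (Apow n) \<star> i x \<star> ide V)) \<cdot> (imors n X \<star> ide (du x \<diamondop> x \<diamondop> V))"
        unfolding e[OF gh(1)] e[OF gh(2)] by (rule Suc.prems(4)[of "X(n := x)", OF X'])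
    qed (use HomD[OF gh(1)] HomD[OF gh(2)] in \<open>simp_all add: Hom_iff\<close>)
  qed simp_all
qed

abbreviation ldin where "ldin n X f \<equiv> ten_mors C (map (\<lambda>k. dual_mor C (f k) \<star> ide (X k)) [0..<n])"
abbreviation rdin where "rdin n Y f \<equiv> ten_mors C (map (\<lambda>k. ide (du (Y k)) \<star> f k) [0..<n])"

lemma din_Suc:
  assumes "\<And>k. f k \<in> Hom C (X k) (Y k)"
  shows "ldin (Suc n) X f = ldin n X f \<star> dual_mor C (f n) \<star> ide (X n)"
    "rdin (Suc n) Y f = rdin n Y f \<star> ide (du (Y n)) \<star> f n"
proof -
  note [simp] = HomD[OF assms]
  show "ldin (Suc n) X f = ldin n X f \<star> dual_mor C (f n) \<star> ide (X n)"
    "rdin (Suc n) Y f = rdin n Y f \<star> ide (du (Y n)) \<star> f n"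
    using ten_mors_append[of "map (\<lambda>k. dual_mor C (f k) \<star> ide (X k)) [0..<n]" "[dual_mor C (f n) \<star> ide (X n)]"]
      ten_mors_append[of "map (\<lambda>k. ide (du (Y k)) \<star> f k) [0..<n]" "[ide (du (Y n)) \<star> f n]"]
    by (simp_all add: image_subset_iff)
qed

lemma din_ide:
  assumes "\<And>k. X k \<in> Obj C"
  shows "ldin n X (\<lambda>k. ide (X k)) = ide (iobs n X)" "rdin n X (\<lambda>k. ide (X k)) = ide (iobs n X)"
  using ten_mors_ide[of "[0..<n]" "\<lambda>k. du (X k) \<diamondop> X k"] assms by (simp_all add: ide_ten)

lemma din_cong:
  "(\<And>k. k < n \<Longrightarrow> X k = X' k \<and> f k = f' k) \<Longrightarrow> ldin n X f = ldin n X' f'"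
  "(\<And>k. k < n \<Longrightarrow> Y k = Y' k \<and> f k = f' k) \<Longrightarrow> rdin n Y f = rdin n Y' f'"
  by (rule arg_cong[of _ _ "ten_mors C"]; simp)+

text \<open>A Fubini argument. For a fixed last colour \<open>x\<close> the induction hypothesis
  gives a morphism \<open>\<psi> x\<close> out of the smaller power. The family of these is
  dinatural in \<open>x\<close>, which can be tested on the other colours, and so it factors through
  the last copy of \<open>A\<close>.\<close>

lemma coend_pow_ex:
  assumes "\<And>X. (\<And>k. X k \<in> Obj C) \<Longrightarrow> F X \<in> Hom C (iobs n X \<diamondop> V) Z" "V \<in> Obj C" "Z \<in> Obj C"
    and "\<And>X Y f. (\<And>k. f k \<in> Hom C (X k) (Y k)) \<Longrightarrow>
      F X \<cdot> (ldin n X f \<star> ide V) = F Y \<cdot> (rdin n Y f \<star> ide V)"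
  shows "\<exists>\<psi>\<in>Hom C (Apow n \<diamondop> V) Z. \<forall>X. (\<forall>k. X k \<in> Obj C) \<longrightarrow> \<psi> \<cdot> (imors n X \<star> ide V) = F X"
  using assms
proof (induction n arbitrary: V F)
  case 0
  \<comment> \<open>Colours are total sequences, so even for \<open>n = 0\<close> the family might
    depend on \<open>X\<close>. Zero morphisms connect any two sequences, and dinaturality along
    them forces the family to be constant.\<close>
  have e: "F X = F Y" if X: "\<And>k::nat. X k \<in> Obj C" and Y: "\<And>k::nat. Y k \<in> Obj C" for X Y
  proof -
    have z: "Zer C (X k) (Y k) \<in> Hom C (X k) (Y k)" for k using X Y by (rule Zer_hom)
    show ?thesis
      using 0(4)[of "\<lambda>k. Zer C (X k) (Y k)" X Y, OF z] HomD[OF 0(1)[of X, OF X]] HomD[OF 0(1)[of Y, OF Y]] 0(2) by simp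
  qed
  let ?U = "\<lambda>k::nat. \<I>"
  have U: "F ?U \<in> Hom C V Z" using 0(1)[of ?U] 0(2) by simp
  show ?case
  proof (intro bexI[of _ "F ?U"] allI impI)
    fix X assume X: "\<forall>k::nat. X k \<in> Obj C"
    then show "F ?U \<cdot> (imors 0 X \<star> ide V) = F X" using e[of ?U X] HomD[OF U] by simp
  qed (use U 0(2) in simp)
next
  case (Suc n)
  note [simp] = Suc.prems(2,3)
  have ex: "\<exists>\<psi>\<in>Hom C (Apow n \<diamondop> du x \<diamondop> x \<diamondop> V) Z. \<forall>X. (\<forall>k. X k \<in> Obj C) \<longrightarrow>
      \<psi> \<cdot> (imors n X \<star> ide (du x \<diamondop> x \<diamondop> V)) = F (X(n := x))" if x [simp]: "x \<in> Obj C" for x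
  proof (rule Suc.IH)
    fix X assume X: "\<And>k::nat. X k \<in> Obj C"
    then have X': "(X(n := x)) k \<in> Obj C" for k by simp
    have e: "iobs (Suc n) (X(n := x)) = iobs n X \<diamondop> du x \<diamondop> x"
      using iobs_Suc[of "X(n := x)" n, OF X'] iobs_cong[of n "X(n := x)" X] by (simp del: upt_Suc)
    have "F (X(n := x)) \<in> Hom C (iobs (Suc n) (X(n := x)) \<diamondop> V) Z"
      by (rule Suc.prems(1)) (rule X')
    then show "F (X(n := x)) \<in> Hom C (iobs n X \<diamondop> du x \<diamondop> x \<diamondop> V) Z"
      unfolding e by (simp only: ten_obj_assoc iobs_obj[of X n, OF X] x dual_obj ten_obj Suc.prems(2))
  next
    fix X Y f assume f: "\<And>k::nat. f k \<in> Hom C (X k) (Y k)"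
    let ?X = "X(n := x)" and ?Y = "Y(n := x)" and ?f = "f(n := ide x)"
    have f': "?f k \<in> Hom C (?X k) (?Y k)" for k using f by (simp add: Hom_iff)
    have m: "set (map (\<lambda>k. dual_mor C (f k) \<star> ide (X k)) [0..<n]) \<subseteq> Mor C"
      "set (map (\<lambda>k. ide (du (Y k)) \<star> f k) [0..<n]) \<subseteq> Mor C" using HomD[OF f] by auto
    have d: "ldin (Suc n) ?X ?f = ldin n X f \<star> ide (du x) \<star> ide x" "rdin (Suc n) ?Y ?f = rdin n Y f \<star> ide (du x) \<star> ide x"
      using din_Suc[of ?f ?X ?Y n, OF f'] din_cong(1)[of n ?X X ?f f] din_cong(2)[of n ?Y Y ?f f] by (simp_all del: upt_Suc)
    have "F ?X \<cdot> (ldin (Suc n) ?X ?f \<star> ide V) = F ?Y \<cdot> (rdin (Suc n) ?Y ?f \<star> ide V)"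
      by (rule Suc.prems(4)) (rule f')
    then show "F ?X \<cdot> (ldin n X f \<star> ide (du x \<diamondop> x \<diamondop> V)) = F ?Y \<cdot> (rdin n Y f \<star> ide (du x \<diamondop> x \<diamondop> V))"
      unfolding d using ten_mors_ty(1)[OF m(1)] ten_mors_ty(1)[OF m(2)] by (simp add: ide_ten)
  qed simp_all
  then obtain \<psi> where \<psi>: "\<And>x. x \<in> Obj C \<Longrightarrow> \<psi> x \<in> Hom C (Apow n \<diamondop> du x \<diamondop> x \<diamondop> V) Z"
    "\<And>x X. x \<in> Obj C \<Longrightarrow> (\<And>k. X k \<in> Obj C) \<Longrightarrow> \<psi> x \<cdot> (imors n X \<star> ide (du x \<diamondop> x \<diamondop> V)) = F (X(n := x))"
    by metis
  note [simp] = HomD(1-3)[OF \<psi>(1)]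
  have "pdinatural (Apow n) V Z \<psi>"
    unfolding pdinatural_def
  proof (intro conjI ballI allI)
    fix x y u assume u: "u \<in> Hom C x y"
    note [simp] = HomD[OF u]
    show "\<psi> x \<cdot> (ide (Apow n) \<star> dual_mor C u \<star> ide x \<star> ide V) = \<psi> y \<cdot> (ide (Apow n) \<star> ide (du y) \<star> u \<star> ide V)"
    proof (rule coend_pow_eq[of _ n "du y \<diamondop> x \<diamondop> V" Z])
      fix X assume X: "\<And>k::nat. X k \<in> Obj C"
      note [simp] = imors_ty[of X, OF X] iobs_obj[of X, OF X]
      \<comment> \<open>Below the index \<open>n\<close> the components of \<open>?f\<close> are
        identities, so simultaneous dinaturality specialises to dinaturality in the last
        colour.\<close>
      let ?X = "X(n := x)" and ?Y = "X(n := y)" and ?f = "\<lambda>k. if k = n then u else ide (X k)"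
      have f': "?f k \<in> Hom C (?X k) (?Y k)" for k using X u by (simp add: Hom_iff)
      have d: "ldin (Suc n) ?X ?f = ide (iobs n X) \<star> dual_mor C u \<star> ide x"
        "rdin (Suc n) ?Y ?f = ide (iobs n X) \<star> ide (du y) \<star> u"
        using din_Suc[of ?f ?X ?Y n, OF f'] din_cong(1)[of n ?X X ?f "\<lambda>k. ide (X k)"]
          din_cong(2)[of n ?Y X ?f "\<lambda>k. ide (X k)"] din_ide[of X n, OF X] by (simp_all del: upt_Suc)
      have "(\<psi> x \<cdot> (ide (Apow n) \<star> dual_mor C u \<star> ide x \<star> ide V)) \<cdot> (imors n X \<star> ide (du y \<diamondop> x \<diamondop> V))
          = (\<psi> x \<cdot> (imors n X \<star> ide (du x \<diamondop> x \<diamondop> V))) \<cdot> (ide (iobs n X) \<star> dual_mor C u \<star> ide x \<star> ide V)"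
        by (simp add: fuse ide_ten)
      also have "\<dots> = F ?X \<cdot> (ldin (Suc n) ?X ?f \<star> ide V)"
        unfolding d using \<psi>(2)[of x X] X by simp
      also have "\<dots> = F ?Y \<cdot> (rdin (Suc n) ?Y ?f \<star> ide V)" by (rule Suc.prems(4)[of ?f ?X ?Y, OF f'])
      also have "\<dots> = (\<psi> y \<cdot> (imors n X \<star> ide (du y \<diamondop> y \<diamondop> V))) \<cdot> (ide (iobs n X) \<star> ide (du y) \<star> u \<star> ide V)"
        unfolding d using \<psi>(2)[of y X] X by simp
      also have "\<dots> = (\<psi> y \<cdot> (ide (Apow n) \<star> ide (du y) \<star> u \<star> ide V)) \<cdot> (imors n X \<star> ide (du y \<diamondop> x \<diamondop> V))"
        by (simp add: fuse ide_ten)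
      finally show "(\<psi> x \<cdot> (ide (Apow n) \<star> dual_mor C u \<star> ide x \<star> ide V)) \<cdot> (imors n X \<star> ide (du y \<diamondop> x \<diamondop> V))
        = (\<psi> y \<cdot> (ide (Apow n) \<star> ide (du y) \<star> u \<star> ide V)) \<cdot> (imors n X \<star> ide (du y \<diamondop> x \<diamondop> V))" .
    qed (simp_all add: Hom_iff)
  qed (use \<psi>(1) in simp)
  then obtain g where g: "g \<in> Hom C (Apow n \<diamondop> A \<diamondop> V) Z" "\<And>x. x \<in> Obj C \<Longrightarrow> g \<cdot> (ide (Apow n) \<star> i x \<star> ide V) = \<psi> x"
    by (rule coend_mid_ex) auto
  note [simp] = HomD[OF g(1)]
  have "g \<cdot> (imors (Suc n) X \<star> ide V) = F X" if X: "\<And>k::nat. X k \<in> Obj C" for X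
  proof -
    note [simp] = imors_ty[of X, OF X] X
    have "imors (Suc n) X \<star> ide V = (ide (Apow n) \<star> i (X n) \<star> ide V) \<cdot> (imors n X \<star> ide (du (X n) \<diamondop> X n \<diamondop> V))"
      unfolding imors_Suc[of X, OF X] by (simp add: fuse)
    then have "g \<cdot> (imors (Suc n) X \<star> ide V) = (g \<cdot> (ide (Apow n) \<star> i (X n) \<star> ide V)) \<cdot> (imors n X \<star> ide (du (X n) \<diamondop> X n \<diamondop> V))"
      by simp
    also have "\<dots> = F X" using g(2)[of "X n"] \<psi>(2)[of "X n" X] by simp
    finally show ?thesis .
  qed
  then show ?case using g(1) unfolding Apow_Suc by (intro bexI[of _ g]) simp_all
qed

lemma coend2_eq:
  assumes "g \<in> Hom C (A \<diamondop> A) Z" "h \<in> Hom C (A \<diamondop> A) Z"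
    and eq: "\<And>X Y. X \<in> Obj C \<Longrightarrow> Y \<in> Obj C \<Longrightarrow> g \<cdot> (i X \<star> i Y) = h \<cdot> (i X \<star> i Y)"
  shows "g = h"
  by (rule coend_pow_eq[of g 2 \<I> Z]) (use assms in \<open>simp_all add: numeral_2_eq_2\<close>)

lemma coend2_ex:
  assumes D: "\<And>X Y. X \<in> Obj C \<Longrightarrow> Y \<in> Obj C \<Longrightarrow> D X Y \<in> Hom C (du X \<diamondop> X \<diamondop> du Y \<diamondop> Y) Z" and Z: "Z \<in> Obj C"
    and dinat: "\<And>X X' f Y Y' g. f \<in> Hom C X X' \<Longrightarrow> g \<in> Hom C Y Y' \<Longrightarrow>
      D X Y \<cdot> (dual_mor C f \<star> ide X \<star> dual_mor C g \<star> ide Y) = D X' Y' \<cdot> (ide (du X') \<star> f \<star> ide (du Y') \<star> g)"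
  obtains m where "m \<in> Hom C (A \<diamondop> A) Z" "\<And>X Y. X \<in> Obj C \<Longrightarrow> Y \<in> Obj C \<Longrightarrow> m \<cdot> (i X \<star> i Y) = D X Y"
proof -
  have "\<exists>\<psi>\<in>Hom C (Apow 2 \<diamondop> \<I>) Z. \<forall>X. (\<forall>k. X k \<in> Obj C) \<longrightarrow> \<psi> \<cdot> (imors 2 X \<star> ide \<I>) = D (X 0) (X 1)"
  proof (rule coend_pow_ex)
    show "D (X 0) (X 1) \<in> Hom C (iobs 2 X \<diamondop> \<I>) Z" if "\<And>k. X k \<in> Obj C" for X
      using D that by (simp add: numeral_2_eq_2)
    fix X Y f assume f: "\<And>k::nat. f k \<in> Hom C (X k) (Y k)"
    note [simp] = HomD[OF f]
    show "D (X 0) (X 1) \<cdot> (ldin 2 X f \<star> ide \<I>) = D (Y 0) (Y 1) \<cdot> (rdin 2 Y f \<star> ide \<I>)"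
      using dinat[OF f f] by (simp add: numeral_2_eq_2)
  qed (use Z in simp_all)
  then obtain m where m: "m \<in> Hom C (A \<diamondop> A) Z"
    "\<And>X. (\<And>k. X k \<in> Obj C) \<Longrightarrow> m \<cdot> (imors 2 X \<star> ide \<I>) = D (X 0) (X 1)"
    by (auto simp: numeral_2_eq_2)
  show thesis
  proof (rule that[OF m(1)])
    show "m \<cdot> (i X \<star> i Y) = D X Y" if "X \<in> Obj C" "Y \<in> Obj C" for X Y
      using m(2)[of "\<lambda>k. if k = 0 then X else Y"] that by (simp add: numeral_2_eq_2)
  qed
qed

subsection \<open>Structural morphisms\<close>

text \<open>Makes the definite descriptions of the structural morphisms with source \<open>A\<close>
  meaningful; for each of them it remains to prove that the prescribed family is dinatural.\<close>

lemma coend_the: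
  assumes "dinatural C Z d" "Z \<in> Obj C"
  defines "t \<equiv> THE t. t \<in> Hom C A Z \<and> (\<forall>X\<in>Obj C. t \<cdot> i X = d X)"
  shows "t \<in> Hom C A Z \<and> (\<forall>X\<in>Obj C. t \<cdot> i X = d X)"
proof -
  obtain g where g: "g \<in> Hom C A Z" "\<And>X. X \<in> Obj C \<Longrightarrow> g \<cdot> i X = d X"
    using coend_ex[OF assms(1,2)] by blast
  show ?thesis unfolding t_def
  proof (rule theI)
    show "g \<in> Hom C A Z \<and> (\<forall>X\<in>Obj C. g \<cdot> i X = d X)" using g by blast
    show "t = g" if "t \<in> Hom C A Z \<and> (\<forall>X\<in>Obj C. t \<cdot> i X = d X)" for t
      by (rule coend_eq[of t Z g]) (use that g in simp_all)
  qed
qed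

text \<open>Stated for any natural family \<open>t\<close> of endomorphisms, which treats the twist
  and its inverse together.\<close>

lemma Theta_dinat:
  assumes "\<And>X Y f. f \<in> Hom C X Y \<Longrightarrow> t Y \<cdot> f = f \<cdot> t X" "\<And>X. X \<in> Obj C \<Longrightarrow> t X \<in> Hom C X X"
  shows "dinatural C \<I> (\<lambda>X. Ev C X \<cdot> (ide (du X) \<star> t X))"
  unfolding dinatural_def
proof (intro conjI ballI allI)
  note [simp] = HomD(1-3)[OF assms(2)]
  show "Ev C X \<cdot> (ide (du X) \<star> t X) \<in> Hom C (du X \<diamondop> X) \<I>" if "X \<in> Obj C" for X
    using that by (simp add: Hom_iff)
  fix X Y f assume f: "f \<in> Hom C X Y"
  note [simp] = HomD[OF f]
  have "(Ev C X \<cdot> (ide (du X) \<star> t X)) \<cdot> (dual_mor C f \<star> ide X)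
      = (Ev C X \<cdot> (dual_mor C f \<star> ide X)) \<cdot> (ide (du Y) \<star> t X)" by (simp add: fuse)
  then show "(Ev C X \<cdot> (ide (du X) \<star> t X)) \<cdot> (dual_mor C f \<star> ide X) = (Ev C Y \<cdot> (ide (du Y) \<star> t Y)) \<cdot> (ide (du Y) \<star> f)"
    by (simp add: ev_dual[OF f] fuse assms(1)[OF f])
qed

lemma Theta_plus_spec:
  "Theta_plus C A i \<in> Hom C A \<I> \<and> (\<forall>X\<in>Obj C. Theta_plus C A i \<cdot> i X = Ev C X \<cdot> (ide (du X) \<star> Twist C X))"
  unfolding Theta_plus_def
  by (rule coend_the) (auto intro!: Theta_dinat simp: twist_natural Hom_iff twist_nat)

lemma Theta_minus_spec:
  "Theta_minus C A i \<in> Hom C A \<I> \<and>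
    (\<forall>X\<in>Obj C. Theta_minus C A i \<cdot> i X = Ev C X \<cdot> (ide (du X) \<star> minv C (Twist C X)))"
  unfolding Theta_minus_def
  by (rule coend_the) (auto intro!: Theta_dinat simp: Hom_iff twist_inv_nat)

text \<open>The morphism \<open>f\<close> crosses three places in turn: the first copy of
  \<open>i\<close>, the coevaluation between the copies, and the second copy of
  \<open>i\<close>.\<close>

lemma comult_dinat:
  "dinatural C (A \<diamondop> A) (\<lambda>X. (i X \<star> i X) \<cdot> (ide (du X) \<star> Coev C X \<star> ide X))"
  unfolding dinatural_def
proof (intro conjI ballI allI)
  show "(i X \<star> i X) \<cdot> (ide (du X) \<star> Coev C X \<star> ide X) \<in> Hom C (du X \<diamondop> X) (A \<diamondop> A)" if "X \<in> Obj C" for X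
    using that by (simp add: Hom_iff)
  fix X Y f assume f: "f \<in> Hom C X Y"
  note [simp] = HomD[OF f]
  have "((i X \<star> i X) \<cdot> (ide (du X) \<star> Coev C X \<star> ide X)) \<cdot> (dual_mor C f \<star> ide X)
      = (i X \<star> i X) \<cdot> (dual_mor C f \<star> Coev C X \<star> ide X)"
    using fuse[of "ide \<I>" "Coev C X" "ide X" "ide X"] by (simp add: fuse)
  also have "\<dots> = (i X \<star> i X) \<cdot> (dual_mor C f \<star> ide X \<star> ide (du X) \<star> ide X) \<cdot> (ide (du Y) \<star> Coev C X \<star> ide X)"
    using fuse[of "Coev C X" "ide X \<star> ide (du X)" "ide X" "ide X"] by (simp add: fuse)
  also have "\<dots> = ((i X \<cdot> (dual_mor C f \<star> ide X)) \<star> i X) \<cdot> (ide (du Y) \<star> Coev C X \<star> ide X)"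
    using fuse_cmp[of "dual_mor C f \<star> ide X" "i X" "ide (du X) \<star> ide X" "i X" "ide (du Y) \<star> Coev C X \<star> ide X"] by simp
  also have "\<dots> = (i Y \<star> i X) \<cdot> (ide (du Y) \<star> f \<star> ide (du X) \<star> ide X) \<cdot> (ide (du Y) \<star> Coev C X \<star> ide X)"
    using fuse_cmp[of "ide (du Y) \<star> f" "i Y" "ide (du X) \<star> ide X" "i X" "ide (du Y) \<star> Coev C X \<star> ide X"]
    by (simp add: i_dinat[OF f])
  also have "(ide (du Y) \<star> f \<star> ide (du X) \<star> ide X) \<cdot> (ide (du Y) \<star> Coev C X \<star> ide X)
      = ide (du Y) \<star> ((f \<star> ide (du X)) \<cdot> Coev C X) \<star> ide X"
    by (simp add: whl whr)
  also have "\<dots> = (ide (du Y) \<star> ide Y \<star> dual_mor C f \<star> ide X) \<cdot> (ide (du Y) \<star> Coev C Y \<star> ide X)"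
    unfolding coev_dual[OF f] by (simp add: whl whr)
  also have "(i Y \<star> i X) \<cdot> (ide (du Y) \<star> ide Y \<star> dual_mor C f \<star> ide X) \<cdot> (ide (du Y) \<star> Coev C Y \<star> ide X)
      = (i Y \<star> (i X \<cdot> (dual_mor C f \<star> ide X))) \<cdot> (ide (du Y) \<star> Coev C Y \<star> ide X)"
    using fuse_cmp[of "ide (du Y) \<star> ide Y" "i Y" "dual_mor C f \<star> ide X" "i X" "ide (du Y) \<star> Coev C Y \<star> ide X"] by simp
  also have "\<dots> = (i Y \<star> i Y) \<cdot> (ide (du Y) \<star> ide Y \<star> ide (du Y) \<star> f) \<cdot> (ide (du Y) \<star> Coev C Y \<star> ide X)"
    using fuse_cmp[of "ide (du Y) \<star> ide Y" "i Y" "ide (du Y) \<star> f" "i Y" "ide (du Y) \<star> Coev C Y \<star> ide X"]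
    by (simp add: i_dinat[OF f])
  also have "(ide (du Y) \<star> ide Y \<star> ide (du Y) \<star> f) \<cdot> (ide (du Y) \<star> Coev C Y \<star> ide X)
      = (ide (du Y) \<star> Coev C Y \<star> ide Y) \<cdot> (ide (du Y) \<star> f)"
    using fuse[of "Coev C Y" "ide Y \<star> ide (du Y)" "ide X" f] fuse[of "ide \<I>" "Coev C Y" f "ide Y"]
    by (simp add: fuse)
  finally show "((i X \<star> i X) \<cdot> (ide (du X) \<star> Coev C X \<star> ide X)) \<cdot> (dual_mor C f \<star> ide X)
      = ((i Y \<star> i Y) \<cdot> (ide (du Y) \<star> Coev C Y \<star> ide Y)) \<cdot> (ide (du Y) \<star> f)" by simp
qed

lemma comult_spec:
  "coend_comult C A i \<in> Hom C A (A \<diamondop> A) \<and>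
    (\<forall>X\<in>Obj C. coend_comult C A i \<cdot> i X = (i X \<star> i X) \<cdot> (ide (du X) \<star> Coev C X \<star> ide X))"
  unfolding coend_comult_def by (rule coend_the[OF comult_dinat]) simp

text \<open>The braiding exchanges the two strands, so \<open>i\<close> is met at a dual colour. Its
  dinaturality is applied to the dual of \<open>f\<close>, and \<open>bidual_nat\<close> removes the
  double dual that results.\<close>

lemma antipode_dinat:
  "dinatural C A (\<lambda>X. i (du X) \<cdot> (bidual C X \<star> Twist C (du X)) \<cdot> Braid C (du X) X)"
  unfolding dinatural_def
proof (intro conjI ballI allI)
  show "i (du X) \<cdot> (bidual C X \<star> Twist C (du X)) \<cdot> Braid C (du X) X \<in> Hom C (du X \<diamondop> X) A" if "X \<in> Obj C" for X
    using that by (simp add: Hom_iff)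
  fix X Y f assume f: "f \<in> Hom C X Y"
  note [simp] = HomD[OF f]
  note f' = dual_mor_hom[OF f]
  have "(i (du X) \<cdot> (bidual C X \<star> Twist C (du X)) \<cdot> Braid C (du X) X) \<cdot> (dual_mor C f \<star> ide X)
      = i (du X) \<cdot> (bidual C X \<star> Twist C (du X)) \<cdot> (ide X \<star> dual_mor C f) \<cdot> Braid C (du Y) X"
    by (simp add: braid_nat)
  also have "\<dots> = (i (du X) \<cdot> (ide (du (du X)) \<star> dual_mor C f)) \<cdot> (bidual C X \<star> Twist C (du Y)) \<cdot> Braid C (du Y) X"
    by (simp add: fuse_cmp twist_nat)
  also have "\<dots> = i (du Y) \<cdot> (dual_mor C (dual_mor C f) \<star> ide (du Y)) \<cdot> (bidual C X \<star> Twist C (du Y)) \<cdot> Braid C (du Y) X"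
    unfolding i_dinat[OF f', symmetric] by simp
  also have "\<dots> = i (du Y) \<cdot> (bidual C Y \<star> Twist C (du Y)) \<cdot> (f \<star> ide (du Y)) \<cdot> Braid C (du Y) X"
    by (simp add: fuse_cmp bidual_nat[OF f])
  also have "(f \<star> ide (du Y)) \<cdot> Braid C (du Y) X = Braid C (du Y) Y \<cdot> (ide (du Y) \<star> f)"
    by (simp add: braid_nat)
  finally show "(i (du X) \<cdot> (bidual C X \<star> Twist C (du X)) \<cdot> Braid C (du X) X) \<cdot> (dual_mor C f \<star> ide X)
     = (i (du Y) \<cdot> (bidual C Y \<star> Twist C (du Y)) \<cdot> Braid C (du Y) Y) \<cdot> (ide (du Y) \<star> f)" by simp
qed

lemma antipode_spec:
  "coend_antipode C A i \<in> Hom C A A \<and>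
    (\<forall>X\<in>Obj C. coend_antipode C A i \<cdot> i X = i (du X) \<cdot> (bidual C X \<star> Twist C (du X)) \<cdot> Braid C (du X) X)"
  unfolding coend_antipode_def by (rule coend_the[OF antipode_dinat]) simp

text \<open>Dinaturality is required in both colours at once. The duals of \<open>f\<close> and
  \<open>g\<close> pass the braiding by naturality, are combined by \<open>dual_ten_nat\<close> into
  the dual of \<open>g \<star> f\<close>, cross \<open>i\<close> as one morphism and are separated
  again on the other strands.\<close>

lemma mult_spec:
  "coend_mult C A i \<in> Hom C (A \<diamondop> A) A \<and>
    (\<forall>X\<in>Obj C. \<forall>Y\<in>Obj C. coend_mult C A i \<cdot> (i X \<star> i Y)
      = i (Y \<diamondop> X) \<cdot> (dual_ten C X Y \<star> ide (Y \<diamondop> X)) \<cdot> (ide (du X) \<star> Braid C X (du Y \<diamondop> Y)))"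
proof -
  let ?D = "\<lambda>X Y. i (Y \<diamondop> X) \<cdot> (dual_ten C X Y \<star> ide (Y \<diamondop> X)) \<cdot> (ide (du X) \<star> Braid C X (du Y \<diamondop> Y))"
  have D0: "?D X Y \<in> Hom C (du X \<diamondop> X \<diamondop> du Y \<diamondop> Y) A" if "X \<in> Obj C" "Y \<in> Obj C" for X Y
    using that by (simp add: Hom_iff)
  have D: "?D X Y \<cdot> (dual_mor C f \<star> ide X \<star> dual_mor C g \<star> ide Y) = ?D X' Y' \<cdot> (ide (du X') \<star> f \<star> ide (du Y') \<star> g)"
    if f: "f \<in> Hom C X X'" and g: "g \<in> Hom C Y Y'" for f X X' g Y Y'
  proof -
    note [simp] = HomD[OF f] HomD[OF g]
    let ?c = "ide (du X') \<star> Braid C X (du Y' \<diamondop> Y)" and ?\<gamma> = "dual_ten C X' Y'"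
    have gf: "g \<star> f \<in> Hom C (Y \<diamondop> X) (Y' \<diamondop> X')" by (simp add: Hom_iff)
    have 1: "(ide (du X) \<star> Braid C X (du Y \<diamondop> Y)) \<cdot> (dual_mor C f \<star> ide X \<star> dual_mor C g \<star> ide Y)
        = (dual_mor C f \<star> dual_mor C g \<star> ide (Y \<diamondop> X)) \<cdot> ?c"
      by (simp add: fuse braid_nat ide_ten)
    have 2: "(dual_ten C X Y \<star> ide (Y \<diamondop> X)) \<cdot> (dual_mor C f \<star> dual_mor C g \<star> ide (Y \<diamondop> X))
        = (dual_mor C (g \<star> f) \<star> ide (Y \<diamondop> X)) \<cdot> (?\<gamma> \<star> ide (Y \<diamondop> X))"
      using fuse[of "dual_mor C f \<star> dual_mor C g" "dual_ten C X Y" "ide (Y \<diamondop> X)" "ide (Y \<diamondop> X)"]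
      by (simp add: dual_ten_nat[OF f g] whr)
    have 3: "(ide (du (Y' \<diamondop> X')) \<star> g \<star> f) \<cdot> (?\<gamma> \<star> ide (Y \<diamondop> X))
        = (?\<gamma> \<star> ide (Y' \<diamondop> X')) \<cdot> (ide (du X') \<star> ide (du Y') \<star> g \<star> f)"
      using fuse[of "ide (du X') \<star> ide (du Y')" ?\<gamma> "g \<star> f" "ide (Y' \<diamondop> X')"]
        fuse[of ?\<gamma> "ide (du (Y' \<diamondop> X'))" "ide (Y \<diamondop> X)" "g \<star> f"] by simp
    have 4: "(ide (du X') \<star> ide (du Y') \<star> g \<star> f) \<cdot> ?c
        = (ide (du X') \<star> Braid C X' (du Y' \<diamondop> Y')) \<cdot> (ide (du X') \<star> f \<star> ide (du Y') \<star> g)"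
      using braid_nat[of f "ide (du Y') \<star> g"] by (simp add: fuse)
    have "?D X Y \<cdot> (dual_mor C f \<star> ide X \<star> dual_mor C g \<star> ide Y)
        = i (Y \<diamondop> X) \<cdot> ((dual_ten C X Y \<star> ide (Y \<diamondop> X)) \<cdot> (dual_mor C f \<star> dual_mor C g \<star> ide (Y \<diamondop> X))) \<cdot> ?c"
      by (simp add: 1)
    also have "\<dots> = (i (Y \<diamondop> X) \<cdot> (dual_mor C (g \<star> f) \<star> ide (Y \<diamondop> X))) \<cdot> (?\<gamma> \<star> ide (Y \<diamondop> X)) \<cdot> ?c"
      unfolding 2 by simp
    also have "\<dots> = i (Y' \<diamondop> X') \<cdot> ((ide (du (Y' \<diamondop> X')) \<star> g \<star> f) \<cdot> (?\<gamma> \<star> ide (Y \<diamondop> X))) \<cdot> ?c"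
      unfolding i_dinat[OF gf] by simp
    also have "\<dots> = i (Y' \<diamondop> X') \<cdot> (?\<gamma> \<star> ide (Y' \<diamondop> X')) \<cdot> ((ide (du X') \<star> ide (du Y') \<star> g \<star> f) \<cdot> ?c)"
      unfolding 3 by simp
    finally show ?thesis unfolding 4 by simp
  qed
  obtain m where m: "m \<in> Hom C (A \<diamondop> A) A" "\<And>X Y. X \<in> Obj C \<Longrightarrow> Y \<in> Obj C \<Longrightarrow> m \<cdot> (i X \<star> i Y) = ?D X Y"
    using coend2_ex[of ?D A, OF D0 _ D] by auto
  show ?thesis unfolding coend_mult_def
  proof (rule theI)
    show "m \<in> Hom C (A \<diamondop> A) A \<and> (\<forall>X\<in>Obj C. \<forall>Y\<in>Obj C. m \<cdot> (i X \<star> i Y) = ?D X Y)" using m by blast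
    show "t = m" if "t \<in> Hom C (A \<diamondop> A) A \<and> (\<forall>X\<in>Obj C. \<forall>Y\<in>Obj C. t \<cdot> (i X \<star> i Y) = ?D X Y)" for t
      by (rule coend2_eq[of t A m]) (use that m in simp_all)
  qed
qed

end

section \<open>Evaluation of diagrams\<close>

context ribbon_k_category
begin

text \<open>Diagrams in which the colour \<open>c k m\<close> may vary along the \<open>k\<close>-th arc: it is constant on the
  pieces \<open>2m\<close> and \<open>2m+1\<close>, which meet in a maximum, and the minimum between the pieces \<open>2m+1\<close> and
  \<open>2m+2\<close> carries the coupon \<open>g k m\<close>. Pushing a coupon through one minimum at a time proves
  the dinaturality of the morphism represented by a diagram.\<close>

definition cobj where
  "cobj c = (\<lambda>(k, j). if even j then du (c k (j div 2)) else c k (j div 2))"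

abbreviation gobj where "gobj c w \<equiv> ten_obs C (map (cobj c) w)"

text \<open>At a minimum the coevaluation is taken in the colour that follows the turn. The coupon
  sits on the descending strand and leads from this colour to the preceding one. For odd
  \<open>j\<close> the index \<open>Suc j div 2\<close> equals \<open>Suc (j div 2)\<close>.\<close>

fun gcore where
  "gcore c g w (Crossing b a) =
     (let U = cobj c (w ! a); V = cobj c (w ! (a + 1))
      in if b then Braid C U V else minv C (Braid C V U))"
| "gcore c g w (Maximum a) =
     (let (k, j) = w ! a in if even j then Ev C (c k (j div 2)) else ev_right C (c k (j div 2)))"
| "gcore c g w (Minimum a k j b) = (let U = c k (Suc j div 2) in
     if b then (g k (j div 2) \<star> ide (du U)) \<cdot> Coev C U else (ide (du U) \<star> g k (j div 2)) \<cdot> coev_right C U)"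

definition gevent where
  "gevent c g w x = (let (a, b) = event_bounds x in
     ide (gobj c (take a w)) \<star> gcore c g w x \<star> ide (gobj c (drop b w)))"

primrec gdiag where
  "gdiag c g [] w = ide (gobj c w)"
| "gdiag c g (x # D) w = gdiag c g D (event_apply w x) \<cdot> gevent c g w x"

definition colouring where
  "colouring c g \<longleftrightarrow> (\<forall>k m. c k m \<in> Obj C \<and> g k m \<in> Hom C (c k (Suc m)) (c k m))"

end

text \<open>An event rewrites one segment of the section word. Naming this segment before and after
  the event separates the local morphism from the identities on both sides.\<close>

fun seg_in :: "section_word \<Rightarrow> diagram_event \<Rightarrow> section_word" where
  "seg_in w (Crossing b a) = [w ! a, w ! (a + 1)]"
| "seg_in w (Maximum a) = [w ! a, w ! (a + 1)]"
| "seg_in w (Minimum a k j b) = []"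

fun seg_out :: "section_word \<Rightarrow> diagram_event \<Rightarrow> section_word" where
  "seg_out w (Crossing b a) = [w ! (a + 1), w ! a]"
| "seg_out w (Maximum a) = []"
| "seg_out w (Minimum a k j b) = (if b then [(k, j), (k, j + 1)] else [(k, j + 1), (k, j)])"

lemma take_two_drop: "a + 1 < length w \<Longrightarrow> w = take a w @ [w ! a, w ! (a + 1)] @ drop (a + 2) w"
  using id_take_nth_drop[of a w] Cons_nth_drop_Suc[of "a + 1" w] by simp

lemma event_split:
  assumes "event_ok w x" "event_bounds x = (a, b)"
  shows "w = take a w @ seg_in w x @ drop b w" "event_apply w x = take a w @ seg_out w x @ drop b w"
  using assms take_two_drop by (cases x; auto)+

text \<open>Minima are the only events that bring new pieces into a section; this bounds the pieces
  that occur in a diagram.\<close>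

fun event_pieces :: "diagram_event \<Rightarrow> (nat \<times> nat) set" where
  "event_pieces (Minimum a k j b) = {(k, j), (k, j + 1)}"
| "event_pieces _ = {}"

lemma event_apply_pieces:
  assumes "event_ok w x" shows "set (event_apply w x) \<subseteq> set w \<union> event_pieces x"
  using assms by (cases x) (auto dest: in_set_takeD in_set_dropD)

context ribbon_k_category
begin

section \<open>Typing and locality of coloured diagrams\<close>

lemma cobj_obj [simp]: "colouring c g \<Longrightarrow> cobj c p \<in> Obj C"
  by (cases p) (simp add: cobj_def colouring_def)

lemma gobj_obj [simp]: "colouring c g \<Longrightarrow> gobj c w \<in> Obj C"
  by (rule ten_obs_obj) (auto intro: cobj_obj)

lemma gobj_append: "colouring c g \<Longrightarrow> gobj c (u @ v) = gobj c u \<diamondop> gobj c v"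
  using ten_obs_append[of "map (cobj c) u" "map (cobj c) v"] cobj_obj[of c g] by (simp add: image_subset_iff)

lemma gcore_hom:
  assumes c: "colouring c g" and ok: "event_ok w x"
  shows "gcore c g w x \<in> Hom C (gobj c (seg_in w x)) (gobj c (seg_out w x))"
proof (cases x)
  case (Crossing b a)
  have [simp]: "cobj c p \<in> Obj C" for p using c by simp
  show ?thesis using Crossing by (simp add: Hom_iff Let_def)
next
  case (Maximum a)
  have [simp]: "c k m \<in> Obj C" for k m using c by (simp add: colouring_def)
  show ?thesis using Maximum ok by (auto simp: Hom_iff cobj_def)
next
  case (Minimum a k j b)
  have [simp]: "c k m \<in> Obj C" for k m using c by (simp add: colouring_def)
  have [simp]: "g k m \<in> Mor C" "Dom C (g k m) = c k (Suc m)" "Cod C (g k m) = c k m" for k m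
    using c by (auto simp: colouring_def Hom_iff)
  have "odd j" using Minimum ok by simp
  then have "Suc j div 2 = Suc (j div 2)" by presburger
  with Minimum \<open>odd j\<close> show ?thesis by (simp add: Hom_iff cobj_def Let_def)
qed

lemma gevent_hom:
  assumes c: "colouring c g" and ok: "event_ok w x"
  shows "gevent c g w x \<in> Hom C (gobj c w) (gobj c (event_apply w x))"
proof -
  obtain a b where ab: "event_bounds x = (a, b)" by force
  note [simp] = HomD[OF gcore_hom[OF assms]] gobj_obj[OF c]
  have "gobj c w = gobj c (take a w) \<diamondop> gobj c (seg_in w x) \<diamondop> gobj c (drop b w)"
    by (subst event_split(1)[OF ok ab]) (simp only: gobj_append[OF c])
  moreover have "gobj c (event_apply w x) = gobj c (take a w) \<diamondop> gobj c (seg_out w x) \<diamondop> gobj c (drop b w)"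
    by (subst event_split(2)[OF ok ab]) (simp only: gobj_append[OF c])
  ultimately show ?thesis by (simp add: gevent_def ab Hom_iff)
qed

lemma gdiag_hom:
  assumes c: "colouring c g" shows "diagram_ok w D \<Longrightarrow> gdiag c g D w \<in> Hom C (gobj c w) \<I>"
proof (induction D arbitrary: w)
  case (Cons x D)
  then show ?case using cmp_hom[OF gevent_hom[OF c]] by simp
qed (simp add: Hom_iff)

text \<open>A diagram sees the colours of finitely many pieces only. This allows a recolouring
  process indexed by all natural numbers to be stopped.\<close>

lemma gdiag_cong:
  assumes "colouring c g" "colouring c' g'" "diagram_ok w D"
    and "\<And>k j. (k, j) \<in> set w \<union> (\<Union>x\<in>set D. event_pieces x) \<Longrightarrow> c k (j div 2) = c' k (j div 2)"
    and "\<And>a k j b. Minimum a k j b \<in> set D \<Longrightarrow> g k (j div 2) = g' k (j div 2)"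
  shows "gdiag c g D w = gdiag c' g' D w"
  using assms(3-)
proof (induction D arbitrary: w)
  case Nil
  then show ?case by simp
next
  case (Cons x D)
  have P: "c k (j div 2) = c' k (j div 2)" if "(k, j) \<in> set w \<union> event_pieces x" for k j
    using Cons.prems(2) that by auto
  have o: "cobj c p = cobj c' p" if "p \<in> set w \<union> event_pieces x" for p
    using P[of "fst p" "snd p"] that by (cases p) (simp add: cobj_def)
  obtain a b where ab: "event_bounds x = (a, b)" by force
  have ml: "map (cobj c) (take a w) = map (cobj c') (take a w)" "map (cobj c) (drop b w) = map (cobj c') (drop b w)"
    using o set_take_subset[of a w] set_drop_subset[of b w] by auto
  have "gcore c g w x = gcore c' g' w x"
  proof (cases x)
    case (Crossing d e)
    then show ?thesis using Cons.prems(1) o[of "w ! e"] o[of "w ! (e + 1)"] by (simp add: Let_def)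
  next
    case (Maximum e)
    then show ?thesis using Cons.prems(1) P[of "fst (w ! e)" "snd (w ! e)"] by (auto split: prod.splits)
  next
    case (Minimum e k j d)
    then show ?thesis using P[of k "j + 1"] Cons.prems(3)[of e k j d] by (simp add: Let_def)
  qed
  then have "gevent c g w x = gevent c' g' w x" by (simp only: gevent_def ab ml Let_def prod.case)
  moreover have "gdiag c g D (event_apply w x) = gdiag c' g' D (event_apply w x)"
  proof (rule Cons.IH)
    show "c k (j div 2) = c' k (j div 2)"
      if "(k, j) \<in> set (event_apply w x) \<union> (\<Union>x\<in>set D. event_pieces x)" for k j
      using that Cons.prems(1,2) event_apply_pieces[of w x] by auto
    show "g k (j div 2) = g' k (j div 2)" if "Minimum a k j b \<in> set D" for a k j b
      using that Cons.prems(3)[of a k j b] by simp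
  qed (use Cons.prems in simp)
  ultimately show ?case by simp
qed

text \<open>\<open>mobj\<close> is the common source of the two sides of dinaturality: ascending
  strands have the new colour, descending strands the old one. \<open>lmix\<close> leads from it to
  the old colouring and \<open>rmix\<close> to the new one.\<close>

definition mobj where "mobj c c' = (\<lambda>(k, j). if even j then du (c' k (j div 2)) else c k (j div 2))"
definition lmix where "lmix c f = (\<lambda>(k, j). if even j then dual_mor C (f k (j div 2)) else ide (c k (j div 2)))"
definition rmix where "rmix c' f = (\<lambda>(k, j). if even j then ide (du (c' k (j div 2))) else f k (j div 2))"

text \<open>A minimum involves its two neighbouring colours in opposite variances, so \<open>f\<close> can be pushed
  through it only if one of the two components of \<open>f\<close> concerned is an identity.\<close>

definition coupon_move where
  "coupon_move c g c' g' f \<longleftrightarrow> colouring c g \<and> colouring c' g' \<and>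
     (\<forall>k m. f k m \<in> Hom C (c k m) (c' k m) \<and> f k m \<cdot> g k m = g' k m \<cdot> f k (Suc m) \<and>
        (c k m = c' k m \<and> f k m = ide (c k m) \<or> c k (Suc m) = c' k (Suc m) \<and> f k (Suc m) = ide (c k (Suc m))))"

lemma coupon_moveD:
  assumes "coupon_move c g c' g' f"
  shows "c k m \<in> Obj C" "c' k m \<in> Obj C" "f k m \<in> Mor C" "Dom C (f k m) = c k m" "Cod C (f k m) = c' k m"
    "g k m \<in> Mor C" "Dom C (g k m) = c k (Suc m)" "Cod C (g k m) = c k m"
    "g' k m \<in> Mor C" "Dom C (g' k m) = c' k (Suc m)" "Cod C (g' k m) = c' k m"
  using assms by (auto simp: coupon_move_def colouring_def Hom_iff)

lemma mix_ty:
  assumes "coupon_move c g c' g' f"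
  shows "mobj c c' p \<in> Obj C" "lmix c f p \<in> Mor C" "Dom C (lmix c f p) = mobj c c' p" "Cod C (lmix c f p) = cobj c p"
    "rmix c' f p \<in> Mor C" "Dom C (rmix c' f p) = mobj c c' p" "Cod C (rmix c' f p) = cobj c' p"
  using coupon_moveD[OF assms] by (auto simp: mobj_def lmix_def rmix_def cobj_def split: prod.splits)

lemma mixes_ty:
  assumes m: "coupon_move c g c' g' f"
  defines "M \<equiv> \<lambda>w. ten_obs C (map (mobj c c') w)" and "L \<equiv> \<lambda>w. ten_mors C (map (lmix c f) w)"
    and "R \<equiv> \<lambda>w. ten_mors C (map (rmix c' f) w)"
  shows "M w \<in> Obj C" "L w \<in> Mor C" "Dom C (L w) = M w" "Cod C (L w) = gobj c w"
    "R w \<in> Mor C" "Dom C (R w) = M w" "Cod C (R w) = gobj c' w"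
    "M (u @ v) = M u \<diamondop> M v" "L (u @ v) = L u \<star> L v" "R (u @ v) = R u \<star> R v"
proof -
  have s: "mobj c c' ` S \<subseteq> Obj C" "lmix c f ` S \<subseteq> Mor C" "rmix c' f ` S \<subseteq> Mor C" for S
    using mix_ty[OF m] by auto
  have e: "map (Dom C \<circ> lmix c f) w = map (mobj c c') w" "map (Cod C \<circ> lmix c f) w = map (cobj c) w"
    "map (Dom C \<circ> rmix c' f) w = map (mobj c c') w" "map (Cod C \<circ> rmix c' f) w = map (cobj c') w"
    using mix_ty[OF m] by auto
  show "M w \<in> Obj C" "L w \<in> Mor C" "Dom C (L w) = M w" "Cod C (L w) = gobj c w"
    "R w \<in> Mor C" "Dom C (R w) = M w" "Cod C (R w) = gobj c' w"
    by (simp_all add: M_def L_def R_def s e)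
  show "M (u @ v) = M u \<diamondop> M v" "L (u @ v) = L u \<star> L v" "R (u @ v) = R u \<star> R v"
    by (simp_all add: M_def L_def R_def s ten_obs_append ten_mors_append)
qed

text \<open>The two colourings of an event are compared through a morphism \<kappa> between mixed
  sections. Having the same \<kappa> in both equations is what allows the comparison to be iterated
  over the events.\<close>

lemma gcore_mix:
  assumes m: "coupon_move c g c' g' f" and ok: "event_ok w x"
  defines "M \<equiv> \<lambda>w. ten_obs C (map (mobj c c') w)" and "L \<equiv> \<lambda>w. ten_mors C (map (lmix c f) w)"
    and "R \<equiv> \<lambda>w. ten_mors C (map (rmix c' f) w)"
  shows "\<exists>\<kappa>\<in>Hom C (M (seg_in w x)) (M (seg_out w x)).
     gcore c g w x \<cdot> L (seg_in w x) = L (seg_out w x) \<cdot> \<kappa> \<and>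
     gcore c' g' w x \<cdot> R (seg_in w x) = R (seg_out w x) \<cdot> \<kappa>"
proof -
  note [simp] = coupon_moveD[OF m] mix_ty[OF m]
  show ?thesis
  proof (cases x)
    case (Crossing b a)
    let ?p = "w ! a" and ?q = "w ! (a + 1)"
    have [simp]: "cobj c p \<in> Obj C" "cobj c' p \<in> Obj C" for p using m by (auto simp: coupon_move_def)
    let ?\<kappa> = "if b then Braid C (mobj c c' ?p) (mobj c c' ?q) else minv C (Braid C (mobj c c' ?q) (mobj c c' ?p))"
    show ?thesis
      by (rule bexI[of _ ?\<kappa>]) (simp_all add: Crossing M_def L_def R_def Hom_iff Let_def braid_nat braid_inv_nat)
  next
    case (Maximum a)
    from ok Maximum obtain k j where j: "even j"
      "w ! a = (k, j) \<and> w ! Suc a = (k, Suc j) \<or> w ! a = (k, Suc j) \<and> w ! Suc a = (k, j)"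
      by auto
    let ?m = "j div 2"
    have f: "f k ?m \<in> Hom C (c k ?m) (c' k ?m)" by (simp add: Hom_iff)
    have 1: "Ev C (c k ?m) \<cdot> (dual_mor C (f k ?m) \<star> ide (c k ?m)) = Ev C (c' k ?m) \<cdot> (ide (du (c' k ?m)) \<star> f k ?m)"
      by (rule ev_dual[OF f])
    have 2: "ev_right C (c k ?m) \<cdot> (ide (c k ?m) \<star> dual_mor C (f k ?m)) = ev_right C (c' k ?m) \<cdot> (f k ?m \<star> ide (du (c' k ?m)))"
      using ev_right_dual[OF f] by simp
    \<comment> \<open>Nothing leaves a maximum, so the composite itself serves as \<kappa>; the
      second equation is then the dinaturality of the evaluation.\<close>
    show ?thesis
      using j
      by (intro bexI[of _ "gcore c g w x \<cdot> L (seg_in w x)"])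
        (auto simp: Maximum M_def L_def R_def Hom_iff lmix_def rmix_def mobj_def 1 2)
  next
    case (Minimum a k j b)
    have "odd j" using Minimum ok by simp
    then have j: "Suc j div 2 = Suc (j div 2)" by presburger
    let ?m = "j div 2"
    let ?m' = "Suc ?m"
    have f: "f k ?m' \<in> Hom C (c k ?m') (c' k ?m')" by (simp add: Hom_iff)
    have fg: "f k ?m \<cdot> g k ?m = g' k ?m \<cdot> f k ?m'" using m by (simp add: coupon_move_def)
    have "c k ?m = c' k ?m \<and> f k ?m = ide (c k ?m) \<or> c k ?m' = c' k ?m' \<and> f k ?m' = ide (c k ?m')"
      using m by (simp add: coupon_move_def)
    then show ?thesis
    proof
      \<comment> \<open>The colour before the turn is unchanged. The new event serves as \<kappa>,
        and the old one is recovered by moving \<open>f\<close> across the coevaluation.\<close>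
      assume 1: "c k ?m = c' k ?m \<and> f k ?m = ide (c k ?m)"
      then have g: "g k ?m = g' k ?m \<cdot> f k ?m'" using fg by simp
      show ?thesis
      proof (cases b)
        case True
        have "(ide (c' k ?m) \<star> dual_mor C (f k ?m')) \<cdot> (g' k ?m \<star> ide (du (c' k ?m'))) \<cdot> Coev C (c' k ?m')
            = (g' k ?m \<star> ide (du (c k ?m'))) \<cdot> (ide (c' k ?m') \<star> dual_mor C (f k ?m')) \<cdot> Coev C (c' k ?m')"
          by (simp add: fuse_cmp)
        also have "\<dots> = (g k ?m \<star> ide (du (c k ?m'))) \<cdot> Coev C (c k ?m')"
          unfolding coev_dual[OF f, symmetric] g by (simp add: fuse_cmp)
        finally show ?thesis using 1 True \<open>odd j\<close>
          by (intro bexI[of _ "gcore c' g' w x"])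
            (simp_all add: Minimum M_def L_def R_def Hom_iff lmix_def rmix_def mobj_def j Let_def)
      next
        case False
        have "(dual_mor C (f k ?m') \<star> ide (c' k ?m)) \<cdot> (ide (du (c' k ?m')) \<star> g' k ?m) \<cdot> coev_right C (c' k ?m')
            = (ide (du (c k ?m')) \<star> g' k ?m) \<cdot> (dual_mor C (f k ?m') \<star> ide (c' k ?m')) \<cdot> coev_right C (c' k ?m')"
          by (simp add: fuse_cmp)
        also have "\<dots> = (ide (du (c k ?m')) \<star> g k ?m) \<cdot> coev_right C (c k ?m')"
          unfolding coev_right_dual[OF f, symmetric] g by (simp add: fuse_cmp)
        finally show ?thesis using 1 False \<open>odd j\<close>
          by (intro bexI[of _ "gcore c' g' w x"])
            (simp_all add: Minimum M_def L_def R_def Hom_iff lmix_def rmix_def mobj_def j Let_def)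
      qed
    next
      \<comment> \<open>The colour after the turn is unchanged. The old event serves as \<kappa>,
        and the new one arises by composing the coupon with \<open>f\<close>.\<close>
      assume 1: "c k ?m' = c' k ?m' \<and> f k ?m' = ide (c k ?m')"
      then have g: "g' k ?m = f k ?m \<cdot> g k ?m" using fg by simp
      have 2: "c k (Suc j div 2) = c' k ?m'" using 1 j by simp
      show ?thesis using 1 \<open>odd j\<close>
        by (intro bexI[of _ "gcore c g w x"])
          (auto simp: Minimum M_def L_def R_def Hom_iff lmix_def rmix_def mobj_def j 2 Let_def g fuse_cmp)
    qed
  qed
qed

text \<open>Each event is exchanged with the mixing morphisms through its \<kappa>, up to the empty
  top section, where these morphisms are trivial.\<close>

lemma gdiag_mix:
  assumes m: "coupon_move c g c' g' f"
  shows "diagram_ok w D \<Longrightarrow>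
    gdiag c g D w \<cdot> ten_mors C (map (lmix c f) w) = gdiag c' g' D w \<cdot> ten_mors C (map (rmix c' f) w)"
proof (induction D arbitrary: w)
  case (Cons x D)
  have cc: "colouring c g" "colouring c' g'" using m by (auto simp: coupon_move_def)
  have ok: "event_ok w x" and ok': "diagram_ok (event_apply w x) D" using Cons.prems by auto
  obtain a b where ab: "event_bounds x = (a, b)" by force
  let ?u = "take a w" and ?v = "drop b w" and ?s = "seg_in w x" and ?t = "seg_out w x"
  let ?L = "\<lambda>w. ten_mors C (map (lmix c f) w)" and ?R = "\<lambda>w. ten_mors C (map (rmix c' f) w)"
  let ?M = "\<lambda>w. ten_obs C (map (mobj c c') w)"
  obtain \<kappa> where \<kappa>: "\<kappa> \<in> Hom C (?M ?s) (?M ?t)"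
    "gcore c g w x \<cdot> ?L ?s = ?L ?t \<cdot> \<kappa>" "gcore c' g' w x \<cdot> ?R ?s = ?R ?t \<cdot> \<kappa>"
    using gcore_mix[OF m ok] by blast
  note [simp] = HomD[OF \<kappa>(1)] mixes_ty(1-7)[OF m] gobj_obj[OF cc(1)] gobj_obj[OF cc(2)]
    HomD(1-3)[OF gcore_hom[OF cc(1) ok]] HomD(1-3)[OF gcore_hom[OF cc(2) ok]]
    HomD(1-3)[OF gdiag_hom[OF cc(1) ok']] HomD(1-3)[OF gdiag_hom[OF cc(2) ok']]
    HomD(1-3)[OF gevent_hom[OF cc(1) ok]] HomD(1-3)[OF gevent_hom[OF cc(2) ok]]
  let ?K = "ide (?M ?u) \<star> \<kappa> \<star> ide (?M ?v)"
  have w: "w = ?u @ ?s @ ?v" and w': "event_apply w x = ?u @ ?t @ ?v" using event_split[OF ok ab] by auto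
  have Lw: "?L w = ?L ?u \<star> ?L ?s \<star> ?L ?v" "?R w = ?R ?u \<star> ?R ?s \<star> ?R ?v"
    by (subst w, simp only: mixes_ty(8-10)[OF m])+
  have Lw': "?L (event_apply w x) = ?L ?u \<star> ?L ?t \<star> ?L ?v" "?R (event_apply w x) = ?R ?u \<star> ?R ?t \<star> ?R ?v"
    by (subst w', simp only: mixes_ty(8-10)[OF m])+
  have L: "gevent c g w x \<cdot> ?L w = ?L (event_apply w x) \<cdot> ?K"
    unfolding Lw Lw' by (simp add: gevent_def ab fuse \<kappa>(2))
  have R: "gevent c' g' w x \<cdot> ?R w = ?R (event_apply w x) \<cdot> ?K"
    unfolding Lw Lw' by (simp add: gevent_def ab fuse \<kappa>(3))
  have K: "?K \<in> Mor C" "Cod C ?K = ?M (event_apply w x)"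
    by (simp_all add: w' mixes_ty(8)[OF m] del: map_append)
  have "gdiag c g (x # D) w \<cdot> ?L w = (gdiag c g D (event_apply w x) \<cdot> ?L (event_apply w x)) \<cdot> ?K"
    using K by (simp add: L)
  also have "\<dots> = (gdiag c' g' D (event_apply w x) \<cdot> ?R (event_apply w x)) \<cdot> ?K"
    using Cons.IH[OF ok'] by simp
  also have "\<dots> = gdiag c' g' (x # D) w \<cdot> ?R w"
    using K by (simp add: R)
  finally show ?case .
qed simp

end

context ribbon_k_category
begin

subsection \<open>Dinaturality of diagrams\<close>

lemma strand_obj_cobj: "strand_obj C X = cobj (\<lambda>k m. X k)"
  by (auto simp: strand_obj_def cobj_def fun_eq_iff)

lemma diagram_mor_gdiag:
  assumes "\<And>k. X k \<in> Obj C" "diagram_ok w D"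
  shows "diagram_mor C X D w = gdiag (\<lambda>k m. X k) (\<lambda>k m. ide (X k)) D w"
  using assms(2)
proof (induction D arbitrary: w)
  case (Cons x D)
  have [simp]: "X k \<in> Obj C" for k using assms by simp
  have "event_core C X w x = gcore (\<lambda>k m. X k) (\<lambda>k m. ide (X k)) w x"
    by (cases x) (simp_all add: strand_obj_cobj Let_def split: prod.split)
  then show ?case using Cons by (simp add: event_mor_def gevent_def section_obj_def strand_obj_cobj)
qed (simp add: section_obj_def strand_obj_cobj)

lemma colouring_const: "(\<And>k. X k \<in> Obj C) \<Longrightarrow> colouring (\<lambda>k m. X k) (\<lambda>k m. ide (X k))"
  by (simp add: colouring_def Hom_iff)

lemma finite_event_pieces [simp]: "finite (event_pieces x)"
  by (cases x) auto

text \<open>The hypothesis on \<open>w\<close> is what is used of a bottom word: its ascending pieces are first pieces.\<close>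

lemma diagram_dinat:
  assumes ok: "diagram_ok w D" and w: "\<And>k j. (k, j) \<in> set w \<Longrightarrow> even j \<Longrightarrow> j = 0"
    and f: "\<And>k. f k \<in> Hom C (X k) (Y k)"
  shows "diagram_mor C X D w \<cdot> ten_mors C (map (\<lambda>(k, j). if even j then dual_mor C (f k) else ide (X k)) w)
    = diagram_mor C Y D w \<cdot> ten_mors C (map (\<lambda>(k, j). if even j then ide (du (Y k)) else f k) w)"
proof -
  note [simp] = HomD[OF f]
  \<comment> \<open>At stage \<open>s\<close> the first \<open>s\<close> colours of every arc are
    already \<open>Y\<close>, and the coupon waits where they end, at the minimum between the pieces
    \<open>2s-1\<close> and \<open>2s\<close>. The move \<open>h s\<close> takes it over the maximum
    of the pieces \<open>2s\<close> and \<open>2s+1\<close>.\<close>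
  define c where "c s k m = (if m < s then Y k else X k)" for s k m :: nat
  define g where "g s k m = (if Suc m = s then f k else ide (c s k m))" for s k m :: nat
  define h where "h s k m = (if m = s then f k else ide (c s k m))" for s k m :: nat
  have cm: "coupon_move (c s) (g s) (c (Suc s)) (g (Suc s)) (h s)" for s
    by (auto simp: coupon_move_def colouring_def c_def g_def h_def Hom_iff)
  \<comment> \<open>The part that has already come out at the bottom: \<open>f\<close> on the
    descending strands whose colour index has been passed.\<close>
  define P where "P s = (\<lambda>(k, j). if even j then ide (du (Y k)) else if j div 2 < s then f k else ide (X k))" for s :: nat
  have step: "gdiag (c s) (g s) D w \<cdot> ten_mors C (map (lmix (c s) (h s)) w)
      = gdiag (c (Suc s)) (g (Suc s)) D w \<cdot> ten_mors C (map (rmix (c (Suc s)) (h s)) w)" for s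
    by (rule gdiag_mix[OF cm ok])
  have main: "gdiag (c 0) (g 0) D w \<cdot> ten_mors C (map (lmix (c 0) (h 0)) w)
      = gdiag (c (Suc s)) (g (Suc s)) D w \<cdot> ten_mors C (map (P (Suc s)) w)" for s
  proof (induction s)
    case 0
    have "rmix (c (Suc 0)) (h 0) p = P (Suc 0) p" if "p \<in> set w" for p
      using w[of "fst p" "snd p"] that by (cases p) (auto simp: rmix_def P_def c_def h_def)
    then have M: "map (rmix (c (Suc 0)) (h 0)) w = map (P (Suc 0)) w" by simp
    show ?case using step[of 0] unfolding M .
  next
    case (Suc s)
    let ?s = "Suc s"
    have cc: "colouring (c t) (g t)" for t using cm[of t] by (simp add: coupon_move_def)
    \<comment> \<open>After the initial stage nothing enters at the bottom: an ascending piece of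
      \<open>w\<close> has index 0, while the move acts at the index \<open>Suc s\<close>.\<close>
    have M: "map (lmix (c ?s) (h ?s)) w = map (\<lambda>p. ide (cobj (c ?s) p)) w"
      using w by (fastforce simp: lmix_def c_def h_def cobj_def split: if_splits)
    have L: "ten_mors C (map (lmix (c ?s) (h ?s)) w) = ide (gobj (c ?s) w)"
      unfolding M by (rule ten_mors_ide) (rule cobj_obj[OF cc])
    have R: "ten_mors C (map (rmix (c (Suc ?s)) (h ?s)) w) \<cdot> ten_mors C (map (P ?s) w) = ten_mors C (map (P (Suc ?s)) w)"
    proof -
      have p: "rmix (c (Suc ?s)) (h ?s) p \<in> Mor C \<and> P ?s p \<in> Mor C \<and> Dom C (rmix (c (Suc ?s)) (h ?s) p) = Cod C (P ?s p)
        \<and> rmix (c (Suc ?s)) (h ?s) p \<cdot> P ?s p = P (Suc ?s) p" if "p \<in> set w" for p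
      proof -
        obtain k j where p: "p = (k, j)" by (cases p)
        then have "even j \<longrightarrow> j = 0" using w that by blast
        then show ?thesis by (auto simp: p rmix_def P_def c_def h_def)
      qed
      then have "ten_mors C (map (rmix (c (Suc ?s)) (h ?s)) w) \<cdot> ten_mors C (map (P ?s) w)
        = ten_mors C (map (\<lambda>p. rmix (c (Suc ?s)) (h ?s) p \<cdot> P ?s p) w)"
        by (intro ten_mors_fuse) auto
      also have "map (\<lambda>p. rmix (c (Suc ?s)) (h ?s) p \<cdot> P ?s p) w = map (P (Suc ?s)) w"
        using p by auto
      finally show ?thesis .
    qed
    note gh = HomD(1-4)[OF gdiag_hom[OF cc ok]]
    have Pt: "set (map (P ?s) w) \<subseteq> Mor C" by (auto simp: P_def split: prod.splits)
    have "map (Cod C) (map (P ?s) w) = map (cobj (c ?s)) w"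
      using w by (fastforce simp: P_def c_def cobj_def split: prod.splits)
    then have PC: "Cod C (ten_mors C (map (P ?s) w)) = gobj (c ?s) w"
      by (simp only: ten_mors_ty[OF Pt])
    have Pm: "ten_mors C (map (P ?s) w) \<in> Mor C" using Pt by simp
    note rt = mixes_ty[OF cm[of ?s]]
    have Rt: "ten_mors C (map (rmix (c (Suc ?s)) (h ?s)) w) \<in> Mor C"
      "Cod C (ten_mors C (map (rmix (c (Suc ?s)) (h ?s)) w)) = gobj (c (Suc ?s)) w"
      using rt by simp_all
    have Rd: "Dom C (ten_mors C (map (rmix (c (Suc ?s)) (h ?s)) w)) = gobj (c ?s) w"
      using rt(3,6)[of w] unfolding L using cobj_obj[OF cc] gobj_obj[OF cc] by simp
    have "gdiag (c ?s) (g ?s) D w \<cdot> ten_mors C (map (P ?s) w)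
        = (gdiag (c (Suc ?s)) (g (Suc ?s)) D w \<cdot> ten_mors C (map (rmix (c (Suc ?s)) (h ?s)) w)) \<cdot> ten_mors C (map (P ?s) w)"
      using step[of ?s] gh[of ?s] unfolding L by simp
    also have "\<dots> = gdiag (c (Suc ?s)) (g (Suc ?s)) D w \<cdot> ten_mors C (map (rmix (c (Suc ?s)) (h ?s)) w) \<cdot> ten_mors C (map (P ?s) w)"
      by (rule cmp_asc) (simp_all only: Pm PC Rt Rd gh)
    also have "\<dots> = gdiag (c (Suc ?s)) (g (Suc ?s)) D w \<cdot> ten_mors C (map (P (Suc ?s)) w)"
      by (simp only: R)
    finally show ?case using Suc by simp
  qed
  \<comment> \<open>Only pieces in \<open>S\<close> occur. At the stage \<open>Suc (Suc N)\<close>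
    all their colours are \<open>Y\<close>, and no occurring minimum still carries the
    coupon.\<close>
  define S where "S = set w \<union> (\<Union>x\<in>set D. event_pieces x)"
  have "finite S" by (simp add: S_def)
  define N where "N = Max (insert 0 (snd ` S))"
  have N: "j div 2 < Suc (Suc N)" "Suc (j div 2) < Suc (Suc N)" if "(k, j) \<in> S" for k j
  proof -
    have "j \<le> N" using that \<open>finite S\<close> by (auto simp: N_def intro!: Max_ge rev_image_eqI)
    then show "j div 2 < Suc (Suc N)" "Suc (j div 2) < Suc (Suc N)" by auto
  qed
  have N': "Suc (j div 2) \<noteq> Suc (Suc N) \<and> j div 2 < Suc (Suc N)" if "Minimum a k j b \<in> set D" for a k j b
    using N[of k j] that by (force simp: S_def)
  have "gdiag (c 0) (g 0) D w = diagram_mor C X D w"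
    unfolding diagram_mor_gdiag[of X, OF HomD(4)[OF f] ok]
    by (rule gdiag_cong[OF _ _ ok]) (use cm[of 0] in \<open>auto simp: coupon_move_def colouring_const c_def g_def\<close>)
  moreover have "gdiag (c (Suc (Suc N))) (g (Suc (Suc N))) D w = diagram_mor C Y D w"
    unfolding diagram_mor_gdiag[of Y, OF HomD(5)[OF f] ok]
  proof (rule gdiag_cong[OF _ _ ok])
    show "colouring (c (Suc (Suc N))) (g (Suc (Suc N)))" using cm by (simp add: coupon_move_def)
    show "colouring (\<lambda>k m. Y k) (\<lambda>k m. ide (Y k))" by (simp add: colouring_const)
    show "c (Suc (Suc N)) k (j div 2) = Y k" if "(k, j) \<in> set w \<union> (\<Union>x\<in>set D. event_pieces x)" for k j
      using N(1)[of k j] that by (simp add: c_def S_def)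
    show "g (Suc (Suc N)) k (j div 2) = ide (Y k)" if "Minimum a k j b \<in> set D" for a k j b
      using N'[OF that] by (simp add: c_def g_def)
  qed
  moreover have "map (lmix (c 0) (h 0)) w = map (\<lambda>(k, j). if even j then dual_mor C (f k) else ide (X k)) w"
    using w by (fastforce simp: lmix_def c_def h_def)
  moreover have "map (P (Suc (Suc N))) w = map (\<lambda>(k, j). if even j then ide (du (Y k)) else f k) w"
    using N(1) by (fastforce simp: P_def S_def)
  ultimately show ?thesis using main[of "Suc N"] by (simp only:)
qed

lemma diagram_mor_hom:
  assumes "\<And>k. X k \<in> Obj C" "diagram_ok w D"
  shows "diagram_mor C X D w \<in> Hom C (section_obj C X w) \<I>"
  using gdiag_hom[OF colouring_const[of X, OF assms(1)] assms(2)] diagram_mor_gdiag[OF assms]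
  by (simp add: section_obj_def strand_obj_cobj)

end

context ribbon_coend
begin

section \<open>From diagrams to morphisms out of tensor powers\<close>

lemma bottom_word_Suc: "bottom_word (Suc n) r = bottom_word n r @ [(n, 0), (n, r n)]"
  by (simp add: bottom_word_def)

lemma bottom_word_mem: "(k, j) \<in> set (bottom_word n r) \<longleftrightarrow> k < n \<and> (j = 0 \<or> j = r k)"
  by (auto simp: bottom_word_def)

lemma ten_mors_bottom:
  assumes "\<And>p. h p \<in> Mor C"
  shows "ten_mors C (map h (bottom_word n r)) = ten_mors C (map (\<lambda>k. h (k, 0) \<star> h (k, r k)) [0..<n])"
proof (induction n)
  case (Suc n)
  have s: "h ` S \<subseteq> Mor C" "(\<lambda>k. h (k, 0) \<star> h (k, r k)) ` T \<subseteq> Mor C" for S T using assms by auto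
  show ?case using Suc assms by (simp add: bottom_word_Suc ten_mors_append s)
qed (simp add: bottom_word_def)

lemma ten_obs_bottom:
  assumes "\<And>p. h p \<in> Obj C"
  shows "ten_obs C (map h (bottom_word n r)) = ten_obs C (map (\<lambda>k. h (k, 0) \<diamondop> h (k, r k)) [0..<n])"
proof (induction n)
  case (Suc n)
  have s: "h ` S \<subseteq> Obj C" "(\<lambda>k. h (k, 0) \<diamondop> h (k, r k)) ` T \<subseteq> Obj C" for S T using assms by auto
  show ?case using Suc assms by (simp add: bottom_word_Suc ten_obs_append s)
qed (simp add: bottom_word_def)

lemma section_obj_bottom:
  assumes "\<And>k. X k \<in> Obj C" "\<And>k. k < n \<Longrightarrow> odd (r k)"
  shows "section_obj C X (bottom_word n r) = iobs n X"
proof -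
  have "section_obj C X (bottom_word n r) = ten_obs C (map (\<lambda>k. strand_obj C X (k, 0) \<diamondop> strand_obj C X (k, r k)) [0..<n])"
    unfolding section_obj_def using assms(1) by (intro ten_obs_bottom) (simp add: strand_obj_def split: prod.split)
  also have "\<dots> = iobs n X"
    using assms by (intro arg_cong[of _ _ "ten_obs C"]) (simp add: strand_obj_def)
  finally show ?thesis .
qed

text \<open>Dinaturality of the diagram is regrouped arc by arc. The last piece of an arc is odd, so
  at the bottom each arc contributes a dual strand followed by the strand of its colour, which is
  the source of \<open>i\<close>.\<close>

lemma diagram_phi_ex:
  assumes ok: "diagram_ok (bottom_word n r) D" and r: "\<And>k. k < n \<Longrightarrow> odd (r k)"
  shows "\<exists>\<phi>\<in>Hom C (Apow n) \<I>. \<forall>X. (\<forall>k. X k \<in> Obj C) \<longrightarrow> diagram_mor C X D (bottom_word n r) = \<phi> \<cdot> imors n X"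
proof -
  let ?F = "\<lambda>X. diagram_mor C X D (bottom_word n r)"
  have "\<exists>\<psi>\<in>Hom C (Apow n \<diamondop> \<I>) \<I>. \<forall>X. (\<forall>k. X k \<in> Obj C) \<longrightarrow> \<psi> \<cdot> (imors n X \<star> ide \<I>) = ?F X"
  proof (rule coend_pow_ex)
    fix X assume X: "\<And>k::nat. X k \<in> Obj C"
    show "?F X \<in> Hom C (iobs n X \<diamondop> \<I>) \<I>"
      using diagram_mor_hom[of X, OF X ok] section_obj_bottom[of X n r, OF X r] iobs_obj[of X, OF X] by simp
  next
    fix X Y f assume f: "\<And>k::nat. f k \<in> Hom C (X k) (Y k)"
    note [simp] = HomD[OF f]
    let ?l = "\<lambda>(k, j). if even j then dual_mor C (f k) else ide (X k)"
    let ?r = "\<lambda>(k, j). if even j then ide (du (Y k)) else f k"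
    have l: "ten_mors C (map ?l (bottom_word n r)) = ldin n X f"
      by (subst ten_mors_bottom) (use r in \<open>auto intro!: arg_cong[of _ _ "ten_mors C"]\<close>)
    have r: "ten_mors C (map ?r (bottom_word n r)) = rdin n Y f"
      by (subst ten_mors_bottom) (use r in \<open>auto intro!: arg_cong[of _ _ "ten_mors C"]\<close>)
    have m: "set (map (\<lambda>k. dual_mor C (f k) \<star> ide (X k)) [0..<n]) \<subseteq> Mor C"
      "set (map (\<lambda>k. ide (du (Y k)) \<star> f k) [0..<n]) \<subseteq> Mor C" by auto
    have "?F X \<cdot> ldin n X f = ?F Y \<cdot> rdin n Y f"
      unfolding l[symmetric] r[symmetric]
      by (rule diagram_dinat[OF ok _ f]) (use assms(2) in \<open>auto simp: bottom_word_mem\<close>)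
    then show "?F X \<cdot> (ldin n X f \<star> ide \<I>) = ?F Y \<cdot> (rdin n Y f \<star> ide \<I>)"
      using ten_mors_ty(1)[OF m(1)] ten_mors_ty(1)[OF m(2)] by simp
  qed simp_all
  then obtain \<psi> where \<psi>: "\<psi> \<in> Hom C (Apow n) \<I>"
    "\<And>X. (\<And>k. X k \<in> Obj C) \<Longrightarrow> \<psi> \<cdot> (imors n X \<star> ide \<I>) = ?F X" by auto
  show ?thesis
  proof (intro bexI[of _ \<psi>] allI impI)
    fix X assume X: "\<forall>k::nat. X k \<in> Obj C"
    then show "?F X = \<psi> \<cdot> imors n X" using \<psi>(2)[of X] imors_ty(1)[of X n] by simp
  qed (rule \<psi>(1))
qed

lemma phi_unique:
  assumes "g \<in> Hom C (Apow n) \<I>" "h \<in> Hom C (Apow n) \<I>"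
    and "\<And>X. (\<And>k. X k \<in> Obj C) \<Longrightarrow> g \<cdot> imors n X = h \<cdot> imors n X"
  shows "g = h"
proof (rule coend_pow_eq[of g n \<I> \<I>])
  show "g \<cdot> (imors n X \<star> ide \<I>) = h \<cdot> (imors n X \<star> ide \<I>)" if "\<And>k. X k \<in> Obj C" for X
    using assms(3)[of X] imors_ty(1)[of X n] that by simp
qed (use assms in simp_all)

end

section \<open>Coends of semisimple categories\<close>

context ribbon_k_category
begin

section \<open>Direct sums and Schur's lemma\<close>

lemma direct_sumD:
  assumes "is_direct_sum C I Y X p q"
  shows "finite I" "X \<in> Obj C" "a \<in> I \<Longrightarrow> Y a \<in> Obj C" "a \<in> I \<Longrightarrow> p a \<in> Hom C X (Y a)"
    "a \<in> I \<Longrightarrow> q a \<in> Hom C (Y a) X" "a \<in> I \<Longrightarrow> b \<in> I \<Longrightarrow> p a \<cdot> q b = (if a = b then ide (Y a) else Zer C (Y b) (Y a))"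
    "msum C X X (\<lambda>a. q a \<cdot> p a) I = ide X"
  using assms by (simp_all add: is_direct_sum_def)

lemma direct_sum_additive:
  assumes ds: "is_direct_sum C I Y X p q"
    and F: "\<And>u v. u \<in> Hom C X X \<Longrightarrow> v \<in> Hom C X X \<Longrightarrow> F (Add C u v) = Add C (F u) (F v)"
    and "\<And>u. u \<in> Hom C X X \<Longrightarrow> F u \<in> Hom C X' Y'" and "F (Zer C X X) = Zer C X' Y'"
    and "X' \<in> Obj C" "Y' \<in> Obj C"
  shows "F (ide X) = msum C X' Y' (\<lambda>a. F (q a \<cdot> p a)) I"
proof -
  note d = direct_sumD[OF ds]
  have "q a \<cdot> p a \<in> Hom C X X" if "a \<in> I" for a using cmp_hom[OF d(4,5)] that by simp
  then show ?thesis
    using msum_additive[of I "\<lambda>a. q a \<cdot> p a" X X F X' Y'] d(1,2,7) assms by simp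
qed

text \<open>The identity of \<open>X\<close> is expanded between the spectators as the sum of the
  \<open>q a \<cdot> p a\<close>, so the injections remain jointly epic after tensoring on both
  sides.\<close>

lemma direct_sum_eq:
  assumes ds: "is_direct_sum C I Y X p q" and g: "g \<in> Hom C (W \<diamondop> X \<diamondop> V) Z" and h: "h \<in> Hom C (W \<diamondop> X \<diamondop> V) Z"
    and [simp]: "W \<in> Obj C" "V \<in> Obj C"
    and eq: "\<And>a. a \<in> I \<Longrightarrow> g \<cdot> (ide W \<star> q a \<star> ide V) = h \<cdot> (ide W \<star> q a \<star> ide V)"
  shows "g = h"
proof -
  note d = direct_sumD[OF ds]
  note [simp] = HomD[OF g] HomD[OF h] d(1,2)
  have *: "u = msum C (W \<diamondop> X \<diamondop> V) Z (\<lambda>a. (u \<cdot> (ide W \<star> q a \<star> ide V)) \<cdot> (ide W \<star> p a \<star> ide V)) I"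
    if u: "u \<in> Hom C (W \<diamondop> X \<diamondop> V) Z" for u
  proof -
    note [simp] = HomD[OF u]
    have "u = u \<cdot> (ide W \<star> ide X \<star> ide V)" by simp
    also have "\<dots> = msum C (W \<diamondop> X \<diamondop> V) Z (\<lambda>a. u \<cdot> (ide W \<star> (q a \<cdot> p a) \<star> ide V)) I"
      by (rule direct_sum_additive[OF ds, of "\<lambda>v. u \<cdot> (ide W \<star> v \<star> ide V)"])
        (auto simp: Hom_iff cmp_Add ten_Add)
    also have "\<dots> = msum C (W \<diamondop> X \<diamondop> V) Z (\<lambda>a. (u \<cdot> (ide W \<star> q a \<star> ide V)) \<cdot> (ide W \<star> p a \<star> ide V)) I"
    proof (rule msum_cong)
      fix a assume a: "a \<in> I"
      note [simp] = HomD[OF d(4)[OF a]] HomD[OF d(5)[OF a]]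
      show "u \<cdot> (ide W \<star> (q a \<cdot> p a) \<star> ide V) \<in> Hom C (W \<diamondop> X \<diamondop> V) Z" by (simp add: Hom_iff)
      show "u \<cdot> (ide W \<star> (q a \<cdot> p a) \<star> ide V) = (u \<cdot> (ide W \<star> q a \<star> ide V)) \<cdot> (ide W \<star> p a \<star> ide V)"
        by (simp add: fuse)
    qed simp_all
    finally show ?thesis .
  qed
  have "msum C (W \<diamondop> X \<diamondop> V) Z (\<lambda>a. (g \<cdot> (ide W \<star> q a \<star> ide V)) \<cdot> (ide W \<star> p a \<star> ide V)) I
      = msum C (W \<diamondop> X \<diamondop> V) Z (\<lambda>a. (h \<cdot> (ide W \<star> q a \<star> ide V)) \<cdot> (ide W \<star> p a \<star> ide V)) I"
  proof (rule msum_cong)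
    fix a assume a: "a \<in> I"
    note [simp] = HomD[OF d(4)[OF a]] HomD[OF d(5)[OF a]]
    show "(g \<cdot> (ide W \<star> q a \<star> ide V)) \<cdot> (ide W \<star> p a \<star> ide V) \<in> Hom C (W \<diamondop> X \<diamondop> V) Z" by (simp add: Hom_iff)
    show "(g \<cdot> (ide W \<star> q a \<star> ide V)) \<cdot> (ide W \<star> p a \<star> ide V) = (h \<cdot> (ide W \<star> q a \<star> ide V)) \<cdot> (ide W \<star> p a \<star> ide V)"
      by (simp only: eq[OF a])
  qed simp_all
  then show ?thesis using *[OF g] *[OF h] by simp
qed

lemma zero_objectD:
  assumes "zero_object C Z" "X \<in> Obj C"
  shows "f \<in> Hom C X Z \<Longrightarrow> f = Zer C X Z" "f \<in> Hom C Z X \<Longrightarrow> f = Zer C Z X"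
  using assms Zer_hom[of X Z] Zer_hom[of Z X] unfolding zero_object_def by metis+

text \<open>Simplicity is a condition on monomorphisms into an object. The kernel of
  \<open>f\<close> is monic, hence has zero source or is invertible; the latter would make
  \<open>f\<close> zero. A zero kernel in turn makes \<open>f\<close> monic, and simplicity of
  \<open>Y\<close> applies.\<close>

lemma schur:
  assumes ab: "abelian_category C" and X: "simple_object C X" and Y: "simple_object C Y"
    and f: "f \<in> Hom C X Y" and nz: "f \<noteq> Zer C X Y"
  shows "iso_mor C f"
proof -
  note [simp] = HomD[OF f]
  obtain k where k: "is_kernel C k f" using ab HomD(1)[OF f] unfolding abelian_category_def by blast
  obtain Q where Q: "Dom C k = Q" by simp
  have K: "k \<in> Mor C" "Cod C k = Dom C f" "f \<cdot> k = Zer C Q (Cod C f)"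
    "\<And>W g. g \<in> Hom C W (Dom C f) \<Longrightarrow> f \<cdot> g = Zer C W (Cod C f) \<Longrightarrow> \<exists>!u. u \<in> Hom C W Q \<and> k \<cdot> u = g"
    using k unfolding is_kernel_def Q by blast+
  have kh: "k \<in> Hom C Q X" using K(1,2) Q by (simp add: Hom_iff)
  note [simp] = HomD[OF kh]
  have fk: "f \<cdot> k = Zer C Q Y" using K(3) by simp
  have fac: "\<exists>!u. u \<in> Hom C W Q \<and> k \<cdot> u = g" if "g \<in> Hom C W X" "f \<cdot> g = Zer C W Y" for g W
    using K(4)[of g W] that by simp
  have "monic C k"
    unfolding monic_def
  proof (intro conjI allI ballI impI)
    fix W g h assume "g \<in> Hom C W (Dom C k)" "h \<in> Hom C W (Dom C k)" and e: "k \<cdot> g = k \<cdot> h"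
    then have g: "g \<in> Hom C W Q" and h: "h \<in> Hom C W Q" by (simp_all only: Q)
    note [simp] = HomD[OF g]
    have "f \<cdot> k \<cdot> g = (f \<cdot> k) \<cdot> g" by simp
    then have "f \<cdot> k \<cdot> g = Zer C W Y" unfolding fk by simp
    then show "g = h" using fac[OF cmp_hom[OF g kh]] g h e by metis
  qed (rule K(1))
  then have "zero_object C Q \<or> iso_mor C k" using X K(2) Q HomD(2)[OF f] unfolding simple_object_def by metis
  then have K0: "zero_object C Q"
  proof
    assume i: "iso_mor C k"
    have "f = (f \<cdot> k) \<cdot> minv C k" using i by simp
    then have "f = Zer C X Y" unfolding fk using i by simp
    then show ?thesis using nz by simp
  qed
  have "monic C f"
    unfolding monic_def
  proof (intro conjI allI ballI impI)
    fix W g h assume g: "g \<in> Hom C W (Dom C f)" and h: "h \<in> Hom C W (Dom C f)" and e: "f \<cdot> g = f \<cdot> h"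
    note [simp] = HomD[OF g] HomD[OF h]
    have gh: "g \<in> Hom C W X" "h \<in> Hom C W X" using g h by simp_all
    have "f \<cdot> msub C g h = Zer C W Y" by (simp add: cmp_msub e msub_self)
    then obtain u where u: "u \<in> Hom C W Q" "k \<cdot> u = msub C g h" using fac[OF msub_hom[OF gh]] by blast
    have "u = Zer C W Q" using zero_objectD(1)[OF K0 _ u(1)] by simp
    then have "msub C g h = Zer C W X" using u(2) by simp
    then show "g = h" using msub_eq_Zer[OF gh] by simp
  qed simp
  then have "zero_object C X \<or> iso_mor C f" using Y HomD(2,3)[OF f] unfolding simple_object_def by metis
  then show ?thesis using X by (simp add: simple_object_def)
qed

lemma direct_sum_right_eq:
  assumes ds: "is_direct_sum C I Y X p q" and g: "g \<in> Hom C (W \<diamondop> X) Z" and h: "h \<in> Hom C (W \<diamondop> X) Z" and W: "W \<in> Obj C"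
    and eq: "\<And>a. a \<in> I \<Longrightarrow> g \<cdot> (ide W \<star> q a) = h \<cdot> (ide W \<star> q a)"
  shows "g = h"
proof (rule direct_sum_eq[OF ds, of g W \<I> Z])
  show "g \<cdot> (ide W \<star> q a \<star> ide \<I>) = h \<cdot> (ide W \<star> q a \<star> ide \<I>)" if "a \<in> I" for a
    using eq[OF that] HomD[OF direct_sumD(5)[OF ds that]] by simp
qed (use g h W direct_sumD(2)[OF ds] in simp_all)

lemma direct_sum_copair:
  assumes ds: "is_direct_sum C I Y X p q" and d: "\<And>a. a \<in> I \<Longrightarrow> d a \<in> Hom C (Y a) Z" and Z [simp]: "Z \<in> Obj C"
  shows "msum C X Z (\<lambda>a. d a \<cdot> p a) I \<in> Hom C X Z" "b \<in> I \<Longrightarrow> msum C X Z (\<lambda>a. d a \<cdot> p a) I \<cdot> q b = d b"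
proof -
  note D = direct_sumD[OF ds]
  have dp: "d a \<cdot> p a \<in> Hom C X Z" if "a \<in> I" for a using cmp_hom[OF D(4) d] that by simp
  show "msum C X Z (\<lambda>a. d a \<cdot> p a) I \<in> Hom C X Z" by (rule msum_hom) (use D(1,2) dp in simp_all)
  assume b: "b \<in> I"
  note [simp] = HomD[OF D(5)[OF b]] HomD[OF d[OF b]]
  have "msum C X Z (\<lambda>a. d a \<cdot> p a) I \<cdot> q b = msum C (Y b) Z (\<lambda>a. (d a \<cdot> p a) \<cdot> q b) I"
    by (subst cmp_msum(2)) (use D(1) dp in simp_all)
  also have "\<dots> = d b"
  proof (rule msum_delta[OF D(1) b])
    fix a assume a: "a \<in> I"
    note [simp] = HomD[OF D(4)[OF a]] HomD[OF d[OF a]]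
    show "(d a \<cdot> p a) \<cdot> q b = (if a = b then d b else Zer C (Y b) Z)" using D(6)[OF a b] by simp
  qed (use d[OF b] in simp_all)
  finally show "msum C X Z (\<lambda>a. d a \<cdot> p a) I \<cdot> q b = d b" .
qed

text \<open>Between distinct representatives there is only the zero morphism, by Schur's lemma, and
  the endomorphisms of a representative are scalars; both pass through any family of
  morphisms.\<close>

lemma simple_representatives_dinat:
  assumes ab: "abelian_category C" and sc: "\<forall>X. simple_object C X \<longrightarrow> scalar_object C X"
    and rep: "simple_representatives C \<Lambda>"
    and q: "\<And>l. l \<in> \<Lambda> \<Longrightarrow> q l \<in> Hom C (du l \<diamondop> l) Z"
    and a: "a \<in> \<Lambda>" and b: "b \<in> \<Lambda>" and f: "f \<in> Hom C a b"
  shows "q a \<cdot> (dual_mor C f \<star> ide a) = q b \<cdot> (ide (du b) \<star> f)"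
proof -
  have simple: "simple_object C l" if "l \<in> \<Lambda>" for l using rep that by (simp add: simple_representatives_def)
  note [simp] = HomD[OF f] HomD[OF q[OF a]] HomD[OF q[OF b]]
  show ?thesis
  proof (cases "a = b")
    case True
    have "f \<in> (\<lambda>t. Scl C t (ide a)) ` UNIV"
      using sc simple[OF a] f unfolding True scalar_object_def bij_betw_def by blast
    then obtain t where "f = Scl C t (ide a)" by blast
    then show ?thesis using True by (simp add: dual_mor_Scl)
  next
    case False
    have "f = Zer C a b"
    proof (rule ccontr)
      assume "f \<noteq> Zer C a b"
      then have "isomorphic C a b" using schur[OF ab simple[OF a] simple[OF b] f] f by (auto simp: isomorphic_def)
      moreover have "isomorphic C a a"
        by (auto simp: isomorphic_def iso_mor_def inverse_mor_def Hom_iff intro!: bexI[of _ "ide a"] exI[of _ "ide a"])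
      moreover have "\<exists>!l. l \<in> \<Lambda> \<and> isomorphic C a l" using rep simple[OF a] by (simp add: simple_representatives_def)
      ultimately show False using a b False by blast
    qed
    then show ?thesis by (simp add: dual_mor_Zer)
  qed
qed

text \<open>Simple summands are replaced by their representatives, with the projections and
  injections adjusted by the chosen isomorphisms.\<close>

lemma semisimple_decomposition:
  assumes ss: "semisimple_category C" and rep: "simple_representatives C \<Lambda>" and X: "X \<in> Obj C"
  obtains n :: nat and l pX qX where "is_direct_sum C {..<n} l X pX qX" "l ` {..<n} \<subseteq> \<Lambda>"
proof -
  have \<Lambda>: "l \<in> Obj C" if "l \<in> \<Lambda>" for l using rep that by (simp add: simple_representatives_def simple_object_def)
  obtain n :: nat and Y p0 q0 where d0: "is_direct_sum C {..<n} Y X p0 q0" "\<And>k. k < n \<Longrightarrow> simple_object C (Y k)"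
    using ss X unfolding semisimple_category_def by blast
  note E = direct_sumD[OF d0(1)]
  have "\<exists>l u. l \<in> \<Lambda> \<and> u \<in> Hom C (Y k) l \<and> iso_mor C u" if "k < n" for k
    using rep d0(2)[OF that] unfolding simple_representatives_def isomorphic_def by blast
  then obtain l u where lu: "\<And>k. k < n \<Longrightarrow> l k \<in> \<Lambda> \<and> u k \<in> Hom C (Y k) (l k) \<and> iso_mor C (u k)" by metis
  have ty: "k < n \<Longrightarrow> u k \<in> Mor C \<and> Dom C (u k) = Y k \<and> Cod C (u k) = l k \<and> iso_mor C (u k) \<and>
      p0 k \<in> Mor C \<and> Dom C (p0 k) = X \<and> Cod C (p0 k) = Y k \<and>
      q0 k \<in> Mor C \<and> Dom C (q0 k) = Y k \<and> Cod C (q0 k) = X \<and> Y k \<in> Obj C \<and> l k \<in> Obj C" for k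
    using lu[of k] E(3,4,5)[of k] \<Lambda>[of "l k"] by (auto simp: Hom_iff)
  let ?p = "\<lambda>k. u k \<cdot> p0 k" and ?q = "\<lambda>k. q0 k \<cdot> minv C (u k)"
  have pq: "?p a \<cdot> ?q b = (if a = b then ide (l a) else Zer C (l b) (l a))" if a: "a < n" and b: "b < n" for a b
  proof -
    note [simp] = ty[OF a] ty[OF b]
    have "?p a \<cdot> ?q b = u a \<cdot> (p0 a \<cdot> q0 b) \<cdot> minv C (u b)" by simp
    also have "\<dots> = (if a = b then ide (l a) else Zer C (l b) (l a))" using E(6)[of a b] a b by auto
    finally show ?thesis .
  qed
  have "msum C X X (\<lambda>k. ?q k \<cdot> ?p k) {..<n} = msum C X X (\<lambda>k. q0 k \<cdot> p0 k) {..<n}"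
    by (rule msum_cong) (use X ty in \<open>auto simp: Hom_iff\<close>)
  then have "is_direct_sum C {..<n} l X ?p ?q"
    using E(7) X ty pq by (auto simp: is_direct_sum_def Hom_iff)
  then show thesis using that[of n l ?p ?q] lu by blast
qed

text \<open>The second conclusion describes \<open>j\<close> independently of the decomposition
  picked by \<open>SOME\<close>. Dinaturality and universality are read off from it after
  composition with the injections of a decomposition of \<open>X\<close> into
  representatives.\<close>

lemma semisimple_coend:
  assumes ab: "abelian_category C" and ss: "semisimple_category C"
    and sc: "\<forall>X. simple_object C X \<longrightarrow> scalar_object C X"
    and rep: "simple_representatives C \<Lambda>"
    and ds: "is_direct_sum C \<Lambda> (\<lambda>l. du l \<diamondop> l) BB p q"
    and j: "j = semisimple_coend_mor C \<Lambda> BB q"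
  shows "is_coend C BB j"
    "\<And>X m b. m \<in> \<Lambda> \<Longrightarrow> b \<in> Hom C m X \<Longrightarrow> j X \<cdot> (ide (du X) \<star> b) = q m \<cdot> (dual_mor C b \<star> ide m)"
proof -
  note D = direct_sumD[OF ds]
  note BB [simp] = D(2)
  have \<Lambda>: "l \<in> Obj C" if "l \<in> \<Lambda>" for l using rep that by (simp add: simple_representatives_def simple_object_def)
  have jX: "j X \<in> Hom C (du X \<diamondop> X) BB \<and>
      (\<forall>m\<in>\<Lambda>. \<forall>b\<in>Hom C m X. j X \<cdot> (ide (du X) \<star> b) = q m \<cdot> (dual_mor C b \<star> ide m))" if X [simp]: "X \<in> Obj C" for X
  proof -
    let ?P = "\<lambda>jj. \<exists>(n::nat) l pX qX. is_direct_sum C {..<n} l X pX qX \<and> l ` {..<n} \<subseteq> \<Lambda> \<and>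
        jj = msum C (du X \<diamondop> X) BB (\<lambda>k. q (l k) \<cdot> (dual_mor C (qX k) \<star> pX k)) {..<n}"
    have "\<exists>jj. ?P jj" using semisimple_decomposition[OF ss rep X] by metis
    then have "?P (j X)" unfolding j semisimple_coend_mor_def by (rule someI_ex)
    then obtain n :: nat and l pX qX where E: "is_direct_sum C {..<n} l X pX qX" and l: "l ` {..<n} \<subseteq> \<Lambda>"
      and jj: "j X = msum C (du X \<diamondop> X) BB (\<lambda>k. q (l k) \<cdot> (dual_mor C (qX k) \<star> pX k)) {..<n}" by blast
    note E' = direct_sumD[OF E]
    have lk: "l k \<in> \<Lambda>" if "k \<in> {..<n}" for k using l that by blast
    have t: "q (l k) \<cdot> (dual_mor C (qX k) \<star> pX k) \<in> Hom C (du X \<diamondop> X) BB" if k: "k \<in> {..<n}" for k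
      using HomD[OF E'(4)[OF k]] HomD[OF E'(5)[OF k]] HomD[OF D(5)[OF lk[OF k]]] by (simp add: Hom_iff)
    have "j X \<cdot> (ide (du X) \<star> b) = q m \<cdot> (dual_mor C b \<star> ide m)" if m: "m \<in> \<Lambda>" and b: "b \<in> Hom C m X" for m b
    proof -
      note [simp] = HomD[OF b] HomD[OF D(5)[OF m]]
      \<comment> \<open>By dinaturality between representatives each summand becomes the value of
        the additive map \<open>?F\<close> at \<open>qX k \<cdot> pX k\<close>; hence the sum is its
        value at the identity.\<close>
      let ?F = "\<lambda>v. q m \<cdot> (dual_mor C (v \<cdot> b) \<star> ide m)"
      have "j X \<cdot> (ide (du X) \<star> b)
          = msum C (du X \<diamondop> m) BB (\<lambda>k. (q (l k) \<cdot> (dual_mor C (qX k) \<star> pX k)) \<cdot> (ide (du X) \<star> b)) {..<n}"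
        unfolding jj by (subst cmp_msum(2)) (use t in simp_all)
      also have "\<dots> = msum C (du X \<diamondop> m) BB (\<lambda>k. ?F (qX k \<cdot> pX k)) {..<n}"
      proof (rule msum_cong)
        fix k assume k: "k \<in> {..<n}"
        note [simp] = HomD[OF E'(4)[OF k]] HomD[OF E'(5)[OF k]] HomD[OF D(5)[OF lk[OF k]]]
        show "(q (l k) \<cdot> (dual_mor C (qX k) \<star> pX k)) \<cdot> (ide (du X) \<star> b) \<in> Hom C (du X \<diamondop> m) BB" by (simp add: Hom_iff)
        have pb: "pX k \<cdot> b \<in> Hom C m (l k)" by (simp add: Hom_iff)
        have e: "q (l k) \<cdot> (ide (du (l k)) \<star> (pX k \<cdot> b)) = q m \<cdot> (dual_mor C (pX k \<cdot> b) \<star> ide m)"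
          by (rule simple_representatives_dinat[OF ab sc rep _ m lk[OF k] pb, symmetric]) (rule D(5))
        have "(q (l k) \<cdot> (dual_mor C (qX k) \<star> pX k)) \<cdot> (ide (du X) \<star> b)
            = (q (l k) \<cdot> (ide (du (l k)) \<star> (pX k \<cdot> b))) \<cdot> (dual_mor C (qX k) \<star> ide m)" by (simp add: fuse)
        also have "\<dots> = q m \<cdot> ((dual_mor C (pX k \<cdot> b) \<cdot> dual_mor C (qX k)) \<star> ide m)"
          unfolding e by (simp add: fuse)
        also have "\<dots> = ?F (qX k \<cdot> pX k)"
          using dual_mor_cmp[OF pb E'(5)[OF k]] by simp
        finally show "(q (l k) \<cdot> (dual_mor C (qX k) \<star> pX k)) \<cdot> (ide (du X) \<star> b) = ?F (qX k \<cdot> pX k)" .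
      qed simp_all
      also have "\<dots> = ?F (ide X)"
      proof (rule direct_sum_additive[OF E, symmetric])
        fix u v assume u: "u \<in> Hom C X X" and v: "v \<in> Hom C X X"
        note [simp] = HomD[OF u] HomD[OF v]
        show "?F (Add C u v) = Add C (?F u) (?F v)"
          using dual_mor_Add[of "u \<cdot> b" m X "v \<cdot> b"] by (simp add: cmp_Add ten_Add Hom_iff)
        show "?F u \<in> Hom C (du X \<diamondop> m) BB" by (simp add: Hom_iff)
      qed (simp_all add: dual_mor_Zer)
      finally show ?thesis by simp
    qed
    moreover have "j X \<in> Hom C (du X \<diamondop> X) BB" unfolding jj by (rule msum_hom) (use t in simp_all)
    ultimately show ?thesis by blast
  qed
  then show star: "j X \<cdot> (ide (du X) \<star> b) = q m \<cdot> (dual_mor C b \<star> ide m)" if "m \<in> \<Lambda>" "b \<in> Hom C m X" for X m b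
    using that HomD(5)[OF that(2)] by blast
  have jdin: "dinatural C BB j"
    unfolding dinatural_def
  proof (intro conjI ballI allI)
    show "j X \<in> Hom C (du X \<diamondop> X) BB" if "X \<in> Obj C" for X using jX[OF that] by blast
    fix X Y f assume f: "f \<in> Hom C X Y"
    note [simp] = HomD[OF f] HomD[OF conjunct1[OF jX[OF HomD(4)[OF f]]]] HomD[OF conjunct1[OF jX[OF HomD(5)[OF f]]]]
    obtain n :: nat and l pX qX where E: "is_direct_sum C {..<n} l X pX qX" "l ` {..<n} \<subseteq> \<Lambda>"
      using semisimple_decomposition[OF ss rep HomD(4)[OF f]] .
    show "j X \<cdot> (dual_mor C f \<star> ide X) = j Y \<cdot> (ide (du Y) \<star> f)"
    proof (rule direct_sum_right_eq[OF E(1), of _ "du Y" BB])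
      fix k assume k: "k \<in> {..<n}"
      then have lk: "l k \<in> \<Lambda>" using E(2) by blast
      note qk = direct_sumD(5)[OF E(1) k]
      note [simp] = HomD[OF qk] HomD[OF D(5)[OF lk]]
      have "(j X \<cdot> (dual_mor C f \<star> ide X)) \<cdot> (ide (du Y) \<star> qX k) = (j X \<cdot> (ide (du X) \<star> qX k)) \<cdot> (dual_mor C f \<star> ide (l k))"
        by (simp add: fuse)
      also have "\<dots> = q (l k) \<cdot> (dual_mor C (f \<cdot> qX k) \<star> ide (l k))"
        unfolding star[OF lk qk] dual_mor_cmp[OF qk f] by (simp add: fuse)
      also have "\<dots> = j Y \<cdot> (ide (du Y) \<star> (f \<cdot> qX k))" by (rule star[OF lk cmp_hom[OF qk f], symmetric])
      finally show "(j X \<cdot> (dual_mor C f \<star> ide X)) \<cdot> (ide (du Y) \<star> qX k) = (j Y \<cdot> (ide (du Y) \<star> f)) \<cdot> (ide (du Y) \<star> qX k)"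
        by (simp add: fuse)
    qed (simp_all add: Hom_iff)
  qed
  show "is_coend C BB j"
    unfolding is_coend_def
  proof (intro conjI BB jdin ballI allI impI)
    fix Z d assume Z: "Z \<in> Obj C" and d: "dinatural C Z d"
    \<comment> \<open>This choice is forced: at a representative \<open>l\<close> the morphism
      \<open>j l\<close> is the injection \<open>q l\<close>.\<close>
    let ?g = "msum C BB Z (\<lambda>l. d l \<cdot> p l) \<Lambda>"
    have dh: "d X \<in> Hom C (du X \<diamondop> X) Z" if "X \<in> Obj C" for X using d that by (simp add: dinatural_def)
    have g: "?g \<in> Hom C BB Z" "\<And>b. b \<in> \<Lambda> \<Longrightarrow> ?g \<cdot> q b = d b"
      by (rule direct_sum_copair[OF ds _ Z]; use dh[OF \<Lambda>] in blast)+
    note [simp] = HomD[OF g(1)]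
    have gj: "?g \<cdot> j X = d X" if X [simp]: "X \<in> Obj C" for X
    proof -
      obtain n :: nat and l pX qX where E: "is_direct_sum C {..<n} l X pX qX" "l ` {..<n} \<subseteq> \<Lambda>"
        using semisimple_decomposition[OF ss rep X] .
      note [simp] = HomD[OF dh[OF X]] HomD[OF conjunct1[OF jX[OF X]]]
      show ?thesis
      proof (rule direct_sum_right_eq[OF E(1), of _ "du X" Z])
        fix k assume k: "k \<in> {..<n}"
        then have lk: "l k \<in> \<Lambda>" using E(2) by blast
        note qk = direct_sumD(5)[OF E(1) k]
        note [simp] = HomD[OF qk] HomD[OF D(5)[OF lk]]
        have "(?g \<cdot> j X) \<cdot> (ide (du X) \<star> qX k) = ?g \<cdot> q (l k) \<cdot> (dual_mor C (qX k) \<star> ide (l k))"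
          using star[OF lk qk] by simp
        also have "\<dots> = (?g \<cdot> q (l k)) \<cdot> (dual_mor C (qX k) \<star> ide (l k))" by simp
        also have "\<dots> = d X \<cdot> (ide (du X) \<star> qX k)"
          unfolding g(2)[OF lk] using d qk by (simp add: dinatural_def)
        finally show "(?g \<cdot> j X) \<cdot> (ide (du X) \<star> qX k) = d X \<cdot> (ide (du X) \<star> qX k)" .
      qed (simp_all add: Hom_iff)
    qed
    show "\<exists>!g. g \<in> Hom C BB Z \<and> (\<forall>X\<in>Obj C. d X = g \<cdot> j X)"
    proof (rule ex1I[of _ ?g])
      show "?g \<in> Hom C BB Z \<and> (\<forall>X\<in>Obj C. d X = ?g \<cdot> j X)" using g(1) gj by simp
      fix h assume h: "h \<in> Hom C BB Z \<and> (\<forall>X\<in>Obj C. d X = h \<cdot> j X)"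
      show "h = ?g"
      proof (rule direct_sum_right_eq[OF ds, of _ \<I> Z])
        fix l assume l: "l \<in> \<Lambda>"
        note [simp] = \<Lambda>[OF l] HomD[OF D(5)[OF l]] HomD[OF conjunct1[OF jX[OF \<Lambda>[OF l]]]]
        have "j l = q l" using star[OF l id_hom[OF \<Lambda>[OF l]]] by simp
        then have "h \<cdot> q l = ?g \<cdot> q l" using h gj[OF \<Lambda>[OF l]] \<Lambda>[OF l] by metis
        then show "h \<cdot> (ide \<I> \<star> q l) = ?g \<cdot> (ide \<I> \<star> q l)" by simp
      qed (use g(1) h in simp_all)
    qed
  qed
qed

end

section \<open>Comparison of the two coends\<close>

context ribbon_k_category
begin

section \<open>Derived structure under the quotient functor\<close>

lemma Cs_minv: "iso_mor C f \<Longrightarrow> minv Cs (\<pi> f) = \<pi> (minv C f)"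
  using ribbon_k_category.minv_eq[OF semisimplification_ribbon _ Cs_inverse[OF _ minv_inverse]] iso_mor_Mor by simp

lemma Cs_structure:
  assumes "X \<in> Obj C"
  shows "ev_right Cs X = \<pi> (ev_right C X)" "coev_right Cs X = \<pi> (coev_right C X)" "bidual Cs X = \<pi> (bidual C X)"
    "Y \<in> Obj C \<Longrightarrow> dual_ten Cs X Y = \<pi> (dual_ten C X Y)"
proof -
  note [simp] = assms
  show e: "ev_right Cs X = \<pi> (ev_right C X)" by (simp add: ev_right_def)
  show "coev_right Cs X = \<pi> (coev_right C X)" by (simp add: coev_right_def Cs_minv)
  show "bidual Cs X = \<pi> (bidual C X)" by (simp add: bidual_def e)
  show "Y \<in> Obj C \<Longrightarrow> dual_ten Cs X Y = \<pi> (dual_ten C X Y)" by (simp add: dual_ten_def Let_def)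
qed

lemma Cs_to_scalar:
  assumes "f \<in> Hom C \<I> \<I>" shows "to_scalar Cs (\<pi> f) = to_scalar C f"
proof -
  have "\<pi> f = Scl Cs (to_scalar C f) (Idm Cs \<I>)" using scalar_hom[OF assms] by simp
  then show ?thesis using ribbon_k_category.to_scalar_Scl[OF semisimplification_ribbon, of "to_scalar C f"]
    by (simp only: Cs_sel(3))
qed

lemma Cs_qtrace:
  assumes "f \<in> Hom C X X" shows "qtrace Cs (\<pi> f) = qtrace C f"
proof -
  note [simp] = HomD[OF assms]
  show ?thesis
    using Cs_to_scalar[OF tr_mor_hom[OF assms]] by (simp add: qtrace_def Let_def tr_mor_def Cs_structure)
qed

text \<open>Evaluation uses structural morphisms and inverses of braidings and twists, all of which
  \<pi> preserves; well-formedness of the diagram provides the typing of the layers.\<close>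

lemma Cs_diagram_mor:
  assumes X: "\<And>k. X k \<in> Obj C"
  shows "diagram_ok w D \<Longrightarrow> diagram_mor Cs X D w = \<pi> (diagram_mor C X D w)"
proof (induction D arbitrary: w)
  case Nil
  then show ?case by (simp add: section_obj_def strand_obj_def ten_obs_def cong: if_cong)
next
  case (Cons x D)
  have c: "colouring (\<lambda>k m. X k) (\<lambda>k m. ide (X k))" by (rule colouring_const) (rule X)
  have ok: "event_ok w x" "diagram_ok (event_apply w x) D" using Cons.prems by auto
  have so: "section_obj Cs X u = section_obj C X u" "section_obj C X u = gobj (\<lambda>k m. X k) u" "strand_obj Cs X = strand_obj C X" for u
    unfolding section_obj_def strand_obj_def ten_obs_def cobj_def Cs_sel by simp_all
  note [simp] = X
  have "strand_obj C X p \<in> Obj C" for p by (simp add: strand_obj_def split: prod.split)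
  then have e: "event_core Cs X w x = \<pi> (event_core C X w x)"
    by (cases x) (simp_all add: so Cs_minv Cs_structure Let_def split: prod.split)
  have g: "event_core C X w x = gcore (\<lambda>k m. X k) (\<lambda>k m. ide (X k)) w x"
    by (cases x) (simp_all add: strand_obj_cobj Let_def split: prod.split)
  note gh = HomD[OF gcore_hom[OF c ok(1)], folded g]
  have "event_mor Cs X w x = \<pi> (event_mor C X w x)"
    using gh(1) gobj_obj[OF c] by (simp add: event_mor_def so e split: prod.split)
  moreover have "event_mor C X w x = gevent (\<lambda>k m. X k) (\<lambda>k m. ide (X k)) w x"
    by (simp add: event_mor_def gevent_def g so(2))
  moreover have "diagram_mor C X D (event_apply w x) = gdiag (\<lambda>k m. X k) (\<lambda>k m. ide (X k)) D (event_apply w x)"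
    by (rule diagram_mor_gdiag[OF X ok(2)])
  ultimately show ?case
    using Cons.IH[OF ok(2)] HomD[OF gevent_hom[OF c ok(1)]] HomD[OF gdiag_hom[OF c ok(2)]] by simp
qed

end

context full_ribbon_subcategory
begin

section \<open>Derived structure in a full subcategory\<close>

lemma sub_obj: "X \<in> Ob \<Longrightarrow> X \<in> Obj C" using Ob by blast

text \<open>These constructions involve only fields shared with the ambient category, so they agree
  as functions. Inverses and finite sums depend on Hom-sets, which differ for objects outside
  \<open>Ob\<close>; \<open>minv\<close>, \<open>coev_right\<close> and \<open>msum\<close> are
  therefore compared under typing hypotheses.\<close>

lemma sub_structure: "ev_right B = ev_right C" "bidual B = bidual C" "dual_ten B = dual_ten C" "to_scalar B = to_scalar C"
  "ten_obs B = ten_obs C" "ten_mors B = ten_mors C" "msub B = msub C"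
proof -
  show e: "ev_right B = ev_right C" by (rule ext) (simp add: ev_right_def sub_sel)
  show "bidual B = bidual C" by (rule ext) (simp add: bidual_def sub_sel e)
  show "dual_ten B = dual_ten C" by (intro ext) (simp add: dual_ten_def sub_sel)
  show "to_scalar B = to_scalar C" by (rule ext) (simp add: to_scalar_def sub_sel)
  show "ten_obs B = ten_obs C" "ten_mors B = ten_mors C" by (rule ext, simp add: ten_obs_def ten_mors_def sub_sel)+
  show "msub B = msub C" by (intro ext) (simp add: msub_def sub_sel)
qed

lemma sub_qtrace: "qtrace B = qtrace C"
  by (rule ext) (simp add: qtrace_def sub_sel sub_structure)

lemma sub_coev_right:
  assumes "X \<in> Ob" shows "coev_right B X = coev_right C X"
proof -
  have [simp]: "X \<in> Obj C" using sub_obj[OF assms] .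
  show ?thesis
    using sub_minv[OF twist_hom assms assms] sub_minv[OF braid_hom Ob_ten Ob_ten, of "du X" X] assms Ob_dual
    by (simp add: coev_right_def sub_sel)
qed

lemma sub_msum: "X \<in> Ob \<Longrightarrow> Y \<in> Ob \<Longrightarrow> msum B X Y f I = msum C X Y f I"
  by (simp add: msum_def hom_group_def sub_Hom sub_sel)

lemma sub_direct_sum:
  assumes "is_direct_sum B I Y X p q" shows "is_direct_sum C I Y X p q" "X \<in> Ob" "a \<in> I \<Longrightarrow> Y a \<in> Ob"
proof -
  show X: "X \<in> Ob" "a \<in> I \<Longrightarrow> Y a \<in> Ob" using assms by (auto simp: is_direct_sum_def sub_sel)
  show "is_direct_sum C I Y X p q"
    using assms X(1) sub_obj unfolding is_direct_sum_def sub_sel sub_msum[OF X(1) X(1)] by (simp add: sub_Hom_iff)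
qed

lemma sub_diagram_mor:
  assumes X: "\<And>k. X k \<in> Ob" shows "diagram_mor B X D w = diagram_mor C X D w"
proof (induction D arbitrary: w)
  case (Cons x D)
  have so: "section_obj B X = section_obj C X" "strand_obj B X = strand_obj C X"
    unfolding section_obj_def[abs_def] strand_obj_def sub_sel sub_structure by (rule refl)+
  have s: "strand_obj C X p \<in> Ob" for p using X Ob_dual by (simp add: strand_obj_def split: prod.split)
  have "minv B (Braid C (strand_obj C X a) (strand_obj C X b)) = minv C (Braid C (strand_obj C X a) (strand_obj C X b))" for a b
    using sub_minv[OF braid_hom Ob_ten Ob_ten] s sub_obj by simp
  then have "event_core B X w x = event_core C X w x"
    by (cases x) (simp_all add: so sub_sel sub_structure sub_coev_right[OF X] Let_def cong: if_cong)
  then show ?case using Cons by (simp add: event_mor_def so sub_sel)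
qed (simp add: section_obj_def strand_obj_def sub_sel sub_structure cong: if_cong)

end

text \<open>\<open>BB\<close> enters twice, as a coend in the subcategory and as a direct sum in the
  whole semisimplification. \<open>D\<close> is a variable tied to the semisimplification by an
  equation, so that general facts on ribbon categories apply without unfolding the quotient.\<close>

locale comparison = CA: ribbon_coend C A i + D: full_ribbon_subcategory D B "Obj B" + BJ: ribbon_coend B BB j
  for C :: "('o, 'm, 'k::field) rcat" and A i and D B :: "('o, 'm set, 'k) rcat" and BB j +
  fixes \<Lambda> p q \<phi>
  assumes D_def: "D = semisimplification C"
    and ds: "is_direct_sum D \<Lambda> (\<lambda>l. Dual D l \<diamondop>\<^bsub>D\<^esub> l) BB p q"
    and \<Lambda>: "\<Lambda> \<subseteq> Obj B"
    and jq: "\<And>l. l \<in> \<Lambda> \<Longrightarrow> j l = q l"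
    and \<phi>: "\<phi> \<in> Hom D BB A"
    and \<phi>j: "\<And>X. X \<in> Obj B \<Longrightarrow> \<phi> \<cdot>\<^bsub>D\<^esub> j X = proj_mor C (i X)"
begin

abbreviation cD (infixr \<open>\<bullet>\<close> 70) where "g \<bullet> f \<equiv> g \<cdot>\<^bsub>D\<^esub> f"
abbreviation tD (infixr \<open>\<odot>\<close> 75) where "g \<odot> f \<equiv> g \<star>\<^bsub>D\<^esub> f"
abbreviation idD where "idD X \<equiv> Idm D X"
abbreviation P where "P \<equiv> proj_mor C"
abbreviation tC (infixr \<open>\<boxtimes>\<close> 75) where "X \<boxtimes> Y \<equiv> X \<diamondop>\<^bsub>C\<^esub> Y"
abbreviation uC (\<open>\<one>\<one>\<close>) where "\<one>\<one> \<equiv> \<I>\<^bsub>C\<^esub>"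

section \<open>Testing morphisms out of the direct sum\<close>

lemma selD [simp]: "Obj D = Obj C" "TOb D = TOb C" "Dual D = Dual C" "TUnit D = TUnit C"
  by (simp_all add: D_def)

lemmas selB [simp] = D.sub_sel(2-)

lemma P_ty [simp]:
  assumes "f \<in> Mor C" shows "P f \<in> Mor D" "Dom D (P f) = Dom C f" "Cod D (P f) = Cod C f"
  using assms by (simp_all add: D_def)

lemma P_cmp: "f \<in> Mor C \<Longrightarrow> g \<in> Mor C \<Longrightarrow> Dom C g = Cod C f \<Longrightarrow> P g \<bullet> P f = P (g \<cdot>\<^bsub>C\<^esub> f)"
  by (simp add: D_def)

lemma P_ten: "f \<in> Mor C \<Longrightarrow> g \<in> Mor C \<Longrightarrow> P g \<odot> P f = P (g \<star>\<^bsub>C\<^esub> f)"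
  by (simp add: D_def)

lemma P_str:
  "Idm D X = P (Idm C X)" "Ev D X = P (Ev C X)" "Coev D X = P (Coev C X)" "Braid D X Y = P (Braid C X Y)"
  "Twist D X = P (Twist C X)"
  by (simp_all add: D_def)

lemma P_struct:
  assumes "X \<in> Obj C"
  shows "bidual D X = P (bidual C X)" "Y \<in> Obj C \<Longrightarrow> dual_ten D X Y = P (dual_ten C X Y)"
    "minv D (Twist D X) = P (minv C (Twist C X))"
  using assms CA.Cs_structure by (simp_all add: D_def CA.Cs_minv)

lemma BC [simp]: "X \<in> Obj B \<Longrightarrow> X \<in> Obj C" using D.sub_obj by simp

lemma B_closed [simp]: "\<one>\<one> \<in> Obj B" "X \<in> Obj B \<Longrightarrow> Y \<in> Obj B \<Longrightarrow> X \<boxtimes> Y \<in> Obj B" "X \<in> Obj B \<Longrightarrow> Dual C X \<in> Obj B"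
  using D.Ob(2) D.Ob_ten D.Ob_dual by simp_all

lemma HomB: "f \<in> Hom B X Y \<longleftrightarrow> f \<in> Hom D X Y \<and> X \<in> Obj B \<and> Y \<in> Obj B"
  by (rule D.sub_Hom_iff)

lemma \<phi>_ty [simp]: "\<phi> \<in> Mor D" "Dom D \<phi> = BB" "Cod D \<phi> = A"
  using \<phi> by (simp_all add: Hom_iff)

lemma j_ty [simp]:
  assumes "X \<in> Obj B" shows "j X \<in> Mor D" "Dom D (j X) = Dual C X \<boxtimes> X" "Cod D (j X) = BB"
  using BJ.i_hom[OF assms, unfolded HomB] by (simp_all add: Hom_iff)

text \<open>The injections \<open>q\<close> are the values of \<open>j\<close> at the
  representatives, so testing on \<open>j\<close> suffices even for a target \<open>Z\<close>
  outside the subcategory.\<close>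

lemma split_eq:
  assumes "g \<in> Hom D (W \<boxtimes> BB \<boxtimes> V) Z" "h \<in> Hom D (W \<boxtimes> BB \<boxtimes> V) Z" "W \<in> Obj C" "V \<in> Obj C"
    and "\<And>l. l \<in> Obj B \<Longrightarrow> g \<bullet> (idD W \<odot> j l \<odot> idD V) = h \<bullet> (idD W \<odot> j l \<odot> idD V)"
  shows "g = h"
proof (rule D.direct_sum_eq[OF ds, of g W V Z h])
  show "g \<bullet> (idD W \<odot> q l \<odot> idD V) = h \<bullet> (idD W \<odot> q l \<odot> idD V)" if "l \<in> \<Lambda>" for l
    using assms(5)[of l] jq[OF that] \<Lambda> that by (metis subsetD)
qed (use assms in simp_all)

lemma split1_eq:
  assumes "g \<in> Hom D BB Z" "h \<in> Hom D BB Z" "\<And>l. l \<in> Obj B \<Longrightarrow> g \<bullet> j l = h \<bullet> j l"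
  shows "g = h"
proof (rule split_eq[of g "\<I>\<^bsub>D\<^esub>" "\<I>\<^bsub>D\<^esub>" Z])
  show "g \<bullet> (idD \<I>\<^bsub>D\<^esub> \<odot> j l \<odot> idD \<I>\<^bsub>D\<^esub>) = h \<bullet> (idD \<I>\<^bsub>D\<^esub> \<odot> j l \<odot> idD \<I>\<^bsub>D\<^esub>)" if "l \<in> Obj B" for l
    unfolding D.ten_unit(2)[OF j_ty(1)[OF that]] D.ten_unit(1)[OF j_ty(1)[OF that]] by (rule assms(3)[OF that])
qed (use assms in simp_all)

lemma split2_eq:
  assumes g: "g \<in> Hom D (BB \<boxtimes> BB) Z" and h: "h \<in> Hom D (BB \<boxtimes> BB) Z"
    and eq: "\<And>l m. l \<in> Obj B \<Longrightarrow> m \<in> Obj B \<Longrightarrow> g \<bullet> (j l \<odot> j m) = h \<bullet> (j l \<odot> j m)"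
  shows "g = h"
proof (rule split_eq[of g "\<I>\<^bsub>D\<^esub>" BB Z])
  note [simp] = D.HomD[OF g] D.HomD[OF h]
  fix l assume l [simp]: "l \<in> Obj B"
  have "g \<bullet> (j l \<odot> idD BB) = h \<bullet> (j l \<odot> idD BB)"
  proof (rule split_eq[of _ "Dual C l \<boxtimes> l" "\<I>\<^bsub>D\<^esub>" Z])
    fix m assume m [simp]: "m \<in> Obj B"
    have e: "(u \<bullet> (j l \<odot> idD BB)) \<bullet> (idD (Dual C l \<boxtimes> l) \<odot> j m) = u \<bullet> (j l \<odot> j m)" if u: "u \<in> Hom D (BB \<boxtimes> BB) Z" for u
      using D.HomD[OF u] by (simp add: D.fuse)
    show "(g \<bullet> (j l \<odot> idD BB)) \<bullet> (idD (Dual C l \<boxtimes> l) \<odot> j m \<odot> idD \<I>\<^bsub>D\<^esub>)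
       = (h \<bullet> (j l \<odot> idD BB)) \<bullet> (idD (Dual C l \<boxtimes> l) \<odot> j m \<odot> idD \<I>\<^bsub>D\<^esub>)"
      unfolding D.ten_unit(2)[OF j_ty(1)[OF m]] e[OF g] e[OF h] by (rule eq[OF l m])
  qed (simp_all add: Hom_iff)
  then show "g \<bullet> (idD \<I>\<^bsub>D\<^esub> \<odot> j l \<odot> idD BB) = h \<bullet> (idD \<I>\<^bsub>D\<^esub> \<odot> j l \<odot> idD BB)"
    by (subst (1 2) D.ten_unit(1)) simp_all
qed (use g h in simp_all)

section \<open>Compatibility of \<phi> with the structural morphisms\<close>

lemma antipode_comparison: "P (coend_antipode C A i) \<bullet> \<phi> = \<phi> \<bullet> coend_antipode B BB j"
proof (rule split1_eq)
  note SC = CA.antipode_spec and SB = BJ.antipode_spec[unfolded HomB]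
  note [simp] = CA.HomD[OF conjunct1[OF SC]] D.HomD[OF conjunct1[OF conjunct1[OF SB]]]
  show "P (coend_antipode C A i) \<bullet> \<phi> \<in> Hom D BB A" "\<phi> \<bullet> coend_antipode B BB j \<in> Hom D BB A" by (simp_all add: Hom_iff)
  fix l assume l [simp]: "l \<in> Obj B"
  have "(P (coend_antipode C A i) \<bullet> \<phi>) \<bullet> j l = P (coend_antipode C A i) \<bullet> P (i l)" using \<phi>j[OF l] by simp
  also have "\<dots> = P (i (Dual C l) \<cdot>\<^bsub>C\<^esub> (bidual C l \<star>\<^bsub>C\<^esub> Twist C (Dual C l)) \<cdot>\<^bsub>C\<^esub> Braid C (Dual C l) l)"
    using SC by (simp add: P_cmp)
  also have "\<dots> = P (i (Dual C l)) \<bullet> (P (bidual C l) \<odot> P (Twist C (Dual C l))) \<bullet> P (Braid C (Dual C l) l)"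
    by (simp add: P_cmp P_ten)
  also have "\<dots> = \<phi> \<bullet> j (Dual C l) \<bullet> (bidual B l \<odot> Twist D (Dual C l)) \<bullet> Braid D (Dual C l) l"
    by (simp add: P_struct P_str D.sub_structure flip: \<phi>j)
  also have "\<dots> = \<phi> \<bullet> (coend_antipode B BB j \<bullet> j l)" using SB by simp
  finally show "(P (coend_antipode C A i) \<bullet> \<phi>) \<bullet> j l = (\<phi> \<bullet> coend_antipode B BB j) \<bullet> j l" by simp
qed

lemma comult_comparison: "P (coend_comult C A i) \<bullet> \<phi> = (\<phi> \<odot> \<phi>) \<bullet> coend_comult B BB j"
proof (rule split1_eq)
  note SC = CA.comult_spec and SB = BJ.comult_spec[unfolded HomB]
  note [simp] = CA.HomD[OF conjunct1[OF SC]] D.HomD[OF conjunct1[OF conjunct1[OF SB]]]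
  show "P (coend_comult C A i) \<bullet> \<phi> \<in> Hom D BB (A \<boxtimes> A)" "(\<phi> \<odot> \<phi>) \<bullet> coend_comult B BB j \<in> Hom D BB (A \<boxtimes> A)"
    by (simp_all add: Hom_iff)
  fix l assume l [simp]: "l \<in> Obj B"
  have "(P (coend_comult C A i) \<bullet> \<phi>) \<bullet> j l = P (coend_comult C A i) \<bullet> P (i l)" using \<phi>j[OF l] by simp
  also have "\<dots> = P ((i l \<star>\<^bsub>C\<^esub> i l) \<cdot>\<^bsub>C\<^esub> (Idm C (Dual C l) \<star>\<^bsub>C\<^esub> Coev C l \<star>\<^bsub>C\<^esub> Idm C l))"
    using SC by (simp add: P_cmp)
  also have "\<dots> = (P (i l) \<odot> P (i l)) \<bullet> (idD (Dual C l) \<odot> Coev D l \<odot> idD l)"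
    by (simp add: P_cmp P_ten P_str)
  also have "\<dots> = (\<phi> \<odot> \<phi>) \<bullet> (j l \<odot> j l) \<bullet> (idD (Dual C l) \<odot> Coev D l \<odot> idD l)"
    by (simp add: D.fuse_cmp flip: \<phi>j)
  also have "\<dots> = (\<phi> \<odot> \<phi>) \<bullet> (coend_comult B BB j \<bullet> j l)" using SB by simp
  finally show "(P (coend_comult C A i) \<bullet> \<phi>) \<bullet> j l = ((\<phi> \<odot> \<phi>) \<bullet> coend_comult B BB j) \<bullet> j l" by simp
qed

lemma mult_comparison: "P (coend_mult C A i) \<bullet> (\<phi> \<odot> \<phi>) = \<phi> \<bullet> coend_mult B BB j"
proof (rule split2_eq)
  note SC = CA.mult_spec and SB = BJ.mult_spec[unfolded HomB]
  note [simp] = CA.HomD[OF conjunct1[OF SC]] D.HomD[OF conjunct1[OF conjunct1[OF SB]], simplified]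
  show "P (coend_mult C A i) \<bullet> (\<phi> \<odot> \<phi>) \<in> Hom D (BB \<boxtimes> BB) A" "\<phi> \<bullet> coend_mult B BB j \<in> Hom D (BB \<boxtimes> BB) A"
    by (simp_all add: Hom_iff)
  fix l m assume l [simp]: "l \<in> Obj B" and m [simp]: "m \<in> Obj B"
  have "(P (coend_mult C A i) \<bullet> (\<phi> \<odot> \<phi>)) \<bullet> (j l \<odot> j m) = P (coend_mult C A i) \<bullet> (P (i l) \<odot> P (i m))"
    using \<phi>j[OF l] \<phi>j[OF m] by (simp add: D.fuse)
  also have "\<dots> = P (i (m \<boxtimes> l) \<cdot>\<^bsub>C\<^esub> (dual_ten C l m \<star>\<^bsub>C\<^esub> Idm C (m \<boxtimes> l)) \<cdot>\<^bsub>C\<^esub> (Idm C (Dual C l) \<star>\<^bsub>C\<^esub> Braid C l (Dual C m \<boxtimes> m)))"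
    using SC by (simp add: P_cmp P_ten)
  also have "\<dots> = P (i (m \<boxtimes> l)) \<bullet> (P (dual_ten C l m) \<odot> idD (m \<boxtimes> l)) \<bullet> (idD (Dual C l) \<odot> Braid D l (Dual C m \<boxtimes> m))"
    by (simp add: P_cmp P_ten P_str)
  also have "\<dots> = \<phi> \<bullet> j (m \<boxtimes> l) \<bullet> (dual_ten B l m \<odot> idD (m \<boxtimes> l)) \<bullet> (idD (Dual C l) \<odot> Braid D l (Dual C m \<boxtimes> m))"
    by (simp add: P_struct D.sub_structure flip: \<phi>j)
  also have "\<dots> = \<phi> \<bullet> (coend_mult B BB j \<bullet> (j l \<odot> j m))" using SB by simp
  finally show "(P (coend_mult C A i) \<bullet> (\<phi> \<odot> \<phi>)) \<bullet> (j l \<odot> j m) = (\<phi> \<bullet> coend_mult B BB j) \<bullet> (j l \<odot> j m)" by simp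
qed

lemma Gamma_hom: "Gamma_l C A i \<in> Hom C (A \<boxtimes> A) (A \<boxtimes> A)" "Gamma_l B BB j \<in> Hom D (BB \<boxtimes> BB) (BB \<boxtimes> BB)"
  using CA.HomD[OF conjunct1[OF CA.comult_spec]] CA.HomD[OF conjunct1[OF CA.mult_spec]]
    D.HomD[OF conjunct1[OF conjunct1[OF BJ.comult_spec[unfolded HomB]]]]
    D.HomD[OF conjunct1[OF conjunct1[OF BJ.mult_spec[unfolded HomB]]]]
  by (simp_all add: Gamma_l_def Hom_iff)

text \<open>Assembled from the comparisons of coproduct and product by interchange, without a
  further test on dinatural families.\<close>

lemma Gamma_comparison: "P (Gamma_l C A i) \<bullet> (\<phi> \<odot> \<phi>) = (\<phi> \<odot> \<phi>) \<bullet> Gamma_l B BB j"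
proof -
  note [simp] = CA.HomD[OF conjunct1[OF CA.comult_spec]] CA.HomD[OF conjunct1[OF CA.mult_spec]]
    D.HomD[OF conjunct1[OF conjunct1[OF BJ.comult_spec[unfolded HomB]]]]
    D.HomD[OF conjunct1[OF conjunct1[OF BJ.mult_spec[unfolded HomB]]], simplified]
  let ?d = "coend_comult B BB j" and ?m = "coend_mult B BB j"
  have "P (Gamma_l C A i) = (idD A \<odot> P (coend_mult C A i)) \<bullet> (P (coend_comult C A i) \<odot> idD A)"
    by (simp add: Gamma_l_def P_cmp P_ten P_str)
  then have "P (Gamma_l C A i) \<bullet> (\<phi> \<odot> \<phi>) = (idD A \<odot> P (coend_mult C A i)) \<bullet> ((P (coend_comult C A i) \<bullet> \<phi>) \<odot> \<phi>)"
    by (simp add: D.fuse)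
  also have "\<dots> = (idD A \<odot> P (coend_mult C A i)) \<bullet> (\<phi> \<odot> \<phi> \<odot> \<phi>) \<bullet> (?d \<odot> idD BB)"
    unfolding comult_comparison using D.fuse[of ?d "\<phi> \<odot> \<phi>" "idD BB" \<phi>] by simp
  also have "\<dots> = (\<phi> \<odot> (P (coend_mult C A i) \<bullet> (\<phi> \<odot> \<phi>))) \<bullet> (?d \<odot> idD BB)"
    by (simp add: D.fuse_cmp)
  also have "\<dots> = (\<phi> \<odot> \<phi>) \<bullet> (idD BB \<odot> ?m) \<bullet> (?d \<odot> idD BB)"
    unfolding mult_comparison by (simp add: D.fuse_cmp)
  finally show ?thesis by (simp add: Gamma_l_def)
qed

lemma Theta_comparison:
  "P (Theta_plus C A i) \<bullet> \<phi> = Theta_plus B BB j" "P (Theta_minus C A i) \<bullet> \<phi> = Theta_minus B BB j"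
proof -
  note [simp] = CA.HomD[OF conjunct1[OF CA.Theta_plus_spec]] CA.HomD[OF conjunct1[OF CA.Theta_minus_spec]]
  have plus: "(P (Theta_plus C A i) \<bullet> \<phi>) \<bullet> j l = Theta_plus B BB j \<bullet> j l" if l [simp]: "l \<in> Obj B" for l
  proof -
    have "(P (Theta_plus C A i) \<bullet> \<phi>) \<bullet> j l = P (Theta_plus C A i \<cdot>\<^bsub>C\<^esub> i l)" using \<phi>j[OF l] by (simp add: P_cmp)
    also have "\<dots> = Ev D l \<bullet> (idD (Dual C l) \<odot> Twist D l)"
      using CA.Theta_plus_spec by (simp add: P_cmp P_ten P_str)
    also have "\<dots> = Theta_plus B BB j \<bullet> j l" using BJ.Theta_plus_spec by simp
    finally show ?thesis .
  qed
  have minus: "(P (Theta_minus C A i) \<bullet> \<phi>) \<bullet> j l = Theta_minus B BB j \<bullet> j l" if l [simp]: "l \<in> Obj B" for l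
  proof -
    have "(P (Theta_minus C A i) \<bullet> \<phi>) \<bullet> j l = P (Theta_minus C A i \<cdot>\<^bsub>C\<^esub> i l)" using \<phi>j[OF l] by (simp add: P_cmp)
    also have "\<dots> = Ev D l \<bullet> (idD (Dual C l) \<odot> minv D (Twist D l))"
      using CA.Theta_minus_spec by (simp add: P_cmp P_ten P_struct) (simp add: P_cmp P_ten P_str)
    also have "\<dots> = Ev D l \<bullet> (idD (Dual C l) \<odot> minv B (Twist D l))"
      using D.sub_minv[OF D.twist_hom l l] by simp
    also have "\<dots> = Theta_minus B BB j \<bullet> j l" using BJ.Theta_minus_spec by simp
    finally show ?thesis .
  qed
  show "P (Theta_plus C A i) \<bullet> \<phi> = Theta_plus B BB j"
    by (rule split1_eq[of _ "\<I>\<^bsub>C\<^esub>"]) (use plus BJ.Theta_plus_spec in \<open>simp_all add: HomB, simp_all add: Hom_iff\<close>)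
  show "P (Theta_minus C A i) \<bullet> \<phi> = Theta_minus B BB j"
    by (rule split1_eq[of _ "\<I>\<^bsub>C\<^esub>"]) (use minus BJ.Theta_minus_spec in \<open>simp_all add: HomB, simp_all add: Hom_iff\<close>)
qed

section \<open>Scalars and negligible morphisms\<close>

lemma to_scalar_P: "f \<in> Hom C \<one>\<one> \<one>\<one> \<Longrightarrow> to_scalar D (P f) = to_scalar C f"
  unfolding D_def by (rule CA.Cs_to_scalar)

text \<open>Traces in the subcategory are traces of representatives in \<open>C\<close>. By fullness
  every test morphism of \<open>C\<close> is available, so a representative of a negligible class is
  itself negligible, and its class is zero.\<close>

lemma Negl_B:
  assumes "f \<in> Negl B X Y" shows "f = Zer D X Y"
proof -
  have f: "f \<in> Hom D X Y" "X \<in> Obj B" "Y \<in> Obj B" using assms by (auto simp: Negl_def HomB)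
  then obtain f0 where f0: "f = P f0" "f0 \<in> Hom C X Y" by (auto simp: D_def CA.Hom_Cs)
  note [simp] = CA.HomD[OF f0(2)]
  have "qtrace C (g \<cdot>\<^bsub>C\<^esub> f0) = 0" if g: "g \<in> Hom C Y X" for g
  proof -
    note [simp] = CA.HomD[OF g]
    have "P g \<in> Hom B Y X" using f unfolding HomB by (simp add: Hom_iff)
    then have "qtrace B (P g \<cdot>\<^bsub>B\<^esub> f) = 0" using assms by (simp add: Negl_def)
    then have "qtrace D (P (g \<cdot>\<^bsub>C\<^esub> f0)) = 0" by (simp add: D.sub_qtrace f0(1) P_cmp)
    then show ?thesis using CA.Cs_qtrace[of "g \<cdot>\<^bsub>C\<^esub> f0" X] by (simp add: D_def Hom_iff)
  qed
  then have "f0 \<in> Negl C X Y" using f0(2) by (simp add: Negl_def)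
  then show ?thesis using CA.proj_Zer[OF f0(2)] f0(1) by (simp add: D_def)
qed

lemma msub_Negl:
  assumes "f \<in> Hom C X Y" "g \<in> Hom C X Y" shows "msub C f g \<in> Negl C X Y \<longleftrightarrow> P f = P g"
  using CA.proj_eq[OF assms] assms by (simp add: CA.equiv_mor_def)

end

locale comparison_element = comparison C A i D B BB j \<Lambda> p q \<phi>
  for C :: "('o, 'm, 'k::field) rcat" and A i and D B :: "('o, 'm set, 'k) rcat" and BB j \<Lambda> p q \<phi> +
  fixes \<alpha> \<beta>
  assumes \<alpha>: "\<alpha> \<in> Hom C \<I>\<^bsub>C\<^esub> A" and \<beta>: "\<beta> \<in> Hom D \<I>\<^bsub>C\<^esub> BB" and \<alpha>\<beta>: "proj_mor C \<alpha> = \<phi> \<cdot>\<^bsub>D\<^esub> \<beta>"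
begin

section \<open>Transfer of the conditions on \<beta> to \<alpha>\<close>

lemma elt_ty [simp]: "\<alpha> \<in> Mor C" "Dom C \<alpha> = \<one>\<one>" "Cod C \<alpha> = A" "\<beta> \<in> Mor D" "Dom D \<beta> = \<one>\<one>" "Cod D \<beta> = BB"
  using \<alpha> \<beta> by (simp_all add: Hom_iff)

lemma Kirby_transfer:
  assumes K: "\<beta> \<in> Kirby B BB j" shows "\<alpha> \<in> Kirby C A i"
proof -
  let ?SC = "coend_antipode C A i" and ?SB = "coend_antipode B BB j"
  let ?GC = "Gamma_l C A i" and ?GB = "Gamma_l B BB j"
  note [simp] = CA.HomD[OF conjunct1[OF CA.antipode_spec]] D.HomD[OF conjunct1[OF conjunct1[OF BJ.antipode_spec[unfolded HomB]]]]
    CA.HomD[OF Gamma_hom(1)] D.HomD[OF Gamma_hom(2)]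
  have "msub D (?SB \<bullet> \<beta>) \<beta> \<in> Negl B \<one>\<one> BB" "msub D (?GB \<bullet> (\<beta> \<odot> \<beta>)) (\<beta> \<odot> \<beta>) \<in> Negl B \<one>\<one> (BB \<boxtimes> BB)"
    using K by (simp_all add: Kirby_def D.sub_structure)
  then have "msub D (?SB \<bullet> \<beta>) \<beta> = Zer D \<one>\<one> BB" "msub D (?GB \<bullet> (\<beta> \<odot> \<beta>)) (\<beta> \<odot> \<beta>) = Zer D \<one>\<one> (BB \<boxtimes> BB)"
    using Negl_B by blast+
  then have S: "?SB \<bullet> \<beta> = \<beta>" and G: "?GB \<bullet> (\<beta> \<odot> \<beta>) = \<beta> \<odot> \<beta>"
    using D.msub_eq_Zer[of "?SB \<bullet> \<beta>" "\<I>\<^bsub>C\<^esub>" BB \<beta>] D.msub_eq_Zer[of "?GB \<bullet> (\<beta> \<odot> \<beta>)" "\<I>\<^bsub>C\<^esub>" "BB \<boxtimes> BB" "\<beta> \<odot> \<beta>"]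
    by (simp_all add: Hom_iff)
  have "P (?SC \<cdot>\<^bsub>C\<^esub> \<alpha>) = (P ?SC \<bullet> \<phi>) \<bullet> \<beta>" by (simp add: \<alpha>\<beta> flip: P_cmp)
  also have "\<dots> = P \<alpha>" unfolding antipode_comparison by (simp add: S \<alpha>\<beta>)
  finally have 1: "msub C (?SC \<cdot>\<^bsub>C\<^esub> \<alpha>) \<alpha> \<in> Negl C \<one>\<one> A" by (subst msub_Negl) (simp_all add: Hom_iff)
  have "P (?GC \<cdot>\<^bsub>C\<^esub> (\<alpha> \<star>\<^bsub>C\<^esub> \<alpha>)) = P ?GC \<bullet> (P \<alpha> \<odot> P \<alpha>)" by (simp flip: P_cmp P_ten)
  also have "\<dots> = (P ?GC \<bullet> (\<phi> \<odot> \<phi>)) \<bullet> (\<beta> \<odot> \<beta>)" unfolding \<alpha>\<beta> by (simp add: D.fuse)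
  also have "\<dots> = (\<phi> \<odot> \<phi>) \<bullet> (\<beta> \<odot> \<beta>)" unfolding Gamma_comparison by (simp add: G)
  also have "\<dots> = P \<alpha> \<odot> P \<alpha>" unfolding \<alpha>\<beta> by (simp add: D.fuse)
  also have "\<dots> = P (\<alpha> \<star>\<^bsub>C\<^esub> \<alpha>)" by (simp add: P_ten)
  finally have 2: "msub C (?GC \<cdot>\<^bsub>C\<^esub> (\<alpha> \<star>\<^bsub>C\<^esub> \<alpha>)) (\<alpha> \<star>\<^bsub>C\<^esub> \<alpha>) \<in> Negl C \<one>\<one> (A \<boxtimes> A)"
    by (subst msub_Negl) (simp_all add: Hom_iff)
  show ?thesis using 1 2 \<alpha> by (simp add: Kirby_def)
qed

lemma Theta_transfer:
  "to_scalar C (Theta_plus C A i \<cdot>\<^bsub>C\<^esub> \<alpha>) = to_scalar B (Theta_plus B BB j \<cdot>\<^bsub>B\<^esub> \<beta>)"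
  "to_scalar C (Theta_minus C A i \<cdot>\<^bsub>C\<^esub> \<alpha>) = to_scalar B (Theta_minus B BB j \<cdot>\<^bsub>B\<^esub> \<beta>)"
proof -
  have "to_scalar C (t \<cdot>\<^bsub>C\<^esub> \<alpha>) = to_scalar D ((P t \<bullet> \<phi>) \<bullet> \<beta>)" if t: "t \<in> Hom C A \<one>\<one>" for t
  proof -
    note [simp] = CA.HomD[OF t]
    have "to_scalar C (t \<cdot>\<^bsub>C\<^esub> \<alpha>) = to_scalar D (P (t \<cdot>\<^bsub>C\<^esub> \<alpha>))" by (rule to_scalar_P[symmetric]) (simp add: Hom_iff)
    also have "P (t \<cdot>\<^bsub>C\<^esub> \<alpha>) = (P t \<bullet> \<phi>) \<bullet> \<beta>" by (simp add: \<alpha>\<beta> flip: P_cmp)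
    finally show ?thesis .
  qed
  then show "to_scalar C (Theta_plus C A i \<cdot>\<^bsub>C\<^esub> \<alpha>) = to_scalar B (Theta_plus B BB j \<cdot>\<^bsub>B\<^esub> \<beta>)"
    "to_scalar C (Theta_minus C A i \<cdot>\<^bsub>C\<^esub> \<alpha>) = to_scalar B (Theta_minus B BB j \<cdot>\<^bsub>B\<^esub> \<beta>)"
    using CA.Theta_plus_spec CA.Theta_minus_spec Theta_comparison by (simp_all add: D.sub_structure)
qed

end

section \<open>Invariants\<close>

text \<open>The label of a minimum is bounded because the event names a point of the tangle; this
  confines the evaluation to the colours of the actual components.\<close>

lemma has_diagramD:
  assumes "has_diagram T r D"
  shows "diagram_ok (bottom_word (ncomp T) r) D" "k < ncomp T \<Longrightarrow> odd (r k)" "Minimum a l j b \<in> set D \<Longrightarrow> l < ncomp T"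
proof -
  show "diagram_ok (bottom_word (ncomp T) r) D" "k < ncomp T \<Longrightarrow> odd (r k)" using assms unfolding has_diagram_def by blast+
  obtain hs where hs: "\<forall>m<length D. event_at T (hs ! m) (D ! m)" using assms by (auto simp: has_diagram_def)
  assume "Minimum a l j b \<in> set D"
  then obtain m where "m < length D" "D ! m = Minimum a l j b" by (auto simp: in_set_conv_nth)
  then have "event_at T (hs ! m) (Minimum a l j b)" using hs by metis
  then show "l < ncomp T" by (auto simp: points_at_def)
qed

text \<open>Colours enter through the initial word and the labels of minima only, since crossings
  and maxima act on strands already present.\<close>

lemma diagram_mor_cong:
  assumes "diagram_ok w D" "\<And>k j. (k, j) \<in> set w \<Longrightarrow> X k = X' k" "\<And>a k j b. Minimum a k j b \<in> set D \<Longrightarrow> X k = X' k"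
  shows "diagram_mor C X D w = diagram_mor C X' D w"
proof -
  have so: "section_obj C X w = section_obj C X' w" if "\<And>k j. (k, j) \<in> set w \<Longrightarrow> X k = X' k" for w
    unfolding section_obj_def using that
    by (intro arg_cong[of _ _ "ten_obs C"] map_cong) (auto simp: strand_obj_def split: prod.split)
  show ?thesis using assms
  proof (induction D arbitrary: w)
    case Nil
    then show ?case using so[of w] by simp
  next
    case (Cons x D)
    have ok: "event_ok w x" "diagram_ok (event_apply w x) D" using Cons.prems(1) by auto
    have st: "strand_obj C X p = strand_obj C X' p" "X (fst p) = X' (fst p)" if "p \<in> set w" for p
    proof -
      obtain k j where p: "p = (k, j)" by (cases p)
      then show "strand_obj C X p = strand_obj C X' p" "X (fst p) = X' (fst p)"
        using Cons.prems(2)[of k j] that by (simp_all add: strand_obj_def)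
    qed
    have core: "event_core C X w x = event_core C X' w x"
    proof (cases x)
      case (Crossing d e)
      then show ?thesis using ok(1) st(1)[of "w ! e"] st(1)[of "w ! (e + 1)"] by simp
    next
      case (Maximum e)
      then show ?thesis using ok(1) st(2)[of "w ! e"] nth_mem[of e w] by (cases "w ! e") auto
    next
      case (Minimum e k j d)
      then show ?thesis using Cons.prems(3)[of e k j d] by simp
    qed
    have "section_obj C X (take a w) = section_obj C X' (take a w)" "section_obj C X (drop a w) = section_obj C X' (drop a w)" for a
      by (intro so; use Cons.prems(2) in \<open>auto dest: in_set_takeD in_set_dropD\<close>)+
    then have "event_mor C X w x = event_mor C X' w x" by (simp add: event_mor_def core split: prod.split)
    moreover have "diagram_mor C X D (event_apply w x) = diagram_mor C X' D (event_apply w x)"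
    proof (rule Cons.IH[OF ok(2)])
      show "X k = X' k" if "(k, j) \<in> set (event_apply w x)" for k j
      proof -
        have "(k, j) \<in> set w \<union> event_pieces x" using event_apply_pieces[OF ok(1)] that by blast
        then consider "(k, j) \<in> set w" | a l b where "x = Minimum a k l b" by (cases x) auto
        then show ?thesis
        proof cases
          case 1
          then show ?thesis by (rule Cons.prems(2))
        next
          case (2 a l b)
          then show ?thesis using Cons.prems(3)[of a k l b] by simp
        qed
      qed
      show "X k = X' k" if "Minimum a k j b \<in> set D" for a k j b using Cons.prems(3)[of a k j b] that by simp
    qed
    ultimately show ?case by simp
  qed
qed

context ribbon_coend
begin

text \<open>The morphism \<phi> attached to one fixed diagram, with colours that are objects at all
  indices, as in the lemmas on iterated coends.\<close>

definition diag_phi where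
  "diag_phi n r D \<phi> \<longleftrightarrow> \<phi> \<in> Hom C (Apow n) \<I> \<and>
     (\<forall>X. (\<forall>k. X k \<in> Obj C) \<longrightarrow> diagram_mor C X D (bottom_word n r) = \<phi> \<cdot> imors n X)"

lemma diag_phi_ex:
  assumes "has_diagram T r D" obtains \<phi> where "diag_phi (ncomp T) r D \<phi>"
  using diagram_phi_ex[OF has_diagramD(1,2)[OF assms]] by (auto simp: diag_phi_def)

lemma is_phi_iff:
  "is_phi C A i T \<phi> \<longleftrightarrow> (\<exists>T' r D. tangle_isotopic T T' \<and> has_diagram T' r D \<and> diag_phi (ncomp T) r D \<phi>)"
proof
  assume "is_phi C A i T \<phi>"
  then obtain T' r D where "tangle_isotopic T T'" "has_diagram T' r D" and \<phi>: "\<phi> \<in> Hom C (Apow (ncomp T)) \<I>"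
    and "\<forall>X. (\<forall>k<ncomp T. X k \<in> Obj C) \<longrightarrow> diagram_mor C X D (bottom_word (ncomp T) r) = \<phi> \<cdot> imors (ncomp T) X"
    by (auto simp: is_phi_def represents_def)
  then show "\<exists>T' r D. tangle_isotopic T T' \<and> has_diagram T' r D \<and> diag_phi (ncomp T) r D \<phi>"
    unfolding diag_phi_def by blast
next
  assume "\<exists>T' r D. tangle_isotopic T T' \<and> has_diagram T' r D \<and> diag_phi (ncomp T) r D \<phi>"
  then obtain T' r D where iso: "tangle_isotopic T T'" and D: "has_diagram T' r D" and \<phi>: "diag_phi (ncomp T) r D \<phi>"
    by blast
  have n: "ncomp T' = ncomp T" using iso by (simp add: tangle_isotopic_def)
  have "diagram_mor C X D (bottom_word (ncomp T) r) = \<phi> \<cdot> imors (ncomp T) X" if X: "\<forall>k<ncomp T. X k \<in> Obj C" for X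
  proof -
    \<comment> \<open>\<open>is_phi\<close> constrains only the first \<open>ncomp T\<close>
      colours. The others are filled with the unit object, which changes neither side of the
      equation.\<close>
    let ?X = "\<lambda>k. if k < ncomp T then X k else \<I>"
    have "diagram_mor C X D (bottom_word (ncomp T) r) = diagram_mor C ?X D (bottom_word (ncomp T) r)"
      by (rule diagram_mor_cong) (use has_diagramD[OF D] n in \<open>auto simp: bottom_word_mem\<close>)
    also have "\<dots> = \<phi> \<cdot> imors (ncomp T) ?X" using \<phi> X unfolding diag_phi_def by simp
    also have "imors (ncomp T) ?X = imors (ncomp T) X" by (rule imors_cong) simp
    finally show ?thesis .
  qed
  then show "is_phi C A i T \<phi>"
    using iso D \<phi> unfolding is_phi_def represents_def diag_phi_def by blast
qed

end

context comparison_element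
begin

section \<open>Equality of the link and manifold invariants\<close>

lemma ten_obs_D [simp]: "ten_obs D = ten_obs C"
  by (rule ext) (simp add: ten_obs_def)

lemma ten_obs_B [simp]: "ten_obs B = ten_obs C"
  by (simp add: D.sub_structure)

lemma P_ten_mors: "set fs \<subseteq> Mor C \<Longrightarrow> ten_mors D (map P fs) = P (ten_mors C fs)"
  by (induction fs) (simp_all add: P_ten, simp add: P_str)

lemma pow_ty:
  assumes [simp]: "f \<in> Mor D" "Dom D f = X" "Cod D f = Y"
  shows "ten_mors D (replicate n f) \<in> Mor D" "Dom D (ten_mors D (replicate n f)) = ten_obs C (replicate n X)"
    "Cod D (ten_mors D (replicate n f)) = ten_obs C (replicate n Y)"
proof -
  have "set (replicate n f) \<subseteq> Mor D" by auto
  from D.ten_mors_ty[OF this] show "ten_mors D (replicate n f) \<in> Mor D"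
    "Dom D (ten_mors D (replicate n f)) = ten_obs C (replicate n X)"
    "Cod D (ten_mors D (replicate n f)) = ten_obs C (replicate n Y)" by simp_all
qed

lemma replicate_map: "replicate n f = map (\<lambda>_. f) [0..<n]"
  by (simp add: map_replicate_const)

text \<open>Both sides end in the unit object, which lies in \<B>, so uniqueness out of powers of
  the coend of \<B> applies directly. On the dinatural families both give the evaluation of the same
  diagram.\<close>

lemma diag_phi_comparison:
  assumes D: "has_diagram T r E" and f: "CA.diag_phi (ncomp T) r E f" and g: "BJ.diag_phi (ncomp T) r E g"
  shows "g = P f \<bullet> ten_mors D (replicate (ncomp T) \<phi>)"
proof (rule BJ.phi_unique[of _ "ncomp T"])
  let ?n = "ncomp T" and ?w = "bottom_word (ncomp T) r"
  have fh: "f \<in> Hom C (CA.Apow ?n) \<one>\<one>" using f by (simp add: CA.diag_phi_def)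
  note [simp] = CA.HomD[OF fh] pow_ty[OF \<phi>_ty]
  show "g \<in> Hom B (BJ.Apow ?n) \<I>\<^bsub>B\<^esub>" using g by (simp add: BJ.diag_phi_def)
  show "P f \<bullet> ten_mors D (replicate ?n \<phi>) \<in> Hom B (BJ.Apow ?n) \<I>\<^bsub>B\<^esub>"
    using BJ.Apow_obj[of ?n] unfolding HomB by (simp add: Hom_iff)
  fix X assume X: "\<And>k::nat. X k \<in> Obj B"
  then have [simp]: "X k \<in> Obj B" "X k \<in> Obj C" for k by simp_all
  have s: "set (map (\<lambda>k. j (X k)) [0..<?n]) \<subseteq> Mor D" "set (map (\<lambda>k. i (X k)) [0..<?n]) \<subseteq> Mor C" by auto
  have "ten_mors D (replicate ?n \<phi>) \<bullet> ten_mors D (map (\<lambda>k. j (X k)) [0..<?n])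
      = ten_mors D (map (\<lambda>k. \<phi> \<bullet> j (X k)) [0..<?n])"
    unfolding replicate_map by (rule D.ten_mors_fuse) simp_all
  also have "\<dots> = ten_mors D (map P (map (\<lambda>k. i (X k)) [0..<?n]))" using \<phi>j by (simp add: comp_def)
  also have "\<dots> = P (CA.imors ?n X)" by (rule P_ten_mors[OF s(2)])
  finally have e: "ten_mors D (replicate ?n \<phi>) \<bullet> ten_mors D (map (\<lambda>k. j (X k)) [0..<?n]) = P (CA.imors ?n X)" .
  have jd: "Cod D (ten_mors D (map (\<lambda>k. j (X k)) [0..<?n])) = ten_obs C (replicate ?n BB)"
    using D.ten_mors_ty(3)[OF s(1)] by (simp add: comp_def map_replicate_const)
  have "(P f \<bullet> ten_mors D (replicate ?n \<phi>)) \<bullet> ten_mors D (map (\<lambda>k. j (X k)) [0..<?n])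
      = P f \<bullet> ten_mors D (replicate ?n \<phi>) \<bullet> ten_mors D (map (\<lambda>k. j (X k)) [0..<?n])"
    by (rule D.cmp_asc) (use D.ten_mors_ty(1)[OF s(1)] jd in simp_all)
  also have "\<dots> = P (f \<cdot>\<^bsub>C\<^esub> CA.imors ?n X)"
    unfolding e by (rule P_cmp) (simp_all add: CA.imors_ty)
  also have "\<dots> = P (diagram_mor C X E ?w)" using f by (simp add: CA.diag_phi_def)
  also have "\<dots> = diagram_mor D X E ?w"
    using CA.Cs_diagram_mor[of X, OF _ has_diagramD(1)[OF D]] by (simp add: D_def)
  also have "\<dots> = diagram_mor B X E ?w" using D.sub_diagram_mor[of X] by simp
  also have "\<dots> = g \<cdot>\<^bsub>B\<^esub> BJ.imors ?n X" using g by (simp add: BJ.diag_phi_def)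
  finally show "g \<cdot>\<^bsub>B\<^esub> BJ.imors ?n X = (P f \<bullet> ten_mors D (replicate ?n \<phi>)) \<cdot>\<^bsub>B\<^esub> BJ.imors ?n X"
    by (simp add: D.sub_structure)
qed

lemma diag_phi_scalar:
  assumes D: "has_diagram T r E" and f: "CA.diag_phi (ncomp T) r E f" and g: "BJ.diag_phi (ncomp T) r E g"
  shows "to_scalar C (f \<cdot>\<^bsub>C\<^esub> ten_mors C (replicate (ncomp T) \<alpha>)) = to_scalar B (g \<cdot>\<^bsub>B\<^esub> ten_mors B (replicate (ncomp T) \<beta>))"
proof -
  let ?n = "ncomp T"
  have fh: "f \<in> Hom C (CA.Apow ?n) \<one>\<one>" using f by (simp add: CA.diag_phi_def)
  have s: "set (replicate ?n \<alpha>) \<subseteq> Mor C" by auto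
  have u: "ten_obs C (replicate n \<one>\<one>) = \<one>\<one>" for n by (induction n) simp_all
  have \<alpha>n: "ten_mors C (replicate ?n \<alpha>) \<in> Mor C" "Dom C (ten_mors C (replicate ?n \<alpha>)) = \<one>\<one>"
    "Cod C (ten_mors C (replicate ?n \<alpha>)) = CA.Apow ?n" using CA.ten_mors_ty[OF s] u by simp_all
  note [simp] = CA.HomD[OF fh] pow_ty[OF \<phi>_ty] pow_ty[OF elt_ty(4-6)] \<alpha>n
  have "P (ten_mors C (replicate ?n \<alpha>)) = ten_mors D (map P (replicate ?n \<alpha>))" by (rule P_ten_mors[OF s, symmetric])
  also have "\<dots> = ten_mors D (map (\<lambda>_. \<phi> \<bullet> \<beta>) [0..<?n])" by (simp add: \<alpha>\<beta> map_replicate_const)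
  also have "\<dots> = ten_mors D (replicate ?n \<phi>) \<bullet> ten_mors D (replicate ?n \<beta>)"
    unfolding replicate_map by (rule D.ten_mors_fuse[symmetric]) simp_all
  finally have "P (f \<cdot>\<^bsub>C\<^esub> ten_mors C (replicate ?n \<alpha>)) = P f \<bullet> ten_mors D (replicate ?n \<phi>) \<bullet> ten_mors D (replicate ?n \<beta>)"
    by (simp flip: P_cmp)
  also have "\<dots> = g \<bullet> ten_mors D (replicate ?n \<beta>)" by (simp add: diag_phi_comparison[OF assms])
  finally have "P (f \<cdot>\<^bsub>C\<^esub> ten_mors C (replicate ?n \<alpha>)) = g \<bullet> ten_mors D (replicate ?n \<beta>)" .
  then show ?thesis using to_scalar_P[of "f \<cdot>\<^bsub>C\<^esub> ten_mors C (replicate ?n \<alpha>)"]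
    by (simp add: D.sub_structure Hom_iff)
qed

text \<open>Every diagram has its morphism out of the tensor power in both categories, so a diagram
  that produces the value \<open>c\<close> on one side produces it on the other.\<close>

lemma phi_transfer:
  "(\<exists>f. is_phi C A i T f \<and> c = to_scalar C (f \<cdot>\<^bsub>C\<^esub> ten_mors C (replicate (ncomp T) \<alpha>))) \<longleftrightarrow>
   (\<exists>g. is_phi B BB j T g \<and> c = to_scalar B (g \<cdot>\<^bsub>B\<^esub> ten_mors B (replicate (ncomp T) \<beta>)))"
proof
  assume "\<exists>f. is_phi C A i T f \<and> c = to_scalar C (f \<cdot>\<^bsub>C\<^esub> ten_mors C (replicate (ncomp T) \<alpha>))"
  then obtain f T' r E where f: "tangle_isotopic T T'" "has_diagram T' r E" "CA.diag_phi (ncomp T) r E f"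
    "c = to_scalar C (f \<cdot>\<^bsub>C\<^esub> ten_mors C (replicate (ncomp T) \<alpha>))"
    unfolding CA.is_phi_iff by blast
  have n: "ncomp T' = ncomp T" using f(1) by (simp add: tangle_isotopic_def)
  obtain g where g: "BJ.diag_phi (ncomp T) r E g" using BJ.diag_phi_ex[OF f(2)] n by metis
  have "is_phi B BB j T g" unfolding BJ.is_phi_iff using f(1,2) g by blast
  then show "\<exists>g. is_phi B BB j T g \<and> c = to_scalar B (g \<cdot>\<^bsub>B\<^esub> ten_mors B (replicate (ncomp T) \<beta>))"
    using diag_phi_scalar[OF f(2), unfolded n, OF f(3) g] f(4) by metis
next
  assume "\<exists>g. is_phi B BB j T g \<and> c = to_scalar B (g \<cdot>\<^bsub>B\<^esub> ten_mors B (replicate (ncomp T) \<beta>))"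
  then obtain g T' r E where g: "tangle_isotopic T T'" "has_diagram T' r E" "BJ.diag_phi (ncomp T) r E g"
    "c = to_scalar B (g \<cdot>\<^bsub>B\<^esub> ten_mors B (replicate (ncomp T) \<beta>))"
    unfolding BJ.is_phi_iff by blast
  have n: "ncomp T' = ncomp T" using g(1) by (simp add: tangle_isotopic_def)
  obtain f where f: "CA.diag_phi (ncomp T) r E f" using CA.diag_phi_ex[OF g(2)] n by metis
  have "is_phi C A i T f" unfolding CA.is_phi_iff using g(1,2) f by blast
  then show "\<exists>f. is_phi C A i T f \<and> c = to_scalar C (f \<cdot>\<^bsub>C\<^esub> ten_mors C (replicate (ncomp T) \<alpha>))"
    using diag_phi_scalar[OF g(2), unfolded n, OF f g(3)] g(4) by metis
qed

text \<open>The two definite descriptions range over the same values, diagram by diagram; neither isotopy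
  invariance nor independence of the special tangle enters.\<close>

lemma tau_link_transfer: "tau_link C A i L \<alpha> = tau_link B BB j L \<beta>"
proof -
  let ?S = "\<lambda>T K. special_tangle T \<and> cup_closure T K \<and> link_isotopic L (to_sphere K)"
  have "(\<exists>T K f. special_tangle T \<and> cup_closure T K \<and> link_isotopic L (to_sphere K) \<and> is_phi C A i T f \<and>
      c = to_scalar C (f \<cdot>\<^bsub>C\<^esub> ten_mors C (replicate (ncomp T) \<alpha>))) \<longleftrightarrow>
    (\<exists>T K f. special_tangle T \<and> cup_closure T K \<and> link_isotopic L (to_sphere K) \<and> is_phi B BB j T f \<and>
      c = to_scalar B (f \<cdot>\<^bsub>B\<^esub> ten_mors B (replicate (ncomp T) \<beta>)))" (is "?l \<longleftrightarrow> ?r") for c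
  proof -
    have "?l \<longleftrightarrow> (\<exists>T K. ?S T K \<and> (\<exists>f. is_phi C A i T f \<and> c = to_scalar C (f \<cdot>\<^bsub>C\<^esub> ten_mors C (replicate (ncomp T) \<alpha>))))"
      by blast
    also have "\<dots> \<longleftrightarrow> ?r" unfolding phi_transfer by blast
    finally show ?thesis .
  qed
  then show ?thesis unfolding tau_link_def by (simp only:)
qed

lemma tau_manifold_transfer: "tau_manifold C A i M At \<alpha> = tau_manifold B BB j M At \<beta>"
  unfolding tau_manifold_def Theta_transfer tau_link_transfer ..

lemma Kirby_norm_transfer: "\<beta> \<in> Kirby_norm B BB j \<Longrightarrow> \<alpha> \<in> Kirby_norm C A i"
  by (simp add: Kirby_norm_def Theta_transfer Kirby_transfer)

end

text \<open>The relation between \<phi>, \<open>j\<close> and \<open>i\<close> is tested on the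
  injections of a decomposition of \<open>X\<close>. These lift to morphisms of \<open>C\<close>,
  where \<open>i\<close> is dinatural, and at the representatives the relation holds by the
  construction of \<phi> on the summands.\<close>

lemma comparison_semisimple:
  fixes C :: "('o, 'm, 'k::field) rcat" and B :: "('o, 'm set, 'k) rcat"
  assumes C: "ribbon_k_category C" and A: "is_coend C A i"
    and sub: "full_ribbon_abelian_subcategory B (semisimplification C)"
    and ss: "semisimple_category B" and sc: "\<forall>X. simple_object B X \<longrightarrow> scalar_object B X"
    and rep: "simple_representatives B \<Lambda>" and ds: "is_direct_sum B \<Lambda> (\<lambda>l. Dual B l \<diamondop>\<^bsub>B\<^esub> l) BB p q"
    and j: "j = semisimple_coend_mor B \<Lambda> BB q" and \<phi>: "\<phi> = comparison_mor C A i \<Lambda> BB p"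
  shows "comparison C A i (semisimplification C) B BB j \<Lambda> p q \<phi>"
proof -
  interpret CA: ribbon_coend C A i using C A by (simp add: ribbon_coend_def ribbon_coend_axioms_def)
  obtain D where D: "D = semisimplification C" by simp
  interpret D: full_ribbon_subcategory D B "Obj B"
    unfolding D using CA.semisimplification_ribbon sub
    by (simp add: full_ribbon_subcategory_def full_ribbon_subcategory_axioms_def full_ribbon_abelian_subcategory_def)
  have Brib: "ribbon_k_category B" by (rule D.sub_ribbon)
  have ab: "abelian_category B" using sub by (simp add: full_ribbon_abelian_subcategory_def)
  note coB = ribbon_k_category.semisimple_coend[OF Brib ab ss sc rep ds j]
  interpret BJ: ribbon_coend B BB j using Brib coB(1) by (simp add: ribbon_coend_def ribbon_coend_axioms_def)
  have selD: "Obj D = Obj C" "TOb D = TOb C" "Dual D = Dual C" "TUnit D = TUnit C" by (simp_all add: D)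
  have dsD: "is_direct_sum D \<Lambda> (\<lambda>l. Dual D l \<diamondop>\<^bsub>D\<^esub> l) BB p q"
    using D.sub_direct_sum(1)[OF ds] by (simp add: D.sub_sel(2-))
  have \<Lambda>: "\<Lambda> \<subseteq> Obj B" using rep by (auto simp: simple_representatives_def simple_object_def)
  then have \<Lambda>C: "l \<in> Obj C" if "l \<in> \<Lambda>" for l using that D.Ob(1) selD by auto
  have AC: "A \<in> Obj D" by (simp add: selD)
  have Pi: "proj_mor C (i X) \<in> Hom D (Dual D X \<diamondop>\<^bsub>D\<^esub> X) A" if "X \<in> Obj C" for X
    using that by (simp add: D)
  note ph = D.direct_sumD[OF dsD]
  have \<phi>D: "\<phi> = msum D BB A (\<lambda>l. proj_mor C (i l) \<cdot>\<^bsub>D\<^esub> p l) \<Lambda>"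
    by (simp add: \<phi> comparison_mor_def D Let_def)
  have g: "\<phi> \<in> Hom D BB A" "\<And>b. b \<in> \<Lambda> \<Longrightarrow> \<phi> \<cdot>\<^bsub>D\<^esub> q b = proj_mor C (i b)"
    unfolding \<phi>D by (rule D.direct_sum_copair[OF dsD _ AC]; use Pi[OF \<Lambda>C] in blast)+
  have "comparison C A i D B BB j \<Lambda> p q \<phi>"
  proof unfold_locales
    show "D = semisimplification C" by (rule D)
    show "is_direct_sum D \<Lambda> (\<lambda>l. Dual D l \<diamondop>\<^bsub>D\<^esub> l) BB p q" by (rule dsD)
    show "\<Lambda> \<subseteq> Obj B" by (rule \<Lambda>)
    show "j l = q l" if l: "l \<in> \<Lambda>" for l
    proof -
      have lB: "l \<in> Obj B" using l \<Lambda> by blast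
      note [simp] = BJ.HomD[OF BJ.direct_sumD(5)[OF ds l]]
      show ?thesis using coB(2)[OF l BJ.id_hom[OF lB]] lB by simp
    qed
    show "\<phi> \<in> Hom D BB A" by (rule g(1))
    fix X assume X: "X \<in> Obj B"
    then have XC: "X \<in> Obj C" using D.Ob(1) selD by auto
    have jX: "j X \<in> Hom D (Dual D X \<diamondop>\<^bsub>D\<^esub> X) BB"
      using BJ.i_hom[OF X] unfolding D.sub_Hom_iff D.sub_sel(2-) by blast
    have XD: "X \<in> Obj D" using X D.Ob(1) by blast
    note [simp] = XD D.HomD[OF jX] D.HomD[OF Pi[OF XC]] D.HomD[OF g(1)]
    obtain n :: nat and l pX qX where dec: "is_direct_sum B {..<n} l X pX qX" "l ` {..<n} \<subseteq> \<Lambda>"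
      using BJ.semisimple_decomposition[OF ss rep X] .
    show "\<phi> \<cdot>\<^bsub>D\<^esub> j X = proj_mor C (i X)"
    proof (rule D.direct_sum_right_eq[OF D.sub_direct_sum(1)[OF dec(1)], of _ "Dual D X" A])
      fix k assume k: "k \<in> {..<n}"
      then have lk: "l k \<in> \<Lambda>" using dec(2) by blast
      have qB: "qX k \<in> Hom B (l k) X" using BJ.direct_sumD(5)[OF dec(1) k] .
      then have qD: "qX k \<in> Hom D (l k) X" by (simp add: D.sub_Hom_iff)
      then obtain f where f: "qX k = proj_mor C f" "f \<in> Hom C (l k) X" unfolding D CA.Hom_Cs by blast
      note [simp] = D.HomD[OF qD] D.HomD[OF ph(5)[OF lk]] CA.HomD[OF f(2)] \<Lambda>C[OF lk]
      have "(\<phi> \<cdot>\<^bsub>D\<^esub> j X) \<cdot>\<^bsub>D\<^esub> (Idm D (Dual D X) \<star>\<^bsub>D\<^esub> qX k) = \<phi> \<cdot>\<^bsub>D\<^esub> q (l k) \<cdot>\<^bsub>D\<^esub> (dual_mor D (qX k) \<star>\<^bsub>D\<^esub> Idm D (l k))"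
        using coB(2)[OF lk qB] by (simp add: D.sub_sel(2-) D.sub_dual_mor)
      also have "\<dots> = (\<phi> \<cdot>\<^bsub>D\<^esub> q (l k)) \<cdot>\<^bsub>D\<^esub> (dual_mor D (qX k) \<star>\<^bsub>D\<^esub> Idm D (l k))" by simp
      also have "\<dots> = proj_mor C (i X) \<cdot>\<^bsub>D\<^esub> (Idm D (Dual D X) \<star>\<^bsub>D\<^esub> qX k)"
        unfolding g(2)[OF lk] f(1) using CA.i_dinat[OF f(2)] by (simp add: D)
      finally show "(\<phi> \<cdot>\<^bsub>D\<^esub> j X) \<cdot>\<^bsub>D\<^esub> (Idm D (Dual D X) \<star>\<^bsub>D\<^esub> qX k) = proj_mor C (i X) \<cdot>\<^bsub>D\<^esub> (Idm D (Dual D X) \<star>\<^bsub>D\<^esub> qX k)" .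
    qed (simp_all add: Hom_iff)
  qed
  then show ?thesis by (simp only: D)
qed

theorem mainTheorem5:
  fixes C :: "('o, 'm, 'k::field) rcat"
    and A :: 'o and i :: "'o \<Rightarrow> 'm"
    and B :: "('o, 'm set, 'k) rcat"
    and \<Lambda> :: "'o set" and BB :: 'o and p q j :: "'o \<Rightarrow> 'm set"
    and \<phi> \<beta> :: "'m set" and \<alpha> :: 'm
  assumes "ribbon_k_category C"
    and "finite_dim_homs C"
    and "is_coend C A i"
    and "full_ribbon_abelian_subcategory B (semisimplification C)"
    and "semisimple_category B"
    and "finitely_many_simples B"
    and "\<forall>X. simple_object B X \<longrightarrow> scalar_object B X"
    and "simple_representatives B \<Lambda>"
    and "is_direct_sum B \<Lambda> (\<lambda>l. Dual B l \<diamondop>\<^bsub>B\<^esub> l) BB p q"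
    and "j = semisimple_coend_mor B \<Lambda> BB q"
    and "\<phi> = comparison_mor C A i \<Lambda> BB p"
    and "\<beta> \<in> Hom B \<I>\<^bsub>B\<^esub> BB"
    and "\<alpha> \<in> Hom C \<I>\<^bsub>C\<^esub> A"
    and "proj_mor C \<alpha> = \<phi> \<cdot>\<^bsub>semisimplification C\<^esub> \<beta>"
  shows "(\<beta> \<in> Kirby B BB j \<longrightarrow>
           \<alpha> \<in> Kirby C A i \<and>
           (\<forall>L. framed_link L \<longrightarrow> tau_link C A i L \<alpha> = tau_link B BB j L \<beta>))
     \<and> (\<beta> \<in> Kirby_norm B BB j \<longrightarrow>
           \<alpha> \<in> Kirby_norm C A i \<and>
           (\<forall>(M :: 'x topology) At. closed_oriented_3_manifold M At \<longrightarrow>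
              tau_manifold C A i M At \<alpha> = tau_manifold B BB j M At \<beta>))"
proof -
  interpret comparison C A i "semisimplification C" B BB j \<Lambda> p q \<phi>
    using assms by (intro comparison_semisimple) simp_all
  interpret comparison_element C A i "semisimplification C" B BB j \<Lambda> p q \<phi> \<alpha> \<beta>
    by unfold_locales (use assms(12-14) in \<open>simp_all add: HomB\<close>)
  show ?thesis
    using Kirby_transfer Kirby_norm_transfer tau_link_transfer tau_manifold_transfer by blast
qed


end
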